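(* Let $q\geq 3$ be odd. For each reduced fraction $(v,w)$ with $v/w\in\Gamma_q.\infty\cap(0,1]$, \[ \operatorname*{w^*\text{-}lim}_{n\to\infty}\; c_{v/w}\,vw\,\log(n)\sum_{(r,s)\in \mathrm{RF}_{q,n}(v,w)}\frac{1}{s^2}\,\delta_{r/s}=m, \] where $c_1=2$ and $c_y=1$ for $y\neq 1$. (Weak-star convergence means convergence of integrals against every continuous function on $[0,1]$.)
   Context: Setup. Let $q\geq 3$ be odd and $\lambda=\lambda_q=2\cos(\pi/q)$. Elements of $\mathrm{PGL}_2(\mathbb{R})$ are written as matrices (a matrix and its nonzero scalar multiples represent the same element); they act on $\mathbb{R}\cup\{\infty\}$ by $x\mapsto (ax+b)/(cx+d)$, written $g.x$. The Hecke triangle group $\Gamma_q\subset\mathrm{PSL}_2(\mathbb{R})$ is generated by $T=\begin{bmatrix}1&\lambda\\0&1\end{bmatrix}$ and $S=\begin{bmatrix}0&1\\-1&0\end{bmatrix}$. Put $s(x)=\sin(x\pi/q)/\sin(\pi/q)$, $g_k=\begin{bmatrix}s(k)&-s(k+1)\\-s(k-1)&s(k)\end{bmatrix}\in\Gamma_q$, $Q=\begin{bmatrix}0&1\\1&0\end{bmatrix}$, $K=\{(q+1)/2,\dots,q-1\}$. The generalized Farey map $F_q\colon[0,1]\to[0,1]$ is defined, for $k\in K$, by $F_q(x)=g_k.x$ on $[g_k^{-1}.0,g_k^{-1}.1]$ and $F_q(x)=Qg_k.x$ on $[(Qg_k)^{-1}.1,(Qg_k)^{-1}.0]$. A pair $(a,c)\in\mathbb{Z}[\lambda]^2$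 is a reduced fraction if some element of $\Gamma_q$ has a representing matrix of determinant $1$ of the form $\begin{bmatrix}a&*\\c&*\end{bmatrix}$; $(a,c)$ and $(-a,-c)$ are identified, and the class is identified with $a/c\in\mathbb{R}\cup\{\infty\}$ (each point of $\Gamma_q.\infty$ has a unique such representation). For a reduced fraction $(v,w)$ with $v/w\in\Gamma_q.\infty\cap[0,1]$, $\mathrm{RF}_{q,n}(v,w)$ is the set of reduced fractions $(r,s)$ with $r/s\in F_q^{-n}(v/w)$. $m$ is Lebesgue measure on $[0,1]$; $\delta_y$ is the Dirac measure at $y$. *)

theory Defs
  imports "HOL-Analysis.Analysis"
begin

text \<open>2x2 real matrices [a b; c d] represented as quadruples (a,b,c,d).\<close>
type_synonym mat2 = "real \<times> real \<times> real \<times> real"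

fun mmul :: "mat2 \<Rightarrow> mat2 \<Rightarrow> mat2" where
  "mmul (a,b,c,d) (e,f,g,h) = (a*e + b*g, a*f + b*h, c*e + d*g, c*f + d*h)"

fun mdet :: "mat2 \<Rightarrow> real" where
  "mdet (a,b,c,d) = a*d - b*c"

text \<open>Inverse up to scalar (adjugate); represents the inverse in PGL2.\<close>
fun madj :: "mat2 \<Rightarrow> mat2" where
  "madj (a,b,c,d) = (d, -b, -c, a)"

text \<open>Moebius action on finite real points x (with c*x+d \<noteq> 0).\<close>
fun mact :: "mat2 \<Rightarrow> real \<Rightarrow> real" where
  "mact (a,b,c,d) x = (a*x + b) / (c*x + d)"

definition lam :: "nat \<Rightarrow> real" where
  "lam q = 2 * cos (pi / real q)"

definition Tm :: "nat \<Rightarrow> mat2" where "Tm q = (1, lam q, 0, 1)"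
definition Tinv :: "nat \<Rightarrow> mat2" where "Tinv q = (1, - lam q, 0, 1)"
definition Sm :: mat2 where "Sm = (0, 1, -1, 0)"
definition Qm :: mat2 where "Qm = (0, 1, 1, 0)"

text \<open>The determinant-one representatives of elements of the Hecke group:
  the subgroup of SL2(R) generated by T and S (it contains -I = S^2).\<close>
inductive_set hecke_SL :: "nat \<Rightarrow> mat2 set" for q where
  one: "(1,0,0,1) \<in> hecke_SL q"
| mulT: "M \<in> hecke_SL q \<Longrightarrow> mmul M (Tm q) \<in> hecke_SL q"
| mulTinv: "M \<in> hecke_SL q \<Longrightarrow> mmul M (Tinv q) \<in> hecke_SL q"
| mulS: "M \<in> hecke_SL q \<Longrightarrow> mmul M Sm \<in> hecke_SL q"

definition sq :: "nat \<Rightarrow> real \<Rightarrow> real" where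
  "sq q x = sin (x * pi / real q) / sin (pi / real q)"

definition gk :: "nat \<Rightarrow> nat \<Rightarrow> mat2" where
  "gk q k = (sq q k, - sq q (real k + 1), - sq q (real k - 1), sq q k)"

definition Kset :: "nat \<Rightarrow> nat set" where
  "Kset q = {(q+1) div 2 .. q - 1}"

text \<open>The generalized Farey map. The branch intervals cover [0,1] and the
  branches agree at common endpoints, so the choice below is unambiguous.\<close>
definition farey :: "nat \<Rightarrow> real \<Rightarrow> real" where
  "farey q x = (SOME y. \<exists>k\<in>Kset q.
      (x \<in> {mact (madj (gk q k)) 0 .. mact (madj (gk q k)) 1} \<and> y = mact (gk q k) x) \<or>
      (x \<in> {mact (madj (mmul Qm (gk q k))) 1 .. mact (madj (mmul Qm (gk q k))) 0}
         \<and> y = mact (mmul Qm (gk q k)) x))"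

definition Zlam :: "nat \<Rightarrow> real set" where
  "Zlam q = {x. \<exists>n (c::nat \<Rightarrow> int). x = (\<Sum>i<n. of_int (c i) * lam q ^ i)}"

definition reduced_fraction :: "nat \<Rightarrow> real \<Rightarrow> real \<Rightarrow> bool" where
  "reduced_fraction q a c \<longleftrightarrow> a \<in> Zlam q \<and> c \<in> Zlam q \<and>
     (\<exists>b d. (a,b,c,d) \<in> hecke_SL q)"

text \<open>RF_{q,n}(v,w): reduced fractions (r,s) with r/s in F_q^{-n}(v/w).
  Classes {(r,s),(-r,-s)} are represented by the representative with s > 0
  (r/s lies in [0,1], so s \<noteq> 0).\<close>
definition RF :: "nat \<Rightarrow> nat \<Rightarrow> real \<Rightarrow> real \<Rightarrow> (real \<times> real) set" where
  "RF q n v w = {(r,s). reduced_fraction q r s \<and> s > 0 \<and> r / s \<in> {0..1} \<and>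
                       (farey q ^^ n) (r / s) = v / w}"

definition cconst :: "real \<Rightarrow> real" where
  "cconst y = (if y = 1 then 2 else 1)"

end

theory Submission
  imports Defs "HOL-Real_Asymp.Real_Asymp"
begin

text \<open>
  Summing over preimages under \<open>F\<^sub>q\<^sup>n\<close> amounts to applying the \<open>n\<close>-th power of the transfer operator
  \<open>P\<close>, whose invariant density is \<open>1/x\<close>; one has to show that \<open>y ln n (P\<^sup>n f)(y)\<close> tends to the
  integral of \<open>f\<close>. In the coordinate \<open>z = (1 - x)/(1 + x)\<close> the involution \<open>Q\<close> is \<open>z \<mapsto> -z\<close>, so that
  \<open>G(z) = x f(x)\<close> is mapped to \<open>E G(z) + E G(-z)\<close> for an operator \<open>E\<close> that turns decreasing concave
  functions on \<open>[0,1]\<close> into concave functions on \<open>[-1,1]\<close>; an even concave function is decreasing on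
  \<open>[0,1]\<close>. Hence decreasing concave \<open>G\<close> stay decreasing and concave, and then \<open>a\<^sub>n = (P\<^sup>n f)(1)\<close> is
  decreasing in \<open>n\<close> and controls \<open>P\<^sup>n f\<close> away from the parabolic fixed point 0. Conservation of mass
  becomes a convolution identity for \<open>a\<^sub>n\<close> with weights of order \<open>1/j\<close>, which forces
  \<open>a\<^sub>n ln n\<close> to converge to the integral. Linear combinations of such \<open>f\<close> are dense.
\<close>

subsection \<open>The sine sequence\<close>

text \<open>The density \<open>1/x\<close> has infinite mass, so the iterates of an integrable
  density decay to 0 and only the rate carries information. The rate comes from the parabolic branch
  \<open>x / (1 + lm * x)\<close>: the orbit of 1 under it decays like \<open>1/j\<close>, and the
  mass that the other branches bring into the interval from 0 to the \<open>j\<close>-th orbit point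
  is controlled by the integral of \<open>lm / (1 + lm * x)\<close> there, a difference of
  logarithms. These differences sum to \<open>ln (1 + lm * n)\<close>. By itself this determines
  only weighted averages of the values at 1; monotonicity in \<open>n\<close> is what turns averages
  into values, and the concave class exists to provide it.

  Concavity survives because each weight is a difference of consecutive terms in the branch index.
  Summation by parts trades second derivatives of weights for increments of \<open>G\<close>, and
  the boundary terms vanish, at the lower end because the two middle sines agree for odd
  \<open>q\<close>.

  The factor \<open>c_1 = 2\<close> has a simple origin: the branches inverse to \<open>g_k\<close>
  and \<open>Q g_k\<close> take the same value at 1, so there the operator counts every preimage
  twice.\<close>

locale hecke_odd =
  fixes h :: nat
  assumes h_pos: "h \<ge> 1"
begin

abbreviation "q \<equiv> 2 * h + 1"
definition lm :: real where "lm = lam q"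
definition s :: "nat \<Rightarrow> real" where "s k = sq q (real k)"

lemma sin_pi_q_pos: "0 < sin (pi / real q)"
proof (rule sin_gt_zero)
  have "real q > 1" using h_pos by simp
  then show "pi / real q < pi" by (simp add: field_simps)
qed (use h_pos in simp)

lemma s_0 [simp]: "s 0 = 0" and s_1 [simp]: "s (Suc 0) = 1"
  using sin_pi_q_pos by (simp_all add: s_def sq_def)

lemma s_rec: "s (Suc (Suc k)) = lm * s (Suc k) - s k"
proof -
  define t where "t = pi / real q"
  have eq: "s k = sin (real k * t) / sin t" for k
    by (simp add: s_def sq_def t_def)
  have "sin (real (Suc (Suc k)) * t) = 2 * cos t * sin (real (Suc k) * t) - sin (real k * t)"
    using sin_add[of "real (Suc k) * t" t] sin_diff[of "real (Suc k) * t" t]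
    by (simp add: algebra_simps)
  then show ?thesis
    unfolding eq by (simp only: diff_divide_distrib) (simp add: lm_def lam_def t_def)
qed

text \<open>The determinant of \<open>g_k\<close>. The expression is conserved along
  \<open>s_rec\<close>, so it keeps its value 1 from \<open>j = 0\<close>.\<close>

lemma s_det: "s (Suc j) * s (Suc j) - s j * s (Suc (Suc j)) = 1"
  by (induction j) (simp_all add: s_rec algebra_simps)

lemma s_sym: "k \<le> q \<Longrightarrow> s (q - k) = s k"
proof -
  assume k: "k \<le> q"
  have "real (q - k) * pi / real q = pi - real k * pi / real q"
    using k by (simp add: of_nat_diff field_simps)
  then show "s (q - k) = s k" unfolding s_def sq_def by simp
qed

lemma s_strict_mono: "i < k \<Longrightarrow> k \<le> h \<Longrightarrow> s i < s k"
proof -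
  assume a: "i < k" "k \<le> h"
  have "real i * pi / real q < real k * pi / real q"
    using a by (intro divide_strict_right_mono mult_strict_right_mono) auto
  moreover have "real k * pi / real q \<le> pi/2"
  proof -
    have "real k * pi * 2 \<le> pi * real q" using a by (simp add: mult.commute mult_left_mono)
    then show ?thesis using h_pos by (simp add: field_simps)
  qed
  moreover have "- (pi/2) \<le> real i * pi / real q"
    by (rule order_trans[of _ 0]) auto
  ultimately have "sin (real i * pi / real q) < sin (real k * pi / real q)"
    using sin_monotone_2pi by blast
  then show ?thesis unfolding s_def sq_def using sin_pi_q_pos by (simp add: divide_strict_right_mono)
qed

lemma s_q [simp]: "s q = 0" "s (Suc (2 * h)) = 0"
  using s_sym[of 0] by simp_all
lemma s_2h: "s (2 * h) = 1"
  using s_sym[of 1] by simp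
text \<open>The indices \<open>h\<close> and \<open>h + 1\<close> add up to \<open>q\<close>, so the
  reflection \<open>s_sym\<close> exchanges them. The sequence rises up to \<open>h\<close> and
  falls from \<open>h + 1\<close> on.\<close>

lemma s_mid: "s (Suc h) = s h"
  using s_sym[of h] h_pos by (simp add: Suc_diff_le mult_2)

lemma s_pos: "0 < k \<Longrightarrow> k \<le> 2 * h \<Longrightarrow> 0 < s k"
proof (cases "k \<le> h")
  case True
  then show "0 < k \<Longrightarrow> 0 < s k" using s_strict_mono[of 0 k] by simp
next
  case False
  assume "k \<le> 2 * h"
  then have "s (q - k) > 0" using False s_strict_mono[of 0 "q - k"] by simp
  then show ?thesis using s_sym[of k] \<open>k \<le> 2 * h\<close> by simp
qed

lemma s_nonneg: "k \<le> q \<Longrightarrow> 0 \<le> s k"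
  using s_pos[of k] by (cases "k = 0"; cases "k = q") auto

lemma s_strict_dec: "h < j \<Longrightarrow> j \<le> 2 * h \<Longrightarrow> s (Suc j) < s j"
proof -
  assume a: "h < j" "j \<le> 2 * h"
  then have "s (q - Suc j) < s (q - j)" by (intro s_strict_mono) auto
  then show ?thesis using a s_sym[of j] s_sym[of "Suc j"] by simp
qed

lemma s_dec: "h \<le> j \<Longrightarrow> j \<le> 2 * h \<Longrightarrow> s (Suc j) \<le> s j"
  using s_strict_dec[of j] s_mid by (cases "j = h") auto

lemma lm_less_2: "lm < 2"
proof -
  have "cos (pi / real q) < cos 0"
    by (rule cos_monotone_0_pi) (use h_pos in \<open>auto simp: field_simps\<close>)
  then show ?thesis by (simp add: lm_def lam_def)
qed

lemma s_2h1: "s (2 * h - 1) = lm"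
proof -
  obtain i where "2 * h = Suc i" using h_pos by (cases "2 * h") auto
  then show ?thesis using s_rec[of i] s_2h s_q(2) by simp
qed

lemma lm_ge_1: "1 \<le> lm"
proof -
  have "s (Suc (2 * h - 1)) \<le> s (2 * h - 1)" by (rule s_dec) (use h_pos in auto)
  then show ?thesis using s_2h s_2h1 h_pos by simp
qed

lemma s_ratio: "j < 2 * h \<Longrightarrow> s j \<le> lm * s (Suc j)"
  using s_rec[of j] s_nonneg[of "Suc (Suc j)"] by simp

subsection \<open>The branches in a symmetric coordinate\<close>

text \<open>For \<open>x = (1 - z) / (1 + z)\<close>, \<open>U j z\<close> is \<open>1 + z\<close>
  times \<open>s j * x + s (Suc j)\<close>, the denominator of an inverse branch, and
  \<open>U j (- z)\<close> is the same multiple of \<open>s (Suc j) * x + s j\<close>.\<close>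

definition U :: "nat \<Rightarrow> real \<Rightarrow> real" where
  "U j z = s j * (1 - z) + s (Suc j) * (1 + z)"
definition zeta :: "nat \<Rightarrow> real \<Rightarrow> real" where
  "zeta j z = (U j z - U (Suc j) z) / (U j z + U (Suc j) z)"
text \<open>The branch weight after densities are multiplied by \<open>x\<close>: it equals
  \<open>x / (den_psi j x * den_psi (Suc j) x)\<close>.\<close>

definition weight :: "nat \<Rightarrow> real \<Rightarrow> real" where
  "weight j z = (1 - z\<^sup>2) / (U j z * U (Suc j) z)"

lemma U_pos: assumes "j \<le> 2 * h" "\<bar>z\<bar> < 1" shows "0 < U j z"
proof (cases "j = 2 * h")
  case True then show ?thesis using assms s_2h by (simp add: U_def)
next
  case False
  then have "0 < s (Suc j) * (1 + z)" "0 \<le> s j * (1 - z)"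
    using assms s_pos[of "Suc j"] s_nonneg[of j] by auto
  then show ?thesis unfolding U_def by linarith
qed

lemma U_dec: assumes "h \<le> j" "j < 2 * h" "\<bar>z\<bar> < 1" shows "U (Suc j) z < U j z"
proof -
  have "0 \<le> (s j - s (Suc j)) * (1 - z)" "0 < (s (Suc j) - s (Suc (Suc j))) * (1 + z)"
    using assms s_dec[of j] s_strict_dec[of "Suc j"] by (auto intro!: mult_nonneg_nonneg mult_pos_pos)
  moreover have "U j z - U (Suc j) z = (s j - s (Suc j)) * (1 - z) + (s (Suc j) - s (Suc (Suc j))) * (1 + z)"
    by (simp add: U_def algebra_simps)
  ultimately show ?thesis by linarith
qed

lemma U_rec: "U (Suc (Suc j)) z = lm * U (Suc j) z - U j z"
  by (simp add: U_def s_rec algebra_simps)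

text \<open>The left side is a conserved quadratic form of the recursion \<open>U_rec\<close>; the
  right side is its value at \<open>j = 0\<close>.\<close>

lemma U_det: "U (Suc j) z * U (Suc j) z - U (Suc (Suc j)) z * U j z = (2 + lm) + (2 - lm) * z\<^sup>2"
proof (induction j)
  case 0
  show ?case by (simp add: U_def s_rec power2_eq_square algebra_simps)
next
  case (Suc j)
  have "U (Suc (Suc j)) z * U (Suc (Suc j)) z - U (Suc (Suc (Suc j))) z * U (Suc j) z
    = U (Suc j) z * U (Suc j) z - U (Suc (Suc j)) z * U j z"
    unfolding U_rec[of "Suc j"] unfolding U_rec[of j] by (simp add: algebra_simps)
  then show ?case using Suc by simp
qed

lemma zeta_bounds: assumes "h \<le> j" "j < 2 * h" "\<bar>z\<bar> < 1" shows "0 < zeta j z" "zeta j z < 1"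
  using U_dec[OF assms] U_pos[of j z] U_pos[of "Suc j" z] assms
  by (auto simp: zeta_def field_simps)

lemma weight_pos: assumes "j < 2 * h" "\<bar>z\<bar> < 1" shows "0 < weight j z"
  using U_pos[of j z] U_pos[of "Suc j" z] assms
  by (auto simp: weight_def abs_square_less_1 intro!: divide_pos_pos)

lemma zeta_gap:
  assumes "Suc j < 2 * h" "\<bar>z\<bar> < 1"
  shows "zeta (Suc j) z - zeta j z =
    2 * ((2 + lm) + (2 - lm) * z\<^sup>2) / ((U j z + U (Suc j) z) * (U (Suc j) z + U (Suc (Suc j)) z))"
proof -
  have gap: "(B - C) / (B + C) - (A - B) / (A + B) = 2 * (B * B - C * A) / ((A + B) * (B + C))"
    if "0 < A" "0 < B" "0 < C" for A B C :: real
  proof -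
    have "(B - C) * (A + B) - (A - B) * (B + C) = 2 * (B * B - C * A)"
      by (simp add: algebra_simps)
    moreover have "B + C \<noteq> 0" "A + B \<noteq> 0" using that by auto
    ultimately show ?thesis by (simp add: diff_frac_eq mult.commute)
  qed
  show ?thesis
    unfolding U_det[of j z, symmetric] zeta_def
    by (rule gap) (use U_pos assms in auto)
qed

section \<open>First and second derivatives of the branches and weights\<close>

lemma inverse_square_DERIV:
  fixes f :: "real \<Rightarrow> real"
  assumes "(f has_real_derivative f') (at z)" "f z \<noteq> 0"
  shows "((\<lambda>z. c / (f z)\<^sup>2) has_real_derivative (- 2 * c * f' / f z ^ 3)) (at z)"
  using assms by (auto intro!: derivative_eq_intros simp: field_simps power2_eq_square power3_eq_cube)

lemma U_DERIV: "(U j has_real_derivative (s (Suc j) - s j)) (at z)"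
  unfolding U_def[abs_def] by (auto intro!: derivative_eq_intros)

definition zeta' :: "nat \<Rightarrow> real \<Rightarrow> real" where
  "zeta' j z = 4 / (U j z + U (Suc j) z)\<^sup>2"
definition zeta'' :: "nat \<Rightarrow> real \<Rightarrow> real" where
  "zeta'' j z = 8 * (s j - s (Suc (Suc j))) / (U j z + U (Suc j) z) ^ 3"
text \<open>\<open>rho1\<close> and \<open>rho2\<close> are the first two derivatives of
  \<open>s j * (1 - z) / U j z\<close>, whose consecutive differences in \<open>j\<close> are the
  weights.\<close>

definition rho1 :: "nat \<Rightarrow> real \<Rightarrow> real" where
  "rho1 j z = - 2 * s j * s (Suc j) / (U j z)\<^sup>2"
definition rho2 :: "nat \<Rightarrow> real \<Rightarrow> real" where
  "rho2 j z = - 4 * s j * s (Suc j) * (s j - s (Suc j)) / U j z ^ 3"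

lemma U_cross: "(s (Suc j) - s j) * U (Suc j) z - (s (Suc (Suc j)) - s (Suc j)) * U j z = 2"
proof -
  have "(s (Suc j) - s j) * U (Suc j) z - (s (Suc (Suc j)) - s (Suc j)) * U j z
    = 2 * (s (Suc j) * s (Suc j) - s j * s (Suc (Suc j)))"
    by (simp add: U_def algebra_simps)
  then show ?thesis using s_det by simp
qed

lemma U_cross': "s (Suc j) * U j z - s j * U (Suc j) z = 1 + z"
proof -
  have "s (Suc j) * U j z - s j * U (Suc j) z
    = (1 + z) * (s (Suc j) * s (Suc j) - s j * s (Suc (Suc j)))"
    by (simp add: U_def algebra_simps)
  then show ?thesis using s_det by simp
qed

lemma zeta_DERIV:
  assumes "j < 2 * h" "\<bar>z\<bar> < 1"
  shows "(zeta j has_real_derivative zeta' j z) (at z)"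
proof -
  have pos: "0 < U j z" "0 < U (Suc j) z" using U_pos assms by auto
  let ?a = "s (Suc j) - s j" and ?b = "s (Suc (Suc j)) - s (Suc j)"
  have "(zeta j has_real_derivative
     ((?a - ?b) * (U j z + U (Suc j) z) - (U j z - U (Suc j) z) * (?a + ?b)) / 
       ((U j z + U (Suc j) z) * (U j z + U (Suc j) z))) (at z)"
    unfolding zeta_def[abs_def] using pos
    by (intro DERIV_divide DERIV_diff DERIV_add U_DERIV) auto
  also have "(?a - ?b) * (U j z + U (Suc j) z) - (U j z - U (Suc j) z) * (?a + ?b) = 
     2 * (?a * U (Suc j) z - ?b * U j z)"
    by (simp add: algebra_simps)
  finally show ?thesis by (simp add: U_cross zeta'_def power2_eq_square)
qed

lemma zeta'_DERIV:
  assumes "j < 2 * h" "\<bar>z\<bar> < 1"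
  shows "(zeta' j has_real_derivative zeta'' j z) (at z)"
proof -
  have pos: "0 < U j z" "0 < U (Suc j) z" using U_pos assms by auto
  have "((\<lambda>z. U j z + U (Suc j) z) has_real_derivative (s (Suc (Suc j)) - s j)) (at z)"
    using DERIV_add[OF U_DERIV[of j z] U_DERIV[of "Suc j" z]] by simp
  from inverse_square_DERIV[OF this, of 4] show ?thesis
    using pos by (simp add: zeta'_def[abs_def] zeta''_def)
qed

text \<open>Partial fractions, with the numerator supplied by \<open>U_cross'\<close>. This
  telescoping form is what makes summation by parts over the branches possible.\<close>

lemma weight_eq:
  assumes "j < 2 * h" "\<bar>z\<bar> < 1"
  shows "weight j z = s (Suc j) * (1 - z) / U (Suc j) z - s j * (1 - z) / U j z"
proof -
  have pos: "0 < U j z" "0 < U (Suc j) z" using U_pos assms by auto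
  have "s (Suc j) * (1 - z) / U (Suc j) z - s j * (1 - z) / U j z = 
    (1 - z) * (s (Suc j) * U j z - s j * U (Suc j) z) / (U j z * U (Suc j) z)"
    using pos by (simp add: field_simps)
  also have "\<dots> = (1 - z) * (1 + z) / (U j z * U (Suc j) z)" by (simp only: U_cross')
  also have "(1 - z) * (1 + z) = 1 - z\<^sup>2" by (simp add: power2_eq_square algebra_simps)
  finally show ?thesis by (simp add: weight_def)
qed

lemma R_DERIV:
  assumes "j \<le> 2 * h" "\<bar>z\<bar> < 1"
  shows "((\<lambda>z. s j * (1 - z) / U j z) has_real_derivative rho1 j z) (at z)"
proof -
  have pos: "0 < U j z" using U_pos assms by auto
  have lin: "((\<lambda>z. s j * (1 - z)) has_real_derivative - s j) (at z)"
    by (auto intro!: derivative_eq_intros)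
  have "((\<lambda>z. s j * (1 - z) / U j z) has_real_derivative 
     ((- s j) * U j z - s j * (1 - z) * (s (Suc j) - s j)) / (U j z * U j z)) (at z)"
    by (rule DERIV_divide[OF lin U_DERIV]) (use pos in auto)
  moreover have "(- s j) * U j z - s j * (1 - z) * (s (Suc j) - s j) = - 2 * s j * s (Suc j)"
    by (simp add: U_def algebra_simps)
  ultimately show ?thesis by (simp add: rho1_def power2_eq_square)
qed

lemma rho1_DERIV:
  assumes "j \<le> 2 * h" "\<bar>z\<bar> < 1"
  shows "(rho1 j has_real_derivative rho2 j z) (at z)"
  using inverse_square_DERIV[OF U_DERIV, of j z "- 2 * s j * s (Suc j)"] U_pos[OF assms]
  by (simp add: rho1_def[abs_def] rho2_def algebra_simps)

lemma weight_DERIV: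
  assumes "j < 2 * h" "\<bar>z\<bar> < 1"
  shows "(weight j has_real_derivative (rho1 (Suc j) z - rho1 j z)) (at z)"
proof -
  have "((\<lambda>z. s (Suc j) * (1 - z) / U (Suc j) z - s j * (1 - z) / U j z) 
     has_real_derivative (rho1 (Suc j) z - rho1 j z)) (at z)"
    using assms by (intro DERIV_diff R_DERIV) auto
  then show ?thesis
    by (rule has_field_derivative_transform_within_open[where S="{-1<..<1}"])
       (use assms weight_eq in \<open>auto simp: abs_less_iff\<close>)
qed

text \<open>The quotient rule applied to the defining formula gives a second expression for the
  derivative of the weight, in which its sign can be estimated; uniqueness of derivatives identifies
  it with the telescoping one.\<close>

lemma weight'_eq:
  assumes "j < 2 * h" "\<bar>z\<bar> < 1"
  shows "rho1 (Suc j) z - rho1 j z = 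
    (- 2 * z * (U j z * U (Suc j) z) 
      + (1 - z\<^sup>2) * ((s j - s (Suc j)) * U (Suc j) z + (s (Suc j) - s (Suc (Suc j))) * U j z))
    / (U j z * U (Suc j) z)\<^sup>2"
proof -
  have pos: "0 < U j z" "0 < U (Suc j) z" using U_pos assms by auto
  let ?a = "s (Suc j) - s j" and ?b = "s (Suc (Suc j)) - s (Suc j)"
  have sq: "((\<lambda>z. 1 - z\<^sup>2) has_real_derivative (- 2 * z)) (at z)"
    by (auto intro!: derivative_eq_intros)
  have "((\<lambda>z. (1 - z\<^sup>2) / (U j z * U (Suc j) z)) has_real_derivative 
     ((- 2 * z) * (U j z * U (Suc j) z) - (1 - z\<^sup>2) * (?a * U (Suc j) z + ?b * U j z))
    / ((U j z * U (Suc j) z) * (U j z * U (Suc j) z))) (at z)"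
    by (rule DERIV_divide[OF sq DERIV_mult[OF U_DERIV U_DERIV]]) (use pos in auto)
  then have "rho1 (Suc j) z - rho1 j z = 
     ((- 2 * z) * (U j z * U (Suc j) z) - (1 - z\<^sup>2) * (?a * U (Suc j) z + ?b * U j z))
    / ((U j z * U (Suc j) z) * (U j z * U (Suc j) z))"
    using weight_DERIV[OF assms] by (intro DERIV_unique) (simp_all add: weight_def[abs_def])
  moreover have "(- 2 * z) * (U j z * U (Suc j) z) - (1 - z\<^sup>2) * (?a * U (Suc j) z + ?b * U j z) =
     - 2 * z * (U j z * U (Suc j) z) 
      + (1 - z\<^sup>2) * ((s j - s (Suc j)) * U (Suc j) z + (s (Suc j) - s (Suc (Suc j))) * U j z)"
    by (simp add: algebra_simps)
  ultimately show ?thesis by (simp only: power2_eq_square)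
qed

end

subsection \<open>Concavity\<close>

text \<open>Only the open interval matters: every \<open>zeta j z\<close> with
  \<open>h \<le> j\<close>, \<open>j < 2 * h\<close> and \<open>\<bar>z\<bar> < 1\<close> lies
  inside it.\<close>

definition dec_concave :: "(real \<Rightarrow> real) \<Rightarrow> bool" where
  "dec_concave G \<longleftrightarrow> (\<exists>G1 G2. \<forall>z. 0 < z \<and> z < 1 \<longrightarrow>
     (G has_real_derivative G1 z) (at z) \<and> (G1 has_real_derivative G2 z) (at z) \<and> G1 z \<le> 0 \<and> G2 z \<le> 0)"

lemma dec_concave_antimono:
  assumes "dec_concave G" "0 < x" "x \<le> y" "y < 1"
  shows "G y \<le> G x"
proof -
  obtain G1 where G1: "\<And>z. 0 < z \<Longrightarrow> z < 1 \<Longrightarrow> (G has_real_derivative G1 z) (at z) \<and> G1 z \<le> 0"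
    using assms(1) unfolding dec_concave_def by blast
  show ?thesis
  proof (rule DERIV_nonpos_imp_nonincreasing[of x y G])
    fix r assume "x \<le> r" "r \<le> y"
    then have "0 < r" "r < 1" using assms(2-) by auto
    then show "\<exists>d. (G has_real_derivative d) (at r) \<and> d \<le> 0"
      using G1 by blast
  qed (use assms in auto)
qed

lemma dec_concave_cong:
  assumes "dec_concave G" "\<And>z. 0 < z \<Longrightarrow> z < 1 \<Longrightarrow> G z = H z"
  shows "dec_concave H"
proof -
  obtain G1 G2 where G: "\<And>z. 0 < z \<Longrightarrow> z < 1 \<Longrightarrow>
     (G has_real_derivative G1 z) (at z) \<and> (G1 has_real_derivative G2 z) (at z) \<and> G1 z \<le> 0 \<and> G2 z \<le> 0"
    using assms(1) unfolding dec_concave_def by blast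
  have "(H has_real_derivative G1 z) (at z)" if "0 < z" "z < 1" for z
    by (rule has_field_derivative_transform_within_open[where S="{0<..<1}" and f=G])
       (use G that assms(2) in auto)
  then show ?thesis using G unfolding dec_concave_def by blast
qed

lemma sum_by_parts:
  fixes r g :: "nat \<Rightarrow> real"
  assumes "m \<le> n"
  shows "(\<Sum>j\<in>{m..<Suc n}. (r (Suc j) - r j) * g j) =
    r (Suc n) * g n - r m * g m - (\<Sum>j\<in>{m..<n}. r (Suc j) * (g (Suc j) - g j))"
  using assms by (induction n rule: dec_induct) (simp_all add: algebra_simps)

context hecke_odd begin

text \<open>The coefficient of \<open>G1 (zeta j z)\<close> in the second derivative of
  \<open>weight j z * G (zeta j z)\<close>.\<close>

definition curv :: "nat \<Rightarrow> real \<Rightarrow> real" where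
  "curv j z = 2 * (rho1 (Suc j) z - rho1 j z) * zeta' j z + weight j z * zeta'' j z"

lemma zeta''_nonneg: assumes "h \<le> j" "j < 2 * h" "\<bar>z\<bar> < 1" shows "0 \<le> weight j z * zeta'' j z"
proof -
  have "s (Suc (Suc j)) \<le> s j" using s_dec[of j] s_dec[of "Suc j"] assms by simp
  moreover have "0 < U j z" "0 < U (Suc j) z" using U_pos assms by auto
  ultimately show ?thesis using weight_pos[of j z] assms 
    by (auto simp: zeta''_def intro!: mult_nonneg_nonneg divide_nonneg_nonneg)
qed

lemma rho2_nonpos: assumes "h \<le> j" "j \<le> 2 * h" "\<bar>z\<bar> < 1" shows "rho2 j z \<le> 0"
proof -
  have "0 \<le> 4 * s j * s (Suc j) * (s j - s (Suc j)) / U j z ^ 3"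
    using s_nonneg[of j] s_nonneg[of "Suc j"] s_dec[of j] U_pos[of j z] assms
    by (intro divide_nonneg_nonneg mult_nonneg_nonneg) auto
  then show ?thesis by (simp add: rho2_def)
qed

lemma weight'_ge:
  assumes "h \<le> j" "j < 2 * h" "\<bar>z\<bar> < 1"
  shows "- 2 * z / (U j z * U (Suc j) z) \<le> rho1 (Suc j) z - rho1 j z"
proof -
  have pos: "0 < U j z" "0 < U (Suc j) z" using U_pos assms by auto
  have "0 \<le> (1 - z\<^sup>2) * ((s j - s (Suc j)) * U (Suc j) z + (s (Suc j) - s (Suc (Suc j))) * U j z)"
    using s_dec[of j] s_dec[of "Suc j"] assms pos
    by (intro mult_nonneg_nonneg add_nonneg_nonneg) (auto simp: abs_square_le_1)
  then have "- 2 * z * (U j z * U (Suc j) z) / (U j z * U (Suc j) z)\<^sup>2 \<le> rho1 (Suc j) z - rho1 j z"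
    unfolding weight'_eq[OF assms(2,3)] by (intro divide_right_mono) auto
  moreover have "- 2 * z * (U j z * U (Suc j) z) / (U j z * U (Suc j) z)\<^sup>2 = - 2 * z / (U j z * U (Suc j) z)"
    using pos by (simp add: power2_eq_square)
  ultimately show ?thesis by simp
qed

lemma curv_ge:
  assumes "h \<le> j" "j < 2 * h" "\<bar>z\<bar> < 1"
  shows "- 16 * z / (U j z * U (Suc j) z * (U j z + U (Suc j) z)\<^sup>2) \<le> curv j z"
proof -
  have "0 \<le> zeta' j z" by (simp add: zeta'_def)
  then have "2 * (- 2 * z / (U j z * U (Suc j) z)) * zeta' j z \<le> 
      2 * (rho1 (Suc j) z - rho1 j z) * zeta' j z"
    using weight'_ge[OF assms] by (intro mult_right_mono mult_left_mono) auto
  then have "2 * (- 2 * z / (U j z * U (Suc j) z)) * zeta' j z \<le> curv j z"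
    unfolding curv_def using zeta''_nonneg[OF assms] by linarith
  then show ?thesis by (simp add: zeta'_def)
qed

text \<open>The last index receives no help from the summation by parts. Since
  \<open>U (2 * h) z = 1 - z\<close>, the function behind \<open>rho1 (2 * h)\<close> is constant,
  and the derivative of the weight is just \<open>- rho1 (2 * h - 1) z\<close>, which has the right
  sign.\<close>

lemma curv_last: assumes "\<bar>z\<bar> < 1" shows "0 \<le> curv (2 * h - 1) z"
proof -
  have S: "Suc (2 * h - 1) = 2 * h" using h_pos by simp
  have "rho1 (Suc (2 * h - 1)) z = 0" unfolding S by (simp add: rho1_def)
  moreover have "rho1 (2 * h - 1) z \<le> 0"
    using s_nonneg[of "2 * h - 1"] s_nonneg[of "2 * h"] unfolding rho1_def S
    by (simp add: divide_nonpos_nonneg mult_nonneg_nonneg)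
  moreover have "0 \<le> zeta' (2 * h - 1) z" by (simp add: zeta'_def)
  ultimately have "0 \<le> 2 * (rho1 (Suc (2 * h - 1)) z - rho1 (2 * h - 1) z) * zeta' (2 * h - 1) z"
    by (intro mult_nonneg_nonneg) auto
  then show ?thesis unfolding curv_def
    using zeta''_nonneg[of "2 * h - 1" z] h_pos assms by auto
qed

text \<open>After summation by parts in the second derivative of \<open>half_transfer G\<close>, this is the coefficient
  of the nonpositive number \<open>G'(zeta j z)\<close>.\<close>

lemma coef_nonneg:
  assumes "h \<le> j" "Suc j < 2 * h" "\<bar>z\<bar> < 1"
  shows "0 \<le> curv j z - rho2 (Suc j) z * (zeta (Suc j) z - zeta j z)"
proof -
  define X Y Z where "X = U (Suc j) z" "Y = U j z" "Z = U (Suc (Suc j)) z"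
  define b c where "b = s (Suc j)" "c = s (Suc (Suc j))"
  define D where "D = (2 + lm) + (2 - lm) * z\<^sup>2"
  note defs = X_Y_Z_def b_c_def D_def
  have pos: "0 < X" "0 < Y" "0 < Z" unfolding defs using U_pos assms by auto
  have le: "X \<le> Y" "Z \<le> X" unfolding defs using U_dec[of j z] U_dec[of "Suc j" z] assms by auto
  have bc: "0 < b" "0 < c" "b \<le> lm * c" unfolding defs using s_pos s_ratio[of "Suc j"] assms by auto
  have gap: "zeta (Suc j) z - zeta j z = 2 * D / ((Y + X) * (X + Z))"
    unfolding defs by (rule zeta_gap) (use assms in auto)
  have rho: "- rho2 (Suc j) z = 4 * b * c * (b - c) / X ^ 3"
    unfolding defs by (simp add: rho2_def)
  have curv: "- 16 * z / (Y * X * (Y + X)\<^sup>2) \<le> curv j z"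
    unfolding defs using curv_ge assms by auto
  have D0: "0 < D" unfolding D_def using lm_ge_1 lm_less_2 by (intro add_pos_nonneg) auto
  have "0 \<le> b - c" unfolding defs using s_dec[of "Suc j"] assms by auto
  \<comment> \<open>From \<open>b * b - s j * c = 1\<close> and \<open>b \<le> s j\<close>. The
    bound \<open>bd\<close> trades the constant 1 for the factor \<open>b * (b - c)\<close> that
    occurs in \<open>rho2\<close>.\<close>
  have "0 \<le> c * (s j - b)" using s_dec[of j] assms bc by (intro mult_nonneg_nonneg) (auto simp: b_c_def)
  then have bd: "1 \<le> b * (b - c)" using s_det[of j] by (simp add: b_c_def algebra_simps)
  show ?thesis
  proof (cases "z \<le> 0")
    case True
    have "0 \<le> - 16 * z / (Y * X * (Y + X)\<^sup>2)" using True pos by (intro divide_nonneg_nonneg) auto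
    moreover have "0 \<le> - rho2 (Suc j) z * (zeta (Suc j) z - zeta j z)"
      unfolding rho gap using pos D0 bc \<open>0 \<le> b - c\<close>
      by (intro mult_nonneg_nonneg divide_nonneg_nonneg) auto
    ultimately show ?thesis using curv by simp
  next
    case False
    then have z: "0 < z" "z < 1" using assms by auto
    \<comment> \<open>The target is \<open>2 * z * X \<le> b * c * (b - c) * D\<close>. It says that
      the gain from \<open>rho2\<close> covers the worst case of \<open>curv\<close> after
      \<open>Y\<close> is lowered to \<open>X\<close> and one factor \<open>Y + X\<close> to
      \<open>X + Z\<close>.\<close>
    have "X = b * (1 - z) + c * (1 + z)" unfolding defs U_def by simp
    also have "\<dots> \<le> lm * c * (1 - z) + c * (1 + z)" using bc z by (simp add: mult_right_mono)
    finally have "2 * z * X \<le> 2 * z * (lm * c * (1 - z) + c * (1 + z))" using z by simp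
    also have "\<dots> = c * D - c * ((1 - z) * (2 + lm * (1 - z)))"
      by (simp add: D_def algebra_simps power2_eq_square)
    also have "\<dots> \<le> c * D" using bc z lm_ge_1 by simp
    finally have "2 * z * X \<le> c * D" .
    also have "\<dots> \<le> b * (b - c) * (c * D)" using mult_right_mono[OF bd, of "c * D"] bc D0 by simp
    finally have *: "2 * z * X \<le> b * c * (b - c) * D" by (simp add: algebra_simps)
    have "16 * z / (Y * X * (Y + X)\<^sup>2) \<le> 16 * z / (X * X * ((Y + X) * (X + Z)))"
      unfolding power2_eq_square using pos le z
      by (intro divide_left_mono mult_mono mult_pos_pos) auto
    also have "\<dots> = 8 * (2 * z * X) / (X ^ 3 * ((Y + X) * (X + Z)))"
      using pos by (simp add: power3_eq_cube divide_simps)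
    also have "\<dots> \<le> 8 * (b * c * (b - c) * D) / (X ^ 3 * ((Y + X) * (X + Z)))"
      using * pos by (intro divide_right_mono mult_left_mono) auto
    also have "\<dots> = - rho2 (Suc j) z * (zeta (Suc j) z - zeta j z)"
      unfolding rho gap by simp
    finally show ?thesis using curv by simp
  qed
qed

definition half_transfer :: "(real \<Rightarrow> real) \<Rightarrow> real \<Rightarrow> real" where
  "half_transfer G z = (\<Sum>j\<in>{h..<2*h}. weight j z * G (zeta j z))"

text \<open>The terms with second derivatives of weights are summed by parts, concavity replaces
  each increment of \<open>G\<close> by a tangent slope, and what remains is a sum of nonnegative
  coefficients times values of \<open>G1\<close> and \<open>G2\<close>, both nonpositive.\<close>

lemma half_transfer_concave:
  assumes "dec_concave G"
  shows "\<exists>E1 E2. \<forall>z. \<bar>z\<bar> < 1 \<longrightarrow> 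
    (half_transfer G has_real_derivative E1 z) (at z) \<and> (E1 has_real_derivative E2 z) (at z) \<and> E2 z \<le> 0"
proof -
  obtain G1 G2 where G: "\<And>z. 0 < z \<Longrightarrow> z < 1 \<Longrightarrow>
     (G has_real_derivative G1 z) (at z) \<and> (G1 has_real_derivative G2 z) (at z) \<and> G1 z \<le> 0 \<and> G2 z \<le> 0"
    using assms(1) unfolding dec_concave_def by blast
  have tangent: "G y - G x \<le> G1 x * (y - x)" if "0 < x" "x < y" "y < 1" for x y
  proof -
    have "\<exists>t>x. t < y \<and> G y - G x = (y - x) * G1 t"
    proof (rule MVT2[OF that(2)])
      fix r assume "x \<le> r" "r \<le> y"
      then have "0 < r" "r < 1" using that by auto
      then show "(G has_real_derivative G1 r) (at r)" using G by blast
    qed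
    then obtain t where t: "x < t" "t < y" "G y - G x = (y - x) * G1 t" by blast
    have "G1 t \<le> G1 x"
    proof (rule DERIV_nonpos_imp_nonincreasing[of x t G1])
      fix r assume "x \<le> r" "r \<le> t"
      then have "0 < r" "r < 1" using that t by auto
      then show "\<exists>y. (G1 has_real_derivative y) (at r) \<and> y \<le> 0"
        using G by blast
    qed (use t in auto)
    then show ?thesis using t that by (simp add: mult.commute mult_left_mono)
  qed
  define E1 where "E1 z = (\<Sum>j\<in>{h..<2*h}. (rho1 (Suc j) z - rho1 j z) * G (zeta j z) 
      + weight j z * (zeta' j z * G1 (zeta j z)))" for z
  define E2 where "E2 z = (\<Sum>j\<in>{h..<2*h}. (rho2 (Suc j) z - rho2 j z) * G (zeta j z) 
      + curv j z * G1 (zeta j z) + weight j z * (zeta' j z)\<^sup>2 * G2 (zeta j z))" for z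
  have "(half_transfer G has_real_derivative E1 z) (at z)" if z: "\<bar>z\<bar> < 1" for z
    unfolding half_transfer_def[abs_def] E1_def
  proof (rule DERIV_sum)
    fix j assume j: "j \<in> {h..<2*h}"
    have "((\<lambda>z. G (zeta j z)) has_real_derivative G1 (zeta j z) * zeta' j z) (at z)"
      by (rule DERIV_chain2[OF _ zeta_DERIV]) (use G zeta_bounds[of j z] j z in auto)
    from DERIV_mult[OF weight_DERIV this]
    show "((\<lambda>z. weight j z * G (zeta j z)) has_real_derivative
       (rho1 (Suc j) z - rho1 j z) * G (zeta j z) + weight j z * (zeta' j z * G1 (zeta j z))) (at z)"
      using j z by (simp add: algebra_simps)
  qed
  moreover have "(E1 has_real_derivative E2 z) (at z)" if z: "\<bar>z\<bar> < 1" for z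
    unfolding E1_def[abs_def] E2_def
  proof (rule DERIV_sum)
    fix j assume j: "j \<in> {h..<2*h}"
    have g: "((\<lambda>z. G (zeta j z)) has_real_derivative G1 (zeta j z) * zeta' j z) (at z)"
      by (rule DERIV_chain2[OF _ zeta_DERIV]) (use G zeta_bounds[of j z] j z in auto)
    have g1: "((\<lambda>z. G1 (zeta j z)) has_real_derivative G2 (zeta j z) * zeta' j z) (at z)"
      by (rule DERIV_chain2[OF _ zeta_DERIV]) (use G zeta_bounds[of j z] j z in auto)
    have "((\<lambda>z. rho1 (Suc j) z - rho1 j z) has_real_derivative rho2 (Suc j) z - rho2 j z) (at z)"
      using j z by (intro DERIV_diff rho1_DERIV) auto
    note r = this
    have w: "(weight j has_real_derivative rho1 (Suc j) z - rho1 j z) (at z)"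
      and z': "(zeta' j has_real_derivative zeta'' j z) (at z)"
      using weight_DERIV zeta'_DERIV j z by auto
    show "((\<lambda>z. (rho1 (Suc j) z - rho1 j z) * G (zeta j z) + weight j z * (zeta' j z * G1 (zeta j z))) 
       has_real_derivative
       (rho2 (Suc j) z - rho2 j z) * G (zeta j z) 
      + curv j z * G1 (zeta j z) + weight j z * (zeta' j z)\<^sup>2 * G2 (zeta j z)) (at z)"
      by (rule DERIV_cong[OF DERIV_add[OF DERIV_mult[OF r g] DERIV_mult[OF w DERIV_mult[OF z' g1]]]])
        (simp add: algebra_simps curv_def power2_eq_square)
  qed
  moreover have "E2 z \<le> 0" if z: "\<bar>z\<bar> < 1" for z
  proof -
    define g where "g j = G (zeta j z)" for j
    define g1 where "g1 j = G1 (zeta j z)" for j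
    obtain n where n: "2 * h = Suc n" "h \<le> n" using h_pos by (cases "2 * h") auto
    have g1: "g1 j \<le> 0" "G2 (zeta j z) \<le> 0" if "j \<in> {h..<2*h}" for j
      using G[of "zeta j z"] zeta_bounds[of j z] that z by (auto simp: g1_def)
    \<comment> \<open>Vanishing boundary terms: \<open>s h = s (Suc h)\<close> at the lower end,
      \<open>s (Suc (2 * h)) = 0\<close> at the upper end.\<close>
    have "rho2 h z = 0" "rho2 (2 * h) z = 0" by (simp_all add: rho2_def s_mid)
    then have "(\<Sum>j\<in>{h..<2*h}. (rho2 (Suc j) z - rho2 j z) * g j) = 
       - (\<Sum>j\<in>{h..<n}. rho2 (Suc j) z * (g (Suc j) - g j))"
      using sum_by_parts[OF n(2), of "\<lambda>j. rho2 j z" g] n by simp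
    moreover have "\<dots> \<le> - (\<Sum>j\<in>{h..<n}. rho2 (Suc j) z * (g1 j * (zeta (Suc j) z - zeta j z)))"
    proof (intro le_imp_neg_le sum_mono mult_left_mono_neg)
      fix j assume j: "j \<in> {h..<n}"
      then have j': "h \<le> j" "Suc j < 2 * h" "j < 2 * h" using n by auto
      have "0 < zeta (Suc j) z - zeta j z"
        unfolding zeta_gap[OF j'(2) z]
        using U_pos[of j z] U_pos[of "Suc j" z] U_pos[of "Suc (Suc j)" z] j' z lm_ge_1 lm_less_2
        by (intro divide_pos_pos mult_pos_pos add_pos_pos add_pos_nonneg mult_nonneg_nonneg) auto
      then show "g (Suc j) - g j \<le> g1 j * (zeta (Suc j) z - zeta j z)"
        unfolding g_def g1_def using zeta_bounds[of j z] zeta_bounds[of "Suc j" z] j' z by (intro tangent) auto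
      show "rho2 (Suc j) z \<le> 0" using rho2_nonpos[of "Suc j" z] j' z by auto
    qed
    moreover have "(\<Sum>j\<in>{h..<2*h}. curv j z * g1 j) = (\<Sum>j\<in>{h..<n}. curv j z * g1 j) + curv n z * g1 n"
      using n by simp
    moreover have "curv n z * g1 n \<le> 0"
      using curv_last[OF z] g1[of n] n by (intro mult_nonneg_nonpos) (auto simp: n)
    moreover have "(\<Sum>j\<in>{h..<n}. curv j z * g1 j) - (\<Sum>j\<in>{h..<n}. rho2 (Suc j) z * (g1 j * (zeta (Suc j) z - zeta j z)))
       = (\<Sum>j\<in>{h..<n}. (curv j z - rho2 (Suc j) z * (zeta (Suc j) z - zeta j z)) * g1 j)"
      by (simp add: sum_subtractf[symmetric] algebra_simps)
    moreover have "\<dots> \<le> 0"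
      by (intro sum_nonpos mult_nonneg_nonpos coef_nonneg g1) (use n z in auto)
    moreover have "(\<Sum>j\<in>{h..<2*h}. weight j z * (zeta' j z)\<^sup>2 * G2 (zeta j z)) \<le> 0"
      using weight_pos[of _ z] z g1 by (intro sum_nonpos mult_nonneg_nonpos mult_nonneg_nonneg) (auto simp: less_imp_le)
    ultimately show ?thesis unfolding E2_def sum.distrib g_def[symmetric] g1_def[symmetric] by linarith
  qed
  ultimately show ?thesis by blast
qed

text \<open>The derivative of an even concave function vanishes at 0 and decreases from there. The
  second claim covers \<open>z = 0\<close>, the point \<open>x = 1\<close>, which
  \<open>dec_concave\<close> does not see.\<close>

lemma half_transfer_sym_dec_concave:
  assumes "dec_concave G"
  shows "dec_concave (\<lambda>z. half_transfer G z + half_transfer G (- z))"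
    and "0 \<le> z \<Longrightarrow> z < 1 \<Longrightarrow> half_transfer G z + half_transfer G (- z) \<le> half_transfer G 0 + half_transfer G 0"
proof -
  obtain E1 E2 where E: "\<And>z. \<bar>z\<bar> < 1 \<Longrightarrow> 
    (half_transfer G has_real_derivative E1 z) (at z) \<and> (E1 has_real_derivative E2 z) (at z) \<and> E2 z \<le> 0"
    using half_transfer_concave[OF assms] by blast
  have neg: "((\<lambda>z. f (- z)) has_real_derivative - f') (at z)" 
    if "(f has_real_derivative f') (at (- z))" for f f' and z :: real
    by (simp add: that DERIV_mirror[symmetric])
  have D1: "((\<lambda>z. half_transfer G z + half_transfer G (- z)) has_real_derivative (E1 z - E1 (- z))) (at z)" if "\<bar>z\<bar> < 1" for z
    using DERIV_add[of "half_transfer G" "E1 z" z UNIV "\<lambda>z. half_transfer G (- z)" "- E1 (- z)"] E[of z] E[of "- z"] that neg by simp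
  have D2: "((\<lambda>z. E1 z - E1 (- z)) has_real_derivative (E2 z + E2 (- z))) (at z)" if "\<bar>z\<bar> < 1" for z
    using DERIV_diff[of E1 "E2 z" z UNIV "\<lambda>z. E1 (- z)" "- E2 (- z)"] E[of z] E[of "- z"] that neg by simp
  have neg1: "E1 z - E1 (- z) \<le> 0" if "0 \<le> z" "z < 1" for z
  proof -
    have "(\<lambda>z. E1 z - E1 (- z)) z \<le> (\<lambda>z. E1 z - E1 (- z)) 0"
    proof (rule DERIV_nonpos_imp_nonincreasing[of 0 z "\<lambda>z. E1 z - E1 (- z)"])
      fix x assume "0 \<le> x" "x \<le> z"
      then have x: "\<bar>x\<bar> < 1" "\<bar>- x\<bar> < 1" using that by auto
      show "\<exists>y. ((\<lambda>z. E1 z - E1 (- z)) has_real_derivative y) (at x) \<and> y \<le> 0"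
        using D2[OF x(1)] E[OF x(1)] E[OF x(2)] by (intro exI[of _ "E2 x + E2 (- x)"]) auto
    qed (use that in auto)
    then show ?thesis by simp
  qed
  show "dec_concave (\<lambda>z. half_transfer G z + half_transfer G (- z))"
    unfolding dec_concave_def
  proof (intro exI allI impI conjI)
    fix z :: real assume z: "0 < z \<and> z < 1"
    then have z': "\<bar>z\<bar> < 1" "\<bar>- z\<bar> < 1" by auto
    show "((\<lambda>z. half_transfer G z + half_transfer G (- z)) has_real_derivative (E1 z - E1 (- z))) (at z)"
      "((\<lambda>z. E1 z - E1 (- z)) has_real_derivative (E2 z + E2 (- z))) (at z)"
      using D1[OF z'(1)] D2[OF z'(1)] by auto
    show "E1 z - E1 (- z) \<le> 0" using neg1 z by auto
    show "E2 z + E2 (- z) \<le> 0" using E[OF z'(1)] E[OF z'(2)] by auto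
  qed
  show "half_transfer G z + half_transfer G (- z) \<le> half_transfer G 0 + half_transfer G 0" if "0 \<le> z" "z < 1"
  proof -
    have "(\<lambda>z. half_transfer G z + half_transfer G (- z)) z \<le> (\<lambda>z. half_transfer G z + half_transfer G (- z)) 0"
    proof (rule DERIV_nonpos_imp_nonincreasing[of 0 z "\<lambda>z. half_transfer G z + half_transfer G (- z)"])
      fix x assume "0 \<le> x" "x \<le> z"
      then show "\<exists>y. ((\<lambda>z. half_transfer G z + half_transfer G (- z)) has_real_derivative y) (at x) \<and> y \<le> 0"
        using D1[of x] neg1[of x] that by (intro exI[of _ "E1 x - E1 (- x)"]) auto
    qed (use that in auto)
    then show ?thesis by simp
  qed
qed

end

subsection \<open>The transfer operator\<close>

lemma telescope_sum:
  fixes f :: "nat \<Rightarrow> real"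
  assumes "m \<le> n"
  shows "(\<Sum>j\<in>{m..<n}. f j - f (Suc j)) = f m - f n"
  using assms by (induction n rule: dec_induct) auto

text \<open>Substitution via the primitive of \<open>f\<close>, the derivative of \<open>g\<close>
  being its determinant over \<open>(c * x + d)\<^sup>2\<close>. Keeping the determinant signed lets
  one statement serve the orientation reversing branches too.\<close>

lemma mobius_integral:
  fixes f :: "real \<Rightarrow> real" and a b c d e :: real
  defines "g \<equiv> \<lambda>x. (a * x + b) / (c * x + d)"
  assumes f: "continuous_on {0..1} f" and e: "0 \<le> e"
    and pos: "\<And>x. x \<in> {0..e} \<Longrightarrow> 0 < c * x + d"
    and maps: "\<And>x. x \<in> {0..e} \<Longrightarrow> g x \<in> {0..1}"
  shows "((\<lambda>x. (a * d - b * c) * (f (g x) / (c * x + d)\<^sup>2)) has_integral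
           integral {0..g e} f - integral {0..g 0} f) {0..e}"
proof -
  define F where "F x = integral {0..x} f" for x
  have F: "(F has_real_derivative f y) (at y within {0..1})" if "y \<in> {0..1}" for y
    unfolding F_def by (rule integral_has_real_derivative[OF f that])
  have "((\<lambda>x. (a * d - b * c) * (f (g x) / (c * x + d)\<^sup>2)) has_integral F (g e) - F (g 0)) {0..e}"
  proof (rule fundamental_theorem_of_calculus[OF e])
    fix x assume x: "x \<in> {0..e}"
    have dg: "(g has_real_derivative ((a * d - b * c) / (c * x + d)\<^sup>2)) (at x within {0..e})"
    proof -
      have "(g has_real_derivative (a * (c * x + d) - (a * x + b) * c) / ((c * x + d) * (c * x + d))) (at x within {0..e})"
        unfolding g_def using pos[OF x] by (auto intro!: derivative_eq_intros)
      then show ?thesis by (simp add: power2_eq_square algebra_simps)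
    qed
    have "(F has_real_derivative f (g x)) (at (g x) within g ` {0..e})"
      by (rule has_field_derivative_subset[OF F]) (use maps x in auto)
    from DERIV_image_chain[OF this dg]
    show "((\<lambda>x. F (g x)) has_vector_derivative (a * d - b * c) * (f (g x) / (c * x + d)\<^sup>2)) (at x within {0..e})"
      by (simp add: has_real_derivative_iff_has_vector_derivative o_def mult.commute)
  qed
  then show ?thesis by (simp add: F_def)
qed

context hecke_odd begin

definition den_psi :: "nat \<Rightarrow> real \<Rightarrow> real" where "den_psi j x = s j * x + s (Suc j)"
definition den_omega :: "nat \<Rightarrow> real \<Rightarrow> real" where "den_omega j x = s (Suc j) * x + s j"
definition psi :: "nat \<Rightarrow> real \<Rightarrow> real" where "psi j x = den_psi (Suc j) x / den_psi j x"
definition omega :: "nat \<Rightarrow> real \<Rightarrow> real" where "omega j x = den_omega (Suc j) x / den_omega j x"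

text \<open>\<open>psi j\<close> and \<open>omega j\<close> are the inverses of the branches \<open>g\<^sub>k\<close> and \<open>Q g\<^sub>k\<close> of the Farey map for
  \<open>k = j + 1\<close>.\<close>

definition transfer :: "(real \<Rightarrow> real) \<Rightarrow> real \<Rightarrow> real" where
  "transfer f x = (\<Sum>j\<in>{h..<2*h}. f (psi j x) / (den_psi j x)\<^sup>2 + f (omega j x) / (den_omega j x)\<^sup>2)"

lemma den_psi_pos: "j < 2 * h \<Longrightarrow> 0 \<le> x \<Longrightarrow> 0 < den_psi j x"
  unfolding den_psi_def using s_pos[of "Suc j"] s_nonneg[of j] by (intro add_nonneg_pos) auto

lemma den_omega_pos: "h \<le> j \<Longrightarrow> j \<le> 2 * h \<Longrightarrow> 0 \<le> x \<Longrightarrow> 0 < den_omega j x"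
  unfolding den_omega_def using s_pos[of j] s_nonneg[of "Suc j"] h_pos by (intro add_nonneg_pos) auto

lemma den_psi_2h [simp]: "den_psi (2 * h) x = x"
  by (simp add: den_psi_def s_2h)

lemma psi_range: assumes "h \<le> j" "j < 2 * h" "0 \<le> x" "x \<le> 1" shows "psi j x \<in> {0..1}"
proof -
  have "den_psi (Suc j) x \<le> den_psi j x"
    unfolding den_psi_def using s_dec[of j] s_dec[of "Suc j"] assms by (intro add_mono mult_right_mono) auto
  moreover have "0 \<le> den_psi (Suc j) x"
    unfolding den_psi_def using s_nonneg[of "Suc j"] s_nonneg[of "Suc (Suc j)"] assms by auto
  ultimately show ?thesis using den_psi_pos[of j x] assms by (auto simp: psi_def)
qed

text \<open>\<open>1 / (1 + lm)\<close> is \<open>psi (2 * h - 1) 1\<close>, the right end of the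
  image of the parabolic branch. All other branches land to the right of it, here and in
  \<open>psi_ge\<close>; \<open>s_ratio\<close> is the reason.\<close>

lemma omega_ge:
  assumes "h \<le> j" "j < 2 * h" "0 \<le> x" "x \<le> 1" 
  shows "1 / (1 + lm) \<le> omega j x" "omega j x \<le> 1"
proof -
  have pos: "0 < den_omega j x" "0 < den_omega (Suc j) x" using den_omega_pos assms by auto
  have "den_omega (Suc j) x \<le> den_omega j x"
    unfolding den_omega_def using s_dec[of j] s_dec[of "Suc j"] assms by (intro add_mono mult_right_mono) auto
  then show "omega j x \<le> 1" using pos by (simp add: omega_def)
  have "den_omega j x \<le> (1 + lm) * s (Suc j)"
    using s_ratio[of j] s_nonneg[of "Suc j"] assms
      mult_right_mono[of x 1 "s (Suc j)"] by (simp add: den_omega_def algebra_simps)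
  also have "\<dots> \<le> (1 + lm) * den_omega (Suc j) x"
    using s_nonneg[of "Suc (Suc j)"] lm_ge_1 assms by (intro mult_left_mono) (auto simp: den_omega_def)
  finally show "1 / (1 + lm) \<le> omega j x"
    using pos lm_ge_1 by (simp add: omega_def field_simps)
qed

lemma omega_range: assumes "h \<le> j" "j < 2 * h" "0 \<le> x" "x \<le> 1" shows "omega j x \<in> {0..1}"
  using omega_ge[OF assms] lm_ge_1 by (auto intro: order_trans[rotated])

lemma psi_ge:
  assumes "Suc j < 2 * h" "0 \<le> x"
  shows "1 / (1 + lm) \<le> psi j x"
proof -
  have pos: "0 < den_psi j x" "0 < den_psi (Suc j) x" using den_psi_pos assms by auto
  have "den_psi j x \<le> (lm * s (Suc j)) * x + lm * s (Suc (Suc j))" unfolding den_psi_def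
    using s_ratio[of j] s_ratio[of "Suc j"] assms by (intro add_mono mult_right_mono) auto
  also have "\<dots> = lm * den_psi (Suc j) x" by (simp add: den_psi_def algebra_simps)
  finally have "den_psi j x \<le> (1 + lm) * den_psi (Suc j) x" using pos by (simp add: algebra_simps)
  then show ?thesis using pos lm_ge_1 by (simp add: psi_def field_simps)
qed

lemma continuous_on_den_psi: "continuous_on S (den_psi j)" and continuous_on_den_omega: "continuous_on S (den_omega j)"
  unfolding den_psi_def[abs_def] den_omega_def[abs_def] by (intro continuous_intros)+

lemma continuous_on_transfer:
  assumes "continuous_on {0..1} f"
  shows "continuous_on {0..1} (transfer f)"
proof -
  have "continuous_on {0..1} (\<lambda>x. f (psi j x))" if "j \<in> {h..<2*h}" for j
  proof (rule continuous_on_compose2[OF assms])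
    show "continuous_on {0..1} (psi j)"
      unfolding psi_def[abs_def] using den_psi_pos[of j] that
      by (intro continuous_intros continuous_on_den_psi) (auto, fastforce)
  qed (use psi_range[of j] that in auto)
  moreover have "continuous_on {0..1} (\<lambda>x. f (omega j x))" if "j \<in> {h..<2*h}" for j
  proof (rule continuous_on_compose2[OF assms])
    show "continuous_on {0..1} (omega j)"
      unfolding omega_def[abs_def] using den_omega_pos[of j] that
      by (intro continuous_intros continuous_on_den_omega) (auto, fastforce)
  qed (use omega_range[of j] that in auto)
  ultimately show ?thesis
    unfolding transfer_def[abs_def]
    by (intro continuous_intros continuous_on_den_psi continuous_on_den_omega)
       (auto, (metis less_irrefl den_psi_pos den_omega_pos less_imp_le)+)
qed

lemma psi_integral:
  assumes "continuous_on {0..1} f" "h \<le> j" "j < 2 * h" "0 \<le> e" "e \<le> 1"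
  shows "((\<lambda>x. f (psi j x) / (den_psi j x)\<^sup>2) has_integral integral {0..psi j e} f - integral {0..psi j 0} f) {0..e}"
  using mobius_integral[OF assms(1,4), of "s j" "s (Suc j)" "s (Suc j)" "s (Suc (Suc j))"]
    s_det[of j] den_psi_pos[of j] psi_range[of j] assms
  by (simp add: psi_def den_psi_def mult.commute)

lemma omega_integral:
  assumes "continuous_on {0..1} f" "h \<le> j" "j < 2 * h" "0 \<le> e" "e \<le> 1"
  shows "((\<lambda>x. f (omega j x) / (den_omega j x)\<^sup>2) has_integral integral {0..omega j 0} f - integral {0..omega j e} f) {0..e}"
proof -
  have "s (Suc (Suc j)) * s j - s (Suc j) * s (Suc j) = -1" using s_det[of j] by (simp add: algebra_simps)
  then have "((\<lambda>x. - 1 * (f (omega j x) / (den_omega j x)\<^sup>2)) has_integral integral {0..omega j e} f - integral {0..omega j 0} f) {0..e}"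
    using mobius_integral[OF assms(1,4), of "s (Suc j)" "s j" "s (Suc (Suc j))" "s (Suc j)"]
      den_omega_pos[of j] omega_range[of j] assms
    by (simp add: omega_def den_omega_def)
  from has_integral_neg[OF this] show ?thesis by simp
qed

lemma psi_omega_1: "psi j 1 = omega j 1"
  by (simp add: psi_def omega_def den_psi_def den_omega_def add.commute)

text \<open>Each branch contributes the integral over its image. The two images of index
  \<open>j\<close> meet at \<open>psi j 1 = omega j 1\<close>, and their unions telescope from 1
  down to 0.\<close>

lemma integral_transfer:
  assumes "continuous_on {0..1} f"
  shows "integral {0..1} (transfer f) = integral {0..1} f"
proof -
  define F where "F x = integral {0..x} f" for x
  have "(transfer f has_integral (\<Sum>j\<in>{h..<2*h}. (F (psi j 1) - F (psi j 0)) + (F (omega j 0) - F (omega j 1)))) {0..1}"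
    unfolding transfer_def[abs_def] F_def
    by (intro has_integral_sum has_integral_add psi_integral omega_integral assms) auto
  also have "(\<Sum>j\<in>{h..<2*h}. (F (psi j 1) - F (psi j 0)) + (F (omega j 0) - F (omega j 1))) = 
     (\<Sum>j\<in>{h..<2*h}. F (s (Suc j) / s j) - F (s (Suc (Suc j)) / s (Suc j)))"
    by (simp add: psi_omega_1) (simp add: psi_def omega_def den_psi_def den_omega_def)
  also have "\<dots> = F 1 - F 0"
    using telescope_sum[of h "2 * h" "\<lambda>j. F (s (Suc j) / s j)"] s_mid s_pos[of h] h_pos by simp
  finally show ?thesis by (simp add: integral_unique F_def)
qed

section \<open>The operator in the symmetric coordinate and the class it preserves\<close>

definition cayley :: "real \<Rightarrow> real" where "cayley z = (1 - z) / (1 + z)"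

lemma transfer_eq_half_transfer:
  assumes z: "0 \<le> z" "z < 1"
  shows "cayley z * transfer f (cayley z) = half_transfer (\<lambda>z. cayley z * f (cayley z)) z + half_transfer (\<lambda>z. cayley z * f (cayley z)) (- z)"
proof -
  have Xpos: "0 < cayley z" using z by (simp add: cayley_def)
  have Uu: "U j z = (1 + z) * den_psi j (cayley z)" and Uv: "U j (- z) = (1 + z) * den_omega j (cayley z)" for j
    using z by (simp_all add: U_def den_psi_def den_omega_def cayley_def field_simps)
  have Xze: "cayley (zeta j t) = U (Suc j) t / U j t" if "0 < U j t" "0 < U (Suc j) t" for j t
    unfolding cayley_def zeta_def using that by (simp add: divide_simps)
  have gen: "weight j t * (cayley (zeta j t) * y) = (1 - t\<^sup>2) * (y / (U j t)\<^sup>2)"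
    if "0 < U j t" "0 < U (Suc j) t" for j t y
    unfolding Xze[OF that] weight_def using that by (simp add: power2_eq_square)
  have XX: "(1 - z\<^sup>2) / (1 + z)\<^sup>2 = cayley z" using z by (simp add: cayley_def power2_eq_square square_diff_one_factored[symmetric] divide_simps) (simp add: algebra_simps)
  have "weight j z * (cayley (zeta j z) * f (cayley (zeta j z))) = cayley z * (f (psi j (cayley z)) / (den_psi j (cayley z))\<^sup>2)"
    if "j \<in> {h..<2*h}" for j
  proof -
    have pos: "0 < U j z" "0 < U (Suc j) z" using U_pos that z by auto
    have "cayley (zeta j z) = psi j (cayley z)" unfolding Xze[OF pos] Uu psi_def using z by simp
    then show ?thesis unfolding gen[OF pos] Uu power_mult_distrib XX[symmetric] by simp
  qed
  moreover have "weight j (- z) * (cayley (zeta j (- z)) * f (cayley (zeta j (- z)))) = cayley z * (f (omega j (cayley z)) / (den_omega j (cayley z))\<^sup>2)"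
    if "j \<in> {h..<2*h}" for j
  proof -
    have pos: "0 < U j (- z)" "0 < U (Suc j) (- z)" using U_pos[of j "- z"] U_pos[of "Suc j" "- z"] that z by auto
    have "cayley (zeta j (- z)) = omega j (cayley z)" unfolding Xze[OF pos] Uv omega_def using z by simp
    then show ?thesis unfolding gen[OF pos] Uv power_mult_distrib XX[symmetric] by simp
  qed
  ultimately show ?thesis
    unfolding half_transfer_def transfer_def by (simp add: sum.distrib sum_distrib_left distrib_left)
qed

lemma cayley_cayley: "z \<noteq> - 1 \<Longrightarrow> cayley (cayley z) = z"
  unfolding cayley_def by (simp add: divide_simps)

text \<open>The last clause states the monotonicity on the \<open>x\<close> side so as to include
  \<open>x = 1\<close>, where the asymptotics are anchored.\<close>

definition admissible :: "(real \<Rightarrow> real) \<Rightarrow> bool" where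
  "admissible f \<longleftrightarrow> continuous_on {0..1} f \<and> (\<forall>x\<in>{0..1}. 0 \<le> f x) \<and> 
     dec_concave (\<lambda>z. cayley z * f (cayley z)) \<and> (\<forall>x y. 0 < x \<longrightarrow> x \<le> y \<longrightarrow> y \<le> 1 \<longrightarrow> x * f x \<le> y * f y)"

lemma transfer_nonneg:
  assumes "\<And>x. x \<in> {0..1} \<Longrightarrow> 0 \<le> f x" "x \<in> {0..1}"
  shows "0 \<le> transfer f x"
  unfolding transfer_def using assms psi_range[of _ x] omega_range[of _ x] 
  by (intro sum_nonneg add_nonneg_nonneg divide_nonneg_nonneg) auto

lemma admissible_transfer:
  assumes "admissible f"
  shows "admissible (transfer f)"
proof -
  let ?G = "\<lambda>z. cayley z * f (cayley z)" and ?H = "\<lambda>z. cayley z * transfer f (cayley z)"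
  have f: "continuous_on {0..1} f" "\<And>x. x \<in> {0..1} \<Longrightarrow> 0 \<le> f x" "dec_concave ?G"
    using assms by (auto simp: admissible_def)
  have "dec_concave (\<lambda>z. half_transfer ?G z + half_transfer ?G (- z))" by (rule half_transfer_sym_dec_concave[OF f(3)])
  then have conc: "dec_concave ?H" by (rule dec_concave_cong) (simp add: transfer_eq_half_transfer)
  have "x * transfer f x \<le> y * transfer f y" if "0 < x" "x \<le> y" "y \<le> 1" for x y
  proof (cases "y = 1")
    case True
    have "0 \<le> cayley x" "cayley x < 1" using that by (auto simp: cayley_def)
    then have "?H (cayley x) \<le> ?H 0"
      using half_transfer_sym_dec_concave(2)[OF f(3), of "cayley x"] transfer_eq_half_transfer[of "cayley x" f] transfer_eq_half_transfer[of 0 f] by simp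
    moreover have "cayley 0 = 1" by (simp add: cayley_def)
    ultimately show ?thesis using cayley_cayley[of x] that True by simp
  next
    case False
    then have "0 < cayley y" "cayley x < 1" using that by (auto simp: cayley_def)
    moreover have "cayley y \<le> cayley x" unfolding cayley_def using that by (intro frac_le) auto
    ultimately have "0 < cayley y" "cayley y \<le> cayley x" "cayley x < 1" by auto
    from dec_concave_antimono[OF conc this] show ?thesis
      using cayley_cayley[of x] cayley_cayley[of y] that by simp
  qed
  then show ?thesis
    unfolding admissible_def using continuous_on_transfer[OF f(1)] transfer_nonneg[of f, OF f(2)] conc by auto
qed

lemma admissible_transfer_pow: "admissible f \<Longrightarrow> admissible ((transfer ^^ n) f)"
  by (induction n) (auto intro: admissible_transfer)

section \<open>Splitting off the parabolic branch at 0\<close>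

definition far_transfer :: "(real \<Rightarrow> real) \<Rightarrow> real \<Rightarrow> real" where
  "far_transfer f x = (\<Sum>j\<in>{h..<2*h-1}. f (psi j x) / (den_psi j x)\<^sup>2) + (\<Sum>j\<in>{h..<2*h}. f (omega j x) / (den_omega j x)\<^sup>2)"

lemma transfer_split: "transfer f x = f (x / (1 + lm * x)) / (1 + lm * x)\<^sup>2 + far_transfer f x"
proof -
  obtain n where n: "2 * h = Suc n" "h \<le> n" using h_pos by (cases "2 * h") auto
  have "s n = lm" using s_2h1 n by simp
  then have "den_psi n x = 1 + lm * x" "den_psi (Suc n) x = x"
    using s_2h den_psi_2h[of x] n by (simp_all add: den_psi_def)
  then show ?thesis using n by (simp add: transfer_def far_transfer_def sum.distrib psi_def)
qed

text \<open>For positive \<open>x\<close> this is the invariance of \<open>1/x\<close> with the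
  parabolic term \<open>1 / (x * (1 + lm * x))\<close> moved to the other side. By
  \<open>s_det\<close> both sums telescope.\<close>

lemma far_transfer_weights:
  assumes "0 \<le> x"
  shows "(\<Sum>j\<in>{h..<2*h-1}. 1 / (den_psi j x * den_psi (Suc j) x)) + (\<Sum>j\<in>{h..<2*h}. 1 / (den_omega j x * den_omega (Suc j) x))
     = lm / (1 + lm * x)"
proof -
  have 1: "1 / (den_psi j x * den_psi (Suc j) x) = - s j / den_psi j x - - s (Suc j) / den_psi (Suc j) x" if "j \<in> {h..<2*h-1}" for j
  proof -
    have "0 < den_psi j x" "0 < den_psi (Suc j) x" using den_psi_pos assms that by auto
    moreover have "s (Suc j) * den_psi j x - s j * den_psi (Suc j) x = 1"
      using s_det[of j] by (simp add: den_psi_def algebra_simps)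
    ultimately show ?thesis by (simp add: field_simps)
  qed
  have 2: "1 / (den_omega j x * den_omega (Suc j) x) = s (Suc j) / den_omega j x - s (Suc (Suc j)) / den_omega (Suc j) x" if "j \<in> {h..<2*h}" for j
  proof -
    have "0 < den_omega j x" "0 < den_omega (Suc j) x" using den_omega_pos[of j x] den_omega_pos[of "Suc j" x] assms that by auto
    moreover have "s (Suc j) * den_omega (Suc j) x - s (Suc (Suc j)) * den_omega j x = 1"
      using s_det[of j] by (simp add: den_omega_def algebra_simps)
    ultimately show ?thesis by (simp add: field_simps)
  qed
  have "h \<le> 2 * h - 1" "Suc (2 * h - 1) = 2 * h" using h_pos by auto
  then have "(\<Sum>j\<in>{h..<2*h-1}. - s j / den_psi j x - - s (Suc j) / den_psi (Suc j) x) = - s h / den_psi h x + lm / (lm * x + 1)"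
    using telescope_sum[of h "2 * h - 1" "\<lambda>j. - s j / den_psi j x"] s_2h1 s_2h by (simp add: den_psi_def)
  then have "(\<Sum>j\<in>{h..<2*h-1}. 1 / (den_psi j x * den_psi (Suc j) x)) = - s h / den_psi h x + lm / (lm * x + 1)"
    using sum.cong[OF refl 1, of "{h..<2*h-1}" "\<lambda>j. j"] by simp
  moreover have "(\<Sum>j\<in>{h..<2*h}. 1 / (den_omega j x * den_omega (Suc j) x)) = s (Suc h) / den_omega h x"
    using telescope_sum[of h "2 * h" "\<lambda>j. s (Suc j) / den_omega j x"] by (simp add: 2)
  moreover have "den_omega h x = den_psi h x" by (simp add: den_psi_def den_omega_def s_mid)
  ultimately show ?thesis by (simp add: s_mid add.commute)
qed

lemma far_transfer_terms:
  assumes "0 \<le> x" "x \<le> 1"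
  shows "far_transfer f x = (\<Sum>j\<in>{h..<2*h-1}. psi j x * f (psi j x) * (1 / (den_psi j x * den_psi (Suc j) x)))
      + (\<Sum>j\<in>{h..<2*h}. omega j x * f (omega j x) * (1 / (den_omega j x * den_omega (Suc j) x)))"
proof -
  have "f (psi j x) / (den_psi j x)\<^sup>2 = psi j x * f (psi j x) * (1 / (den_psi j x * den_psi (Suc j) x))" if "j \<in> {h..<2*h-1}" for j
    using den_psi_pos[of j x] den_psi_pos[of "Suc j" x] that assms by (simp add: psi_def power2_eq_square less_diff_conv)
  moreover have "f (omega j x) / (den_omega j x)\<^sup>2 = omega j x * f (omega j x) * (1 / (den_omega j x * den_omega (Suc j) x))" if "j \<in> {h..<2*h}" for j
    using den_omega_pos[of j x] den_omega_pos[of "Suc j" x] that assms by (simp add: omega_def power2_eq_square)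
  ultimately show ?thesis unfolding far_transfer_def by simp
qed

text \<open>By \<open>far_transfer_terms\<close> the operator is a positive combination of values
  \<open>y * f y\<close> at points away from 0, and \<open>far_transfer_weights\<close> gives the
  total weight.\<close>

lemma far_transfer_bounds:
  assumes x: "0 \<le> x" "x \<le> 1" 
  shows "(\<And>y. 1 / (1 + lm) \<le> y \<Longrightarrow> y \<le> 1 \<Longrightarrow> y * f y \<le> A) \<Longrightarrow> far_transfer f x \<le> A * (lm / (1 + lm * x))"
    and "(\<And>y. 1 / (1 + lm) \<le> y \<Longrightarrow> y \<le> 1 \<Longrightarrow> B \<le> y * f y) \<Longrightarrow> B * (lm / (1 + lm * x)) \<le> far_transfer f x"
proof -
  have psi: "1 / (1 + lm) \<le> psi j x" "psi j x \<le> 1" "0 \<le> 1 / (den_psi j x * den_psi (Suc j) x)" if "j \<in> {h..<2*h-1}" for j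
    using psi_ge[of j x] psi_range[of j x] den_psi_pos[of j x] den_psi_pos[of "Suc j" x] that x
    by (auto simp: less_diff_conv intro!: mult_nonneg_nonneg)
  have omega: "1 / (1 + lm) \<le> omega j x" "omega j x \<le> 1" "0 \<le> 1 / (den_omega j x * den_omega (Suc j) x)" if "j \<in> {h..<2*h}" for j
    using omega_ge[of j x] den_omega_pos[of j x] den_omega_pos[of "Suc j" x] that x by auto
  show "far_transfer f x \<le> A * (lm / (1 + lm * x))" if "\<And>y. 1 / (1 + lm) \<le> y \<Longrightarrow> y \<le> 1 \<Longrightarrow> y * f y \<le> A"
    unfolding far_transfer_weights[OF x(1), symmetric] far_transfer_terms[OF x] distrib_left sum_distrib_left
    using psi omega that by (intro add_mono sum_mono mult_right_mono) auto
  show "B * (lm / (1 + lm * x)) \<le> far_transfer f x" if "\<And>y. 1 / (1 + lm) \<le> y \<Longrightarrow> y \<le> 1 \<Longrightarrow> B \<le> y * f y"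
    unfolding far_transfer_weights[OF x(1), symmetric] far_transfer_terms[OF x] distrib_left sum_distrib_left
    using psi omega that by (intro add_mono sum_mono mult_right_mono) auto
qed

end

subsection \<open>A Tauberian lemma for monotone sequences\<close>

text \<open>For positive \<open>l\<close>, the integral of \<open>l / (1 + l * x)\<close> from 0 to
  \<open>1 / (1 + l * j)\<close>, of order \<open>1/j\<close>.\<close>

definition log_weight :: "real \<Rightarrow> nat \<Rightarrow> real" where
  "log_weight l j = ln (1 + l * real (Suc j)) - ln (1 + l * real j)"

lemma sum_log_weight: "(\<Sum>j<n. log_weight l j) = ln (1 + l * real n)"
  by (induction n) (simp_all add: log_weight_def)

lemma log_weight_le:
  assumes "0 < l"
  shows "log_weight l j \<le> l / (1 + l * real j)"
proof -
  have pos: "0 < 1 + l * real j" using assms by (simp add: add_pos_nonneg)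
  have pos': "0 < 1 + l * real (Suc j)" using assms by (intro add_pos_nonneg) auto
  have "1 + l / (1 + l * real j) = (1 + l * real (Suc j)) / (1 + l * real j)"
    using pos by (simp add: field_simps)
  then have "log_weight l j = ln (1 + l / (1 + l * real j))"
    using pos pos' by (simp add: log_weight_def ln_div)
  also have "\<dots> \<le> l / (1 + l * real j)" using assms pos by (intro ln_add_one_self_le_self) auto
  finally show ?thesis .
qed

lemma log_weight_nonneg: "0 < l \<Longrightarrow> 0 \<le> log_weight l j"
  unfolding log_weight_def by (simp add: add_pos_nonneg)

text \<open>The hypotheses bracket a convolution of \<open>a\<close> with weights of total
  \<open>ln (1 + l * n)\<close>. This total is asymptotically unchanged when \<open>n\<close> is
  replaced by \<open>n * ln n\<close>, which leaves enough room to compare a monotone sequence with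
  a single one of its values.\<close>

lemma monotone_tauberian:
  fixes a :: "nat \<Rightarrow> real"
  assumes l: "0 < l"
    and dec: "\<And>i j. i \<le> j \<Longrightarrow> a j \<le> a i" and nonneg: "\<And>n. 0 \<le> a n"
    and upper: "\<And>n. (\<Sum>j<n. log_weight l j * ((1 + l) * a (n - j) - l * a (n - Suc j))) \<le> I"
    and lower: "\<And>n. I \<le> J n + (\<Sum>j<n. log_weight l j * a (n - Suc j))" and J: "J \<longlonglongrightarrow> 0"
  shows "(\<lambda>n. a n * ln (real n)) \<longlonglongrightarrow> I"
proof -
  have w_le: "log_weight l j \<le> log_weight l i" if "i \<le> j" for i j
  proof -
    have "log_weight l (Suc k) \<le> log_weight l k" for k
    proof -
      have "0 \<le> l\<^sup>2" by simp
      then have "(1 + l * real (Suc (Suc k))) * (1 + l * real k) \<le> (1 + l * real (Suc k)) * (1 + l * real (Suc k))"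
        by (simp add: power2_eq_square algebra_simps)
      then have "ln ((1 + l * real (Suc (Suc k))) * (1 + l * real k)) \<le> ln ((1 + l * real (Suc k)) * (1 + l * real (Suc k)))"
        using l by (subst ln_le_cancel_iff) (auto intro!: mult_pos_pos add_pos_nonneg)
      moreover have "0 < 1 + l * real i" for i using l by (intro add_pos_nonneg) auto
      ultimately show ?thesis unfolding log_weight_def by (simp only: ln_mult_pos)
    qed
    then show ?thesis by (rule lift_Suc_antimono_le) (rule that)
  qed
  have tel: "(\<Sum>j<k. a (n - Suc j) - a (n - j)) = a (n - k) - a n" for k n
    by (induction k) auto
  define W where "W n = ln (1 + l * real n)" for n
  \<comment> \<open>Up to the factor \<open>l\<close>, the cost of turning the combination in
    \<open>upper\<close> into \<open>a (n - j)\<close>. The increments of \<open>a\<close>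
    telescope, with weight at most \<open>log_weight l 0\<close> before \<open>n div 2\<close> and
    at most \<open>log_weight l (n div 2)\<close> after it. Both parts vanish in the limit because
    \<open>a\<close> converges and the weights tend to 0.\<close>
  define err where "err n = log_weight l 0 * (a (n - n div 2) - a n) + log_weight l (n div 2) * a 0" for n
  have up: "a n * W n \<le> I + l * err n" for n
  proof -
    define k where "k = n div 2"
    have split: "sum g {..<n} = sum g {..<k} + sum g {k..<n}" for g :: "nat \<Rightarrow> real"
      using sum.union_disjoint[of "{..<k}" "{k..<n}" g] by (auto simp: k_def ivl_disj_un ivl_disj_int)
    have "(\<Sum>j<n. log_weight l j * (a (n - Suc j) - a (n - j))) \<le> 
       (\<Sum>j<k. log_weight l 0 * (a (n - Suc j) - a (n - j))) + (\<Sum>j\<in>{k..<n}. log_weight l k * (a (n - Suc j) - a (n - j)))"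
      unfolding split by (intro add_mono sum_mono mult_right_mono w_le) (auto intro!: dec)
    also have "(\<Sum>j\<in>{k..<n}. log_weight l k * (a (n - Suc j) - a (n - j))) = log_weight l k * (a 0 - a (n - k))"
      using split[of "\<lambda>j. a (n - Suc j) - a (n - j)"] tel[of n n] tel[of n k] by (simp add: sum_distrib_left[symmetric])
    also have "\<dots> \<le> log_weight l k * a 0" using nonneg log_weight_nonneg[OF l] by (intro mult_left_mono) auto
    finally have E: "(\<Sum>j<n. log_weight l j * (a (n - Suc j) - a (n - j))) \<le> err n"
      by (simp add: sum_distrib_left[symmetric] tel err_def k_def)
    have "a n * W n = (\<Sum>j<n. log_weight l j * a n)" by (simp add: W_def sum_log_weight[symmetric] sum_distrib_left mult.commute)
    also have "\<dots> \<le> (\<Sum>j<n. log_weight l j * a (n - j))"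
      by (intro sum_mono mult_left_mono dec log_weight_nonneg l) auto
    also have "\<dots> = (\<Sum>j<n. log_weight l j * ((1 + l) * a (n - j) - l * a (n - Suc j))) 
        + l * (\<Sum>j<n. log_weight l j * (a (n - Suc j) - a (n - j)))"
      by (simp add: sum_distrib_left sum.distrib[symmetric] algebra_simps)
    also have "\<dots> \<le> I + l * err n" using upper[of n] E l by (intro add_mono mult_left_mono) auto
    finally show ?thesis .
  qed
  have "\<forall>\<^sub>F n::nat in sequentially. Z \<le> n div 2 \<and> Z \<le> n - n div 2" for Z
    by (rule eventually_sequentiallyI[of "2 * Z"]) linarith
  then have half: "filterlim (\<lambda>n::nat. n div 2) at_top at_top" "filterlim (\<lambda>n::nat. n - n div 2) at_top at_top"
    unfolding filterlim_at_top by (auto simp: eventually_conj_iff)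
  have w0: "log_weight l \<longlonglongrightarrow> 0"
  proof (rule tendsto_sandwich[OF always_eventually always_eventually tendsto_const])
    show "(\<lambda>j. l / (1 + l * real j)) \<longlonglongrightarrow> 0" using l by real_asymp
  qed (use log_weight_le[OF l] log_weight_nonneg[OF l] in auto)
  have "decseq a" unfolding decseq_def by (simp add: dec)
  then obtain A where A: "a \<longlonglongrightarrow> A" 
    by (rule decseq_convergent[of a 0]) (use nonneg in auto)
  have "err \<longlonglongrightarrow> log_weight l 0 * (A - A) + 0 * a 0"
    unfolding err_def
    by (intro tendsto_intros A filterlim_compose[OF A half(2)] filterlim_compose[OF w0 half(1)])
  then have err0: "err \<longlonglongrightarrow> 0" by simp
  \<comment> \<open>Growth of order \<open>ln m\<close> is a compromise: \<open>a 0 / N m\<close>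
    tends to 0, while \<open>ln ((N m + 1) * m)\<close> is still asymptotic to
    \<open>ln m\<close>.\<close>
  define N where "N m = nat \<lceil>ln (real m)\<rceil> + 1" for m :: nat
  have N: "ln (real m) + 1 \<le> real (N m)" "real (N m) \<le> ln (real m) + 2" if "m \<ge> 1" for m
  proof -
    have "0 \<le> ln (real m)" using that by simp
    then show "ln (real m) + 1 \<le> real (N m)" "real (N m) \<le> ln (real m) + 2" unfolding N_def by linarith+
  qed
  have low: "I - J ((N m + 1) * m) - a 0 / N m \<le> a m * W ((N m + 1) * m)" if m: "m \<ge> 1" for m
  proof -
    \<comment> \<open>For \<open>j < N m * m\<close> the index \<open>n - Suc j\<close> is at least
      \<open>m\<close>, so \<open>a m\<close> dominates. Each of the last \<open>m\<close> weights
      is at most \<open>1 / (N m * m)\<close>, so together they cost at most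
      \<open>a 0 / N m\<close>.\<close>
    define n where "n = (N m + 1) * m"
    have N1: "N m \<ge> 1" by (simp add: N_def)
    have Nm: "N m * m \<le> n" "n - N m * m = m" by (auto simp: n_def algebra_simps)
    have split: "sum g {..<n} = sum g {..<N m * m} + sum g {N m * m..<n}" for g :: "nat \<Rightarrow> real"
      using sum.union_disjoint[of "{..<N m * m}" "{N m * m..<n}" g] Nm by (auto simp: ivl_disj_un ivl_disj_int)
    have "(\<Sum>j<n. log_weight l j * a (n - Suc j)) = (\<Sum>j<N m * m. log_weight l j * a (n - Suc j)) + (\<Sum>j\<in>{N m * m..<n}. log_weight l j * a (n - Suc j))"
      by (rule split)
    also have "\<dots> \<le> (\<Sum>j<N m * m. log_weight l j * a m) + (\<Sum>j\<in>{N m * m..<n}. 1 / (real (N m) * real m) * a 0)"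
    proof (intro add_mono sum_mono mult_mono nonneg log_weight_nonneg l mult_left_mono)
      fix j assume "j \<in> {..<N m * m}"
      then show "a (n - Suc j) \<le> a m" using Nm by (intro dec) auto
    next
      fix j assume j: "j \<in> {N m * m..<n}"
      have pos: "0 < real (N m) * real m" using N1 m by simp
      have "log_weight l j \<le> l / (1 + l * real j)" by (rule log_weight_le[OF l])
      also have "\<dots> \<le> l / (l * (real (N m) * real m))"
      proof (rule divide_left_mono)
        have "real (N m * m) \<le> real j" using j by (subst of_nat_le_iff) simp
        then have "l * (real (N m) * real m) \<le> l * real j" using l by simp
        then show "l * (real (N m) * real m) \<le> 1 + l * real j" by simp
      qed (use l pos in \<open>auto intro!: mult_pos_pos add_pos_nonneg\<close>)
      finally show "log_weight l j \<le> 1 / (real (N m) * real m)" using l by simp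
    qed (auto intro: dec)
    also have "(\<Sum>j<N m * m. log_weight l j * a m) \<le> (\<Sum>j<n. log_weight l j * a m)"
      by (rule sum_mono2) (use Nm nonneg log_weight_nonneg[OF l] in auto)
    also have "\<dots> = a m * W n" by (simp add: W_def sum_log_weight[symmetric] sum_distrib_left mult.commute)
    also have "(\<Sum>j\<in>{N m * m..<n}. 1 / (real (N m) * real m) * a 0) = a 0 / N m"
      using Nm m by simp
    finally show ?thesis using lower[of n] by (simp add: n_def)
  qed
  define r where "r m = ln (real m) / W ((N m + 1) * m)" for m
  have "r \<longlonglongrightarrow> 1"
  proof (rule tendsto_sandwich)
    show "(\<lambda>m. ln (real m) / ln (1 + l * (ln (real m) + 3) * real m)) \<longlonglongrightarrow> 1"
      using l by real_asymp
    show "(\<lambda>m. ln (real m) / ln (1 + l * real m)) \<longlonglongrightarrow> 1"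
      using l by real_asymp
    have W_pos: "0 < ln (1 + l * y * real m)" if "m \<ge> 2" "1 \<le> y" for m y
      using that l by (intro ln_gt_zero) (auto intro!: mult_pos_pos)
    have pos1: "0 < 1 + l * y * real m" if "1 \<le> y" for m y
      using that l by (intro add_pos_nonneg) (auto intro!: mult_nonneg_nonneg)
    show "\<forall>\<^sub>F m in sequentially. ln (real m) / ln (1 + l * (ln (real m) + 3) * real m) \<le> r m"
      using eventually_ge_at_top[of 2]
    proof eventually_elim
      case (elim m)
      have W: "W ((N m + 1) * m) = ln (1 + l * real (N m + 1) * real m)" by (simp only: W_def of_nat_mult mult.assoc)
      have L: "0 \<le> ln (real m)" using elim by simp
      have "ln (1 + l * real (N m + 1) * real m) \<le> ln (1 + l * (ln (real m) + 3) * real m)"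
        using N[of m] elim l L pos1[of "real (N m + 1)" m] by (intro ln_mono add_left_mono mult_right_mono mult_left_mono) auto
      then show ?case unfolding r_def W using W_pos[of m "real (N m + 1)"] W_pos[of m "ln (real m) + 3"] elim L
        by (intro divide_left_mono mult_pos_pos) auto
    qed
    show "\<forall>\<^sub>F m in sequentially. r m \<le> ln (real m) / ln (1 + l * real m)"
      using eventually_ge_at_top[of 2]
    proof eventually_elim
      case (elim m)
      have W: "W ((N m + 1) * m) = ln (1 + l * real (N m + 1) * real m)" by (simp only: W_def of_nat_mult mult.assoc)
      have L: "0 \<le> ln (real m)" using elim by simp
      have "ln (1 + l * 1 * real m) \<le> ln (1 + l * real (N m + 1) * real m)"
        using l pos1[of 1 m] by (intro ln_mono add_left_mono mult_right_mono mult_left_mono) auto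
      then show ?case unfolding r_def W using W_pos[of m "real (N m + 1)"] W_pos[of m 1] elim L
        by (intro divide_left_mono mult_pos_pos) auto
    qed
  qed
  show ?thesis
  proof (rule tendsto_sandwich)
    have "filterlim (\<lambda>m. (N m + 1) * m) at_top at_top"
      by (rule filterlim_at_top_mono[OF filterlim_ident always_eventually]) simp
    then have J': "(\<lambda>m. J ((N m + 1) * m)) \<longlonglongrightarrow> 0" by (rule filterlim_compose[OF J])
    have N': "(\<lambda>m. a 0 / real (N m)) \<longlonglongrightarrow> 0"
    proof (rule tendsto_sandwich[OF _ _ tendsto_const])
      show "(\<lambda>m. a 0 / (ln (real m) + 1)) \<longlonglongrightarrow> 0" by real_asymp
      show "\<forall>\<^sub>F m in sequentially. a 0 / real (N m) \<le> a 0 / (ln (real m) + 1)"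
        using eventually_ge_at_top[of 1]
      proof eventually_elim
        case (elim m)
        have "0 \<le> ln (real m)" using elim by simp
        then show ?case using N[OF elim] nonneg by (intro divide_left_mono mult_pos_pos) auto
      qed
    qed (use nonneg in auto)
    have "(\<lambda>m. (I - J ((N m + 1) * m) - a 0 / N m) * r m) \<longlonglongrightarrow> (I - 0 - 0) * 1"
      by (intro tendsto_intros J' N' \<open>r \<longlonglongrightarrow> 1\<close>)
    then show "(\<lambda>m. (I - J ((N m + 1) * m) - a 0 / N m) * r m) \<longlonglongrightarrow> I" by simp
    have "(\<lambda>m. ln (real m) / W m) \<longlonglongrightarrow> 1" unfolding W_def using l by real_asymp
    then have "(\<lambda>m. (I + l * err m) * (ln (real m) / W m)) \<longlonglongrightarrow> (I + l * 0) * 1"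
      by (intro tendsto_intros err0)
    then show "(\<lambda>m. (I + l * err m) * (ln (real m) / W m)) \<longlonglongrightarrow> I" by simp
    show "\<forall>\<^sub>F m in sequentially. (I - J ((N m + 1) * m) - a 0 / N m) * r m \<le> a m * ln (real m)"
      using eventually_ge_at_top[of 2]
    proof eventually_elim
      case (elim m)
      have "0 < real ((N m + 1) * m)" using elim unfolding of_nat_0_less_iff by simp
      then have "0 < l * real ((N m + 1) * m)" by (rule mult_pos_pos[OF l])
      then have "0 < W ((N m + 1) * m)" unfolding W_def by (intro ln_gt_zero) linarith
      then have "0 \<le> r m" "W ((N m + 1) * m) * r m = ln (real m)" using elim by (auto simp: r_def)
      moreover have "(I - J ((N m + 1) * m) - a 0 / N m) * r m \<le> a m * W ((N m + 1) * m) * r m"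
        using low[of m] elim \<open>0 \<le> r m\<close> by (intro mult_right_mono) auto
      ultimately show ?case by (simp add: mult.assoc)
    qed
    show "\<forall>\<^sub>F m in sequentially. a m * ln (real m) \<le> (I + l * err m) * (ln (real m) / W m)"
      using eventually_ge_at_top[of 2]
    proof eventually_elim
      case (elim m)
      have W: "0 < W m" unfolding W_def using l elim by (intro ln_gt_zero) auto
      have "a m * ln (real m) = a m * W m * (ln (real m) / W m)" using W by simp
      also have "\<dots> \<le> (I + l * err m) * (ln (real m) / W m)"
        using up[of m] W elim by (intro mult_right_mono divide_nonneg_pos) auto
      finally show ?case .
    qed
  qed
qed

subsection \<open>Conservation of mass\<close>

context hecke_odd begin

text \<open>The orbit of 1 under the parabolic branch \<open>x / (1 + lm * x)\<close>.\<close>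

definition eps :: "nat \<Rightarrow> real" where "eps j = 1 / (1 + lm * real j)"

lemma eps_bounds: "0 < eps j" "eps j \<le> 1"
proof -
  have "1 \<le> 1 + lm * real j" using lm_ge_1 by simp
  then show "0 < eps j" "eps j \<le> 1" by (simp_all add: eps_def)
qed

lemma eps_Suc: "eps j / (1 + lm * eps j) = eps (Suc j)"
proof -
  have "1 + lm * real j \<noteq> 0" using lm_ge_1 by (simp add: add_pos_nonneg less_imp_neq[symmetric])
  then show ?thesis by (simp add: eps_def divide_simps) (simp add: algebra_simps)
qed

lemma parabolic_pos: "0 \<le> x \<Longrightarrow> 0 < 1 + lm * x"
  using lm_ge_1 by (intro add_pos_nonneg) auto

lemma parabolic_range: "0 \<le> x \<Longrightarrow> x / (1 + lm * x) \<in> {0..1}"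
  using parabolic_pos[of x] lm_ge_1 mult_right_mono[of 1 lm x] by auto

lemma parabolic_integral:
  assumes "continuous_on {0..1} f"
  shows "((\<lambda>x. f (x / (1 + lm * x)) / (1 + lm * x)\<^sup>2) has_integral integral {0..eps (Suc j)} f) {0..eps j}"
proof -
  have "((\<lambda>x. (1 * 1 - 0 * lm) * (f ((1 * x + 0) / (lm * x + 1)) / (lm * x + 1)\<^sup>2)) has_integral
     integral {0..(1 * eps j + 0) / (lm * eps j + 1)} f - integral {0..(1 * 0 + 0) / (lm * 0 + 1)} f) {0..eps j}"
  proof (rule mobius_integral[OF assms])
    show "0 \<le> eps j" using eps_bounds(1)[of j] by simp
    fix x assume "x \<in> {0..eps j}"
    then have "0 \<le> x" by simp
    then show "0 < lm * x + 1" "(1 * x + 0) / (lm * x + 1) \<in> {0..1}"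
      using parabolic_pos[of x] parabolic_range[of x] by (simp_all add: add.commute)
  qed
  then show ?thesis by (simp add: eps_Suc add.commute[of _ 1])
qed

lemma continuous_on_far_transfer:
  assumes "continuous_on {0..1} f"
  shows "continuous_on {0..1} (far_transfer f)"
proof -
  have nz: "1 + lm * x \<noteq> 0" if "x \<in> {0..1}" for x using parabolic_pos[of x] that by auto
  have fx: "continuous_on {0..1} (\<lambda>x. f (x / (1 + lm * x)))"
  proof (rule continuous_on_compose2[OF assms])
    show "continuous_on {0..1} (\<lambda>x. x / (1 + lm * x))"
      by (intro continuous_intros) (use nz in auto)
  qed (rule image_subsetI, rule parabolic_range, simp)
  have sq: "continuous_on {0..1} (\<lambda>x. (1 + lm * x)\<^sup>2)" by (intro continuous_intros)
  have "continuous_on {0..1} (\<lambda>x. f (x / (1 + lm * x)) / (1 + lm * x)\<^sup>2)"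
    by (rule continuous_on_divide[OF fx sq]) (use nz in auto)
  from continuous_on_diff[OF continuous_on_transfer[OF assms] this]
  have "continuous_on {0..1} (\<lambda>x. transfer f x - f (x / (1 + lm * x)) / (1 + lm * x)\<^sup>2)" .
  moreover have "(\<lambda>x. transfer f x - f (x / (1 + lm * x)) / (1 + lm * x)\<^sup>2) = far_transfer f"
    by (rule ext) (simp add: transfer_split)
  ultimately show ?thesis by (simp only:)
qed

lemma integral_transfer_split:
  assumes "continuous_on {0..1} f"
  shows "integral {0..eps j} (transfer f) = integral {0..eps (Suc j)} f + integral {0..eps j} (far_transfer f)"
proof -
  have "far_transfer f integrable_on {0..eps j}"
    using continuous_on_far_transfer[OF assms] eps_bounds[of j]
    by (intro integrable_continuous_interval) (auto elim: continuous_on_subset)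
  then have "((\<lambda>x. f (x / (1 + lm * x)) / (1 + lm * x)\<^sup>2 + far_transfer f x) has_integral 
      integral {0..eps (Suc j)} f + integral {0..eps j} (far_transfer f)) {0..eps j}"
    by (intro has_integral_add parabolic_integral[OF assms] integrable_integral)
  then show ?thesis unfolding transfer_split[symmetric] by (rule integral_unique)
qed

lemma far_transfer_integral_bounds:
  assumes f: "continuous_on {0..1} f"
  shows "(\<And>y. 1 / (1 + lm) \<le> y \<Longrightarrow> y \<le> 1 \<Longrightarrow> y * f y \<le> A) \<Longrightarrow> integral {0..eps j} (far_transfer f) \<le> log_weight lm j * A"
    and "(\<And>y. 1 / (1 + lm) \<le> y \<Longrightarrow> y \<le> 1 \<Longrightarrow> B \<le> y * f y) \<Longrightarrow> log_weight lm j * B \<le> integral {0..eps j} (far_transfer f)"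
proof -
  have "((\<lambda>x. lm / (1 + lm * x)) has_integral ln (1 + lm * eps j) - ln (1 + lm * 0)) {0..eps j}"
  proof (rule fundamental_theorem_of_calculus)
    fix x assume "x \<in> {0..eps j}"
    then show "((\<lambda>x. ln (1 + lm * x)) has_vector_derivative lm / (1 + lm * x)) (at x within {0..eps j})"
      unfolding has_real_derivative_iff_has_vector_derivative[symmetric]
      using parabolic_pos[of x] by (auto intro!: derivative_eq_intros)
  qed (use eps_bounds[of j] in auto)
  moreover have "ln (1 + lm * eps j) = log_weight lm j"
  proof -
    have pos: "0 < 1 + lm * real j" "0 < 1 + lm * real (Suc j)" using parabolic_pos by auto
    have "1 + lm * eps j = (1 + lm * real (Suc j)) / (1 + lm * real j)"
      using pos by (simp add: eps_def field_simps)
    then show ?thesis using pos by (simp add: log_weight_def ln_div)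
  qed
  ultimately have "((\<lambda>x. lm / (1 + lm * x)) has_integral log_weight lm j) {0..eps j}" by simp
  note w = has_integral_mult_right[OF this]
  have "far_transfer f integrable_on {0..eps j}"
    using continuous_on_far_transfer[OF assms] eps_bounds[of j]
    by (intro integrable_continuous_interval) (auto elim: continuous_on_subset)
  note N = integrable_integral[OF this]
  show "integral {0..eps j} (far_transfer f) \<le> log_weight lm j * A" 
    if "\<And>y. 1 / (1 + lm) \<le> y \<Longrightarrow> y \<le> 1 \<Longrightarrow> y * f y \<le> A"
    using has_integral_le[OF N w[of A]] far_transfer_bounds(1)[of _ f A] that eps_bounds[of j] by (simp add: mult.commute)
  show "log_weight lm j * B \<le> integral {0..eps j} (far_transfer f)" 
    if "\<And>y. 1 / (1 + lm) \<le> y \<Longrightarrow> y \<le> 1 \<Longrightarrow> B \<le> y * f y"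
    using has_integral_le[OF w[of B] N] far_transfer_bounds(2)[of _ B f] that eps_bounds[of j] by (simp add: mult.commute)
qed

lemma continuous_on_transfer_pow: "continuous_on {0..1} f \<Longrightarrow> continuous_on {0..1} ((transfer ^^ n) f)"
  by (induction n) (auto intro: continuous_on_transfer)

lemma integral_transfer_pow: "continuous_on {0..1} f \<Longrightarrow> integral {0..1} ((transfer ^^ n) f) = integral {0..1} f"
  by (induction n) (auto simp: integral_transfer continuous_on_transfer_pow)

text \<open>Iterates \<open>integral_transfer_split\<close> from the whole interval down to
  \<open>eps n\<close>: each step removes one transfer and moves the right end along the parabolic
  orbit. The leftover mass of \<open>f\<close> near 0 becomes the error \<open>J\<close> of
  \<open>monotone_tauberian\<close>.\<close>

lemma mass_decomposition:
  assumes f: "continuous_on {0..1} f"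
  shows "integral {0..1} f = integral {0..eps n} f + (\<Sum>j<n. integral {0..eps j} (far_transfer ((transfer ^^ (n - Suc j)) f)))"
proof -
  have "integral {0..1} ((transfer ^^ n) f) = integral {0..eps i} ((transfer ^^ (n - i)) f) 
     + (\<Sum>j<i. integral {0..eps j} (far_transfer ((transfer ^^ (n - Suc j)) f)))" if "i \<le> n" for i
    using that
  proof (induction i)
    case 0
    show ?case by (simp add: eps_def)
  next
    case (Suc i)
    then have "n - i = Suc (n - Suc i)" by simp
    then have "integral {0..eps i} ((transfer ^^ (n - i)) f) = 
      integral {0..eps (Suc i)} ((transfer ^^ (n - Suc i)) f) + integral {0..eps i} (far_transfer ((transfer ^^ (n - Suc i)) f))"
      using integral_transfer_split[OF continuous_on_transfer_pow[OF f], of i "n - Suc i"] by simp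
    then show ?case using Suc by simp
  qed
  from this[of n] show ?thesis using integral_transfer_pow[OF f] by simp
qed

text \<open>\<open>transfer_split\<close> with its second part bounded above. It serves in reverse:
  the value at \<open>x\<close> one step later bounds the value at \<open>x / (1 + lm * x)\<close>
  from below.\<close>

lemma parabolic_invariance:
  assumes "0 \<le> x" "x \<le> 1" "\<And>y. 1 / (1 + lm) \<le> y \<Longrightarrow> y \<le> 1 \<Longrightarrow> y * f y \<le> A"
  shows "x * transfer f x * (1 + lm * x) \<le> x / (1 + lm * x) * f (x / (1 + lm * x)) + A * lm * x"
proof -
  have pos: "0 < 1 + lm * x" by (rule parabolic_pos[OF assms(1)])
  have split: "x * (F / t\<^sup>2 + M) * t = x / t * F + x * t * M" if "0 < t" for t F M :: real
    using that by (simp add: power2_eq_square field_simps)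
  have "x * transfer f x * (1 + lm * x) = x / (1 + lm * x) * f (x / (1 + lm * x)) + x * (1 + lm * x) * far_transfer f x"
    unfolding transfer_split[of f x] by (rule split[OF pos])
  also have "x * (1 + lm * x) * far_transfer f x \<le> x * (1 + lm * x) * (A * (lm / (1 + lm * x)))"
    using assms pos by (intro mult_left_mono far_transfer_bounds) auto
  also have "\<dots> = A * lm * x" using pos by simp
  finally show ?thesis by simp
qed

section \<open>Asymptotics for admissible densities\<close>

lemma admissible_asymptotics_1:
  assumes "admissible f"
  shows "(\<lambda>n. (transfer ^^ n) f 1 * ln (real n)) \<longlonglongrightarrow> integral {0..1} f"
proof (rule monotone_tauberian[of lm _ _ "\<lambda>n. integral {0..eps n} f"])
  define a where "a n = (transfer ^^ n) f 1" for n
  have g: "admissible ((transfer ^^ n) f)" for n by (rule admissible_transfer_pow[OF assms])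
  have cont: "continuous_on {0..1} f" using assms by (simp add: admissible_def)
  have mono: "x * (transfer ^^ n) f x \<le> a n" if "0 < x" "x \<le> 1" for x n
  proof -
    have "x * (transfer ^^ n) f x \<le> 1 * (transfer ^^ n) f 1" using g[of n] that unfolding admissible_def by blast
    then show ?thesis by (simp add: a_def)
  qed
  have e1: "0 < 1 / (1 + lm)" "1 / (1 + lm) \<le> 1" using lm_ge_1 by auto
  \<comment> \<open>\<open>parabolic_invariance\<close> at \<open>x = 1\<close> bounds the value at
    \<open>1 / (1 + lm)\<close> from below, and monotonicity carries the bound to the right. This is
    the source of the combination in hypothesis \<open>upper\<close> of
    \<open>monotone_tauberian\<close>.\<close>
  have ge: "(1 + lm) * a (Suc n) - lm * a n \<le> 1 / (1 + lm) * (transfer ^^ n) f (1 / (1 + lm))" for n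
    using parabolic_invariance[of 1 "(transfer ^^ n) f" "a n"] mono[OF less_le_trans[OF e1(1)]]
    by (simp add: a_def algebra_simps)
  have ge': "(1 + lm) * a (Suc n) - lm * a n \<le> y * (transfer ^^ n) f y" if "1 / (1 + lm) \<le> y" "y \<le> 1" for n y
  proof -
    have "1 / (1 + lm) * (transfer ^^ n) f (1 / (1 + lm)) \<le> y * (transfer ^^ n) f y"
      using g[of n] that e1 unfolding admissible_def by blast
    then show ?thesis using ge[of n] by linarith
  qed
  show "0 < lm" using lm_ge_1 by simp
  show "0 \<le> (transfer ^^ n) f 1" for n using g[of n] by (simp add: admissible_def)
  have "a (Suc n) \<le> a n" for n
  proof -
    have "(1 + lm) * a (Suc n) \<le> (1 + lm) * a n"
      using ge[of n] mono[OF e1, of n] by (simp add: algebra_simps)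
    then show ?thesis using lm_ge_1 by simp
  qed
  then show "(transfer ^^ j) f 1 \<le> (transfer ^^ i) f 1" if "i \<le> j" for i j
    using lift_Suc_antimono_le[of a i j] that by (simp add: a_def)
  show "(\<Sum>j<n. log_weight lm j * ((1 + lm) * (transfer ^^ (n - j)) f 1 - lm * (transfer ^^ (n - Suc j)) f 1)) \<le> integral {0..1} f" for n
  proof -
    have "(\<Sum>j<n. log_weight lm j * ((1 + lm) * (transfer ^^ (n - j)) f 1 - lm * (transfer ^^ (n - Suc j)) f 1)) 
        \<le> (\<Sum>j<n. integral {0..eps j} (far_transfer ((transfer ^^ (n - Suc j)) f)))"
    proof (rule sum_mono)
      fix j assume "j \<in> {..<n}"
      then have "n - j = Suc (n - Suc j)" by auto
      then show "log_weight lm j * ((1 + lm) * (transfer ^^ (n - j)) f 1 - lm * (transfer ^^ (n - Suc j)) f 1) \<le> 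
         integral {0..eps j} (far_transfer ((transfer ^^ (n - Suc j)) f))"
        using far_transfer_integral_bounds(2)[OF continuous_on_transfer_pow[OF cont] ge'] by (metis a_def)
    qed
    moreover have "0 \<le> integral {0..eps n} f"
      using assms eps_bounds[of n] by (intro Henstock_Kurzweil_Integration.integral_nonneg integrable_continuous_interval)
        (auto simp: admissible_def elim: continuous_on_subset)
    ultimately show ?thesis using mass_decomposition[OF cont, of n] by linarith
  qed
  show "integral {0..1} f \<le> integral {0..eps n} f + (\<Sum>j<n. log_weight lm j * (transfer ^^ (n - Suc j)) f 1)" for n
    unfolding mass_decomposition[OF cont, of n]
    using mono[OF less_le_trans[OF e1(1)]] by (intro add_left_mono sum_mono far_transfer_integral_bounds(1) continuous_on_transfer_pow[OF cont])
      (auto simp: a_def)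
  show "(\<lambda>n. integral {0..eps n} f) \<longlonglongrightarrow> 0"
  proof -
    have "continuous_on {0..1} (\<lambda>x. integral {0..x} f)"
      by (intro indefinite_integral_continuous_1 integrable_continuous_interval cont)
    moreover have "eps \<longlonglongrightarrow> 0" unfolding eps_def[abs_def] using lm_ge_1 by real_asymp
    ultimately have "(\<lambda>n. integral {0..eps n} f) \<longlonglongrightarrow> integral {0..0} f"
    proof (rule continuous_on_tendsto_compose)
      show "\<forall>\<^sub>F n in sequentially. eps n \<in> {0..1}"
        using eps_bounds by (intro always_eventually allI) (simp add: less_imp_le)
    qed simp
    then show ?thesis by simp
  qed
qed

text \<open>The value at 1 is an upper bound. Lower bounds travel towards 0 along
  \<open>eps j\<close>, by comparing time \<open>Suc n\<close> at \<open>eps j\<close> with time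
  \<open>n\<close> at \<open>eps (Suc j)\<close>; any \<open>eps j\<close> below \<open>y\<close>
  then completes the squeeze.\<close>

lemma admissible_asymptotics:
  assumes "admissible f" "0 < y" "y \<le> 1"
  shows "(\<lambda>n. y * (transfer ^^ n) f y * ln (real n)) \<longlonglongrightarrow> integral {0..1} f"
proof -
  let ?I = "integral {0..1} f"
  have g: "admissible ((transfer ^^ n) f)" for n by (rule admissible_transfer_pow[OF assms(1)])
  have mono: "x * (transfer ^^ n) f x \<le> y * (transfer ^^ n) f y" if "0 < x" "x \<le> y" "y \<le> 1" for x y n
    using g[of n] that unfolding admissible_def by blast
  have lnn: "0 \<le> ln (real n)" for n by (cases "n = 0") auto
  have e1: "0 < 1 / (1 + lm)" "1 / (1 + lm) \<le> 1" using lm_ge_1 by auto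
  have at_eps: "(\<lambda>n. eps j * (transfer ^^ n) f (eps j) * ln (real n)) \<longlonglongrightarrow> ?I" for j
  proof (induction j)
    case 0
    show ?case using admissible_asymptotics_1[OF assms(1)] by (simp add: eps_def)
  next
    case (Suc j)
    define b where "b n = eps j * (transfer ^^ n) f (eps j) * ln (real n)" for n
    define c where "c n = (transfer ^^ n) f 1 * ln (real n)" for n
    have c: "c \<longlonglongrightarrow> ?I" unfolding c_def by (rule admissible_asymptotics_1[OF assms(1)])
    have b: "b \<longlonglongrightarrow> ?I" unfolding b_def by (rule Suc)
    have "(\<lambda>n. ln (real n) / ln (real (Suc n))) \<longlonglongrightarrow> 1" by real_asymp
    then have "(\<lambda>n. b (Suc n) * (ln (real n) / ln (real (Suc n)))) \<longlonglongrightarrow> ?I * 1"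
      by (intro tendsto_mult LIMSEQ_Suc b)
    note b1 = this
    have b': "(\<lambda>n. b (Suc n) * (ln (real n) / ln (real (Suc n))) * (1 + lm * eps j) - lm * eps j * c n) \<longlonglongrightarrow>
       ?I * 1 * (1 + lm * eps j) - lm * eps j * ?I"
      by (intro tendsto_diff c b1 tendsto_mult tendsto_const)
    show ?case
    proof (rule tendsto_sandwich[OF _ _ _ c])
      show "(\<lambda>n. b (Suc n) * (ln (real n) / ln (real (Suc n))) * (1 + lm * eps j) - lm * eps j * c n) \<longlonglongrightarrow> ?I"
        using b' by (simp add: algebra_simps)
      show "\<forall>\<^sub>F n in sequentially. eps (Suc j) * (transfer ^^ n) f (eps (Suc j)) * ln (real n) \<le> c n"
        using mono[of "eps (Suc j)" 1] eps_bounds[of "Suc j"] lnn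
        by (intro always_eventually allI) (auto simp: c_def intro!: mult_right_mono)
      show "\<forall>\<^sub>F n in sequentially. b (Suc n) * (ln (real n) / ln (real (Suc n))) * (1 + lm * eps j) - lm * eps j * c n
         \<le> eps (Suc j) * (transfer ^^ n) f (eps (Suc j)) * ln (real n)"
        using eventually_ge_at_top[of 1]
      proof eventually_elim
        case (elim n)
        have "eps j * (transfer ^^ Suc n) f (eps j) * (1 + lm * eps j) \<le> 
           eps (Suc j) * (transfer ^^ n) f (eps (Suc j)) + (transfer ^^ n) f 1 * lm * eps j"
          using parabolic_invariance[of "eps j" "(transfer ^^ n) f" "(transfer ^^ n) f 1"] eps_bounds[of j] mono[of _ 1 n] e1
          unfolding eps_Suc by (simp add: less_imp_le order_less_le_trans[OF e1(1)])
        from mult_right_mono[OF this lnn[of n]]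
        have "eps j * (transfer ^^ Suc n) f (eps j) * ln (real n) * (1 + lm * eps j) - lm * eps j * c n \<le> 
           eps (Suc j) * (transfer ^^ n) f (eps (Suc j)) * ln (real n)"
          by (simp add: c_def algebra_simps)
        moreover have "b (Suc n) * (ln (real n) / ln (real (Suc n))) = eps j * (transfer ^^ Suc n) f (eps j) * ln (real n)"
          using elim by (simp add: b_def)
        ultimately show ?case by simp
      qed
    qed
  qed
  have "eps \<longlonglongrightarrow> 0" unfolding eps_def[abs_def] using lm_ge_1 by real_asymp
  then obtain j where j: "eps j < y"
    using order_tendstoD(2)[of eps 0 sequentially y] assms(2) eventually_happens by force
  show ?thesis
  proof (rule tendsto_sandwich[OF _ _ at_eps[of j] admissible_asymptotics_1[OF assms(1)]])
    show "\<forall>\<^sub>F n in sequentially. eps j * (transfer ^^ n) f (eps j) * ln (real n) \<le> y * (transfer ^^ n) f y * ln (real n)"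
      using mono[of "eps j" y] eps_bounds[of j] j assms lnn
      by (intro always_eventually allI mult_right_mono) auto
    show "\<forall>\<^sub>F n in sequentially. y * (transfer ^^ n) f y * ln (real n) \<le> (transfer ^^ n) f 1 * ln (real n)"
      using mono[of y 1] assms lnn
      by (intro always_eventually allI mult_right_mono) auto
  qed
qed

subsection \<open>Density of the admissible functions\<close>

lemma transfer_linear: "transfer (\<lambda>x. f x + c * g x) = (\<lambda>x. transfer f x + c * transfer g x)"
  by (rule ext) (simp add: transfer_def sum_distrib_left sum.distrib[symmetric] algebra_simps add_divide_distrib)

lemma transfer_pow_linear: "(transfer ^^ n) (\<lambda>x. f x + c * g x) = (\<lambda>x. (transfer ^^ n) f x + c * (transfer ^^ n) g x)"
  by (induction n) (simp_all add: transfer_linear)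

lemma transfer_pow_nonneg:
  assumes "\<And>x. x \<in> {0..1} \<Longrightarrow> 0 \<le> f x" "x \<in> {0..1}"
  shows "0 \<le> (transfer ^^ n) f x"
  using assms(2)
proof (induction n arbitrary: x)
  case (Suc n)
  then show ?case using transfer_nonneg[of "(transfer ^^ n) f" x] by simp
qed (use assms(1) in simp)

lemma transfer_pow_abs_le:
  assumes "\<And>x. x \<in> {0..1} \<Longrightarrow> \<bar>f x - g x\<bar> \<le> e * k x" "x \<in> {0..1}"
  shows "\<bar>(transfer ^^ n) f x - (transfer ^^ n) g x\<bar> \<le> e * (transfer ^^ n) k x"
proof -
  \<comment> \<open>Positivity of the operator. The coefficients \<open>1\<close> and
    \<open>- 1\<close> are written out to match the pattern of
    \<open>transfer_pow_linear\<close>.\<close>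
  have "0 \<le> (transfer ^^ n) (\<lambda>x. (e * k x + - 1 * f x) + 1 * g x) x"
    "0 \<le> (transfer ^^ n) (\<lambda>x. (e * k x + 1 * f x) + - 1 * g x) x"
    using assms by (intro transfer_pow_nonneg; force simp: abs_le_iff)+
  moreover have "(transfer ^^ n) (\<lambda>x. e * k x) x = e * (transfer ^^ n) k x"
  proof -
    have "(transfer ^^ n) (\<lambda>x. 0 + e * k x) x = (transfer ^^ n) (\<lambda>x. 0) x + e * (transfer ^^ n) k x"
      by (simp only: transfer_pow_linear)
    moreover have "(transfer ^^ n) (\<lambda>x. 0) = (\<lambda>x. 0)" by (induction n) (simp_all add: transfer_def[abs_def])
    ultimately show ?thesis by simp
  qed
  ultimately show ?thesis unfolding transfer_pow_linear by (simp add: abs_le_iff)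
qed

text \<open>Chosen so that \<open>x * f x\<close> becomes the polynomial
  \<open>(1 - z) * P z\<close> in the symmetric coordinate. The zero at \<open>z = 1\<close> is
  unavoidable, since \<open>x * f x\<close> vanishes at \<open>x = 0\<close>.\<close>

definition poly_density :: "real poly \<Rightarrow> real \<Rightarrow> real" where
  "poly_density P x = (1 + cayley x) * poly P (cayley x)"

lemma cayley_range: "x \<in> {0..1} \<Longrightarrow> cayley x \<in> {0..1}"
  by (auto simp: cayley_def)

lemma cayley_antimono: "0 \<le> x \<Longrightarrow> x \<le> y \<Longrightarrow> y \<le> 1 \<Longrightarrow> cayley y \<le> cayley x"
  unfolding cayley_def by (intro frac_le) auto

lemma continuous_on_cayley: "continuous_on {0..1} cayley"
  unfolding cayley_def[abs_def] by (intro continuous_intros) auto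

lemma continuous_on_poly_density: "continuous_on {0..1} (poly_density P)"
  unfolding poly_density_def[abs_def] by (intro continuous_intros continuous_on_cayley)

lemma poly_density_cayley: "0 \<le> z \<Longrightarrow> cayley z * poly_density P (cayley z) = poly ([:1, -1:] * P) z"
proof -
  assume z: "0 \<le> z"
  then have "cayley z * (1 + z) = 1 - z" by (simp add: cayley_def)
  moreover have "cayley z * poly_density P (cayley z) = cayley z * (1 + z) * poly P z"
    using z by (simp add: poly_density_def cayley_cayley)
  moreover have "poly ([:1, -1:] * P) z = (1 - z) * poly P z" by (simp add: algebra_simps)
  ultimately show ?thesis by (simp only:)
qed

lemma admissible_poly_density:
  fixes P :: "real poly"
  defines "R \<equiv> [:1, -1:] * P"
  assumes "\<And>z. z \<in> {0..1} \<Longrightarrow> 0 \<le> poly P z \<and> poly (pderiv R) z \<le> 0 \<and> poly (pderiv (pderiv R)) z \<le> 0"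
  shows "admissible (poly_density P)"
  unfolding admissible_def
proof (intro conjI ballI allI impI continuous_on_poly_density)
  show "0 \<le> poly_density P x" if "x \<in> {0..1}" for x
    using assms(2)[OF cayley_range[OF that]] cayley_range[OF that] by (simp add: poly_density_def)
  have "dec_concave (poly R)"
    unfolding dec_concave_def using assms(2) by (intro exI[of _ "poly (pderiv R)"] exI[of _ "poly (pderiv (pderiv R))"]) auto
  then show "dec_concave (\<lambda>z. cayley z * poly_density P (cayley z))"
    by (rule dec_concave_cong) (simp add: poly_density_cayley R_def)
  fix x y :: real assume xy: "0 < x" "x \<le> y" "y \<le> 1"
  have "poly R (cayley x) \<le> poly R (cayley y)"
  proof (rule DERIV_nonpos_imp_nonincreasing[of "cayley y" "cayley x" "poly R"])
    fix t assume "cayley y \<le> t" "t \<le> cayley x"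
    then have "t \<in> {0..1}" using cayley_range[of x] cayley_range[of y] xy by auto
    then show "\<exists>d. (poly R has_real_derivative d) (at t) \<and> d \<le> 0"
      using assms(2) poly_DERIV by blast
  qed (use cayley_antimono xy in auto)
  then show "x * poly_density P x \<le> y * poly_density P y"
    using poly_density_cayley[of "cayley x" P] poly_density_cayley[of "cayley y" P] cayley_range[of x] cayley_range[of y] xy
    by (simp add: cayley_cayley R_def)
qed

lemma poly_bounded_unit: "\<exists>M. \<forall>z\<in>{0..1}. \<bar>poly (p :: real poly) z\<bar> \<le> M"
proof -
  have "bounded (poly p ` {0..1})"
    by (intro compact_imp_bounded compact_continuous_image continuous_intros) auto
  then show ?thesis by (auto simp: bounded_iff)
qed

lemma poly_density_add: "poly_density (P + smult C Q) = (\<lambda>x. poly_density P x + C * poly_density Q x)"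
  by (rule ext) (simp add: poly_density_def algebra_simps)

text \<open>Here \<open>x * f x\<close> is \<open>(1 - z) * (3 + z) = 3 - 2 * z - z\<^sup>2\<close>,
  with first derivative at most \<open>-2\<close> on the unit interval and second derivative
  \<open>-2\<close>. Adding a large multiple of it therefore makes any \<open>poly_density P\<close>
  admissible.\<close>

lemma admissible_base: "admissible (poly_density [:3, 1:])"
  by (rule admissible_poly_density) (auto simp: pderiv_pCons)

lemma base_ge: "x \<in> {0..1} \<Longrightarrow> 1 \<le> poly_density [:3, 1:] x"
proof -
  assume "x \<in> {0..1}"
  then have "1 * 1 \<le> (1 + cayley x) * (3 + cayley x)" using cayley_range[of x] by (intro mult_mono) auto
  then show ?thesis by (simp add: poly_density_def)
qed

lemma poly_density_asymptotics:
  assumes y: "0 < y" "y \<le> 1"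
  shows "(\<lambda>n. y * (transfer ^^ n) (poly_density P) y * ln (real n)) \<longlonglongrightarrow> integral {0..1} (poly_density P)"
proof -
  let ?B = "poly_density [:3, 1:]"
  define R where "R = [:1, -1:] * P"
  obtain M0 M1 M2 where M: "\<And>z. z \<in> {0..1} \<Longrightarrow> \<bar>poly P z\<bar> \<le> M0"
    "\<And>z. z \<in> {0..1} \<Longrightarrow> \<bar>poly (pderiv R) z\<bar> \<le> M1" "\<And>z. z \<in> {0..1} \<Longrightarrow> \<bar>poly (pderiv (pderiv R)) z\<bar> \<le> M2"
    using poly_bounded_unit by metis
  define C where "C = max M0 (max M1 M2)"
  have C: "\<bar>poly P z\<bar> \<le> C" "\<bar>poly (pderiv R) z\<bar> \<le> C" "\<bar>poly (pderiv (pderiv R)) z\<bar> \<le> C" "0 \<le> C" if "z \<in> {0..1}" for z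
    using M[OF that] unfolding C_def by linarith+
  have admissible: "admissible (poly_density (P + smult C [:3, 1:]))"
  proof (rule admissible_poly_density)
    fix z :: real assume z: "z \<in> {0..1}"
    have R': "[:1, -1:] * (P + smult C [:3, 1:]) = R + smult C [:3, -2, -1:]"
      by (simp add: R_def algebra_simps)
    have "0 \<le> C * z" using C(4)[OF z] z by simp
    then show "0 \<le> poly (P + smult C [:3, 1:]) z \<and> poly (pderiv ([:1, -1:] * (P + smult C [:3, 1:]))) z \<le> 0 
      \<and> poly (pderiv (pderiv ([:1, -1:] * (P + smult C [:3, 1:])))) z \<le> 0"
    proof -
      have "poly (P + smult C [:3, 1:]) z = poly P z + (3 * C + C * z)"
        "poly (pderiv (R + smult C [:3, -2, -1:])) z = poly (pderiv R) z - 2 * C - 2 * (C * z)"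
        "poly (pderiv (pderiv (R + smult C [:3, -2, -1:]))) z = poly (pderiv (pderiv R)) z - 2 * C"
        by (simp_all add: pderiv_add pderiv_smult pderiv_pCons algebra_simps)
      then show ?thesis unfolding R' using C[OF z] \<open>0 \<le> C * z\<close> by linarith
    qed
  qed
  have "(\<lambda>n. y * (transfer ^^ n) (poly_density (P + smult C [:3, 1:])) y * ln (real n) - C * (y * (transfer ^^ n) ?B y * ln (real n)))
     \<longlonglongrightarrow> integral {0..1} (poly_density (P + smult C [:3, 1:])) - C * integral {0..1} ?B"
    by (rule tendsto_diff[OF admissible_asymptotics[OF admissible y]
          tendsto_mult[OF tendsto_const admissible_asymptotics[OF admissible_base y]]])
  moreover have "integral {0..1} (poly_density (P + smult C [:3, 1:])) = 
     integral {0..1} (poly_density P) + C * integral {0..1} ?B"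
    unfolding poly_density_add
    by (subst integral_add) (auto intro!: integrable_continuous_interval continuous_intros continuous_on_poly_density)
  ultimately show ?thesis
    unfolding poly_density_add transfer_pow_linear by (simp add: algebra_simps)
qed

lemma poly_density_dense:
  assumes f: "continuous_on {0..1} f" and e: "0 < e"
  shows "\<exists>P. \<forall>x\<in>{0..1}. \<bar>f x - poly_density P x\<bar> \<le> e"
proof -
  \<comment> \<open>The approximation is done for \<open>f (cayley z) / (1 + z)\<close>; multiplying
    back by \<open>1 + cayley x\<close>, at most 2, explains the tolerance
    \<open>e / 2\<close>.\<close>
  have "continuous_on {0..1} (\<lambda>z. f (cayley z) / (1 + z))"
    by (intro continuous_on_divide continuous_on_compose2[OF f continuous_on_cayley] continuous_intros)
      (use cayley_range in auto)
  then obtain g where g: "real_polynomial_function g" "\<And>z. z \<in> {0..1} \<Longrightarrow> \<bar>f (cayley z) / (1 + z) - g z\<bar> < e / 2"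
    by (rule Stone_Weierstrass_real_polynomial_function[OF compact_Icc, where e = "e / 2"]) (use e in auto)
  then obtain a n where "g = (\<lambda>x. \<Sum>i\<le>n. a i * x ^ i)" by (auto simp: real_polynomial_function_iff_sum)
  then have gp: "g = poly (\<Sum>i\<le>n. monom (a i) i)" by (auto simp: poly_sum poly_monom)
  have "\<bar>f x - poly_density (\<Sum>i\<le>n. monom (a i) i) x\<bar> \<le> e" if x: "x \<in> {0..1}" for x
  proof -
    have cayley: "0 \<le> cayley x" "cayley x \<le> 1" using cayley_range[OF x] by auto
    have "f x - poly_density (\<Sum>i\<le>n. monom (a i) i) x = (1 + cayley x) * (f (cayley (cayley x)) / (1 + cayley x) - g (cayley x))"
      using cayley x by (simp add: poly_density_def gp cayley_cayley field_simps)
    also have "\<bar>\<dots>\<bar> \<le> 2 * (e / 2)"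
      unfolding abs_mult using cayley g(2) by (intro mult_mono) (auto simp: less_imp_le)
    finally show ?thesis by simp
  qed
  then show ?thesis by blast
qed

text \<open>A uniform error must survive multiplication by \<open>ln n\<close>. It does because it
  is dominated by a small multiple of the base density, which is at least 1 and whose own
  asymptotics are known.\<close>

lemma transfer_pow_asymptotics:
  assumes f: "continuous_on {0..1} f" and y: "0 < y" "y \<le> 1"
  shows "(\<lambda>n. y * (transfer ^^ n) f y * ln (real n)) \<longlonglongrightarrow> integral {0..1} f"
proof (rule LIMSEQ_I)
  let ?B = "poly_density [:3, 1:]" and ?I = "integral {0..1} :: (real \<Rightarrow> real) \<Rightarrow> real"
  let ?S = "\<lambda>f n. y * (transfer ^^ n) f y * ln (real n)"
  fix r :: real assume r: "0 < r"
  define K where "K = \<bar>?I ?B\<bar> + 1"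
  have K: "1 \<le> K" by (simp add: K_def)
  define e where "e = r / (4 * K)"
  have e: "0 < e" using r K by (simp add: e_def)
  obtain P where P: "\<And>x. x \<in> {0..1} \<Longrightarrow> \<bar>f x - poly_density P x\<bar> \<le> e"
    using poly_density_dense[OF f e] by blast
  have "\<bar>?I f - ?I (poly_density P)\<bar> \<le> e"
  proof -
    have int: "f integrable_on {0..1}" "poly_density P integrable_on {0..1}"
      using f continuous_on_poly_density by (auto intro: integrable_continuous_interval)
    have "norm (?I (\<lambda>x. f x - poly_density P x)) \<le> e * (1 - 0)"
      by (rule integral_bound) (auto intro!: continuous_intros f continuous_on_poly_density P)
    then show ?thesis using int by (simp add: integral_diff)
  qed
  moreover have "\<bar>?S f n - ?S (poly_density P) n\<bar> \<le> e * ?S ?B n" for n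
  proof -
    have "\<bar>f x - poly_density P x\<bar> \<le> e * ?B x" if "x \<in> {0..1}" for x
      using P[OF that] mult_left_mono[OF base_ge[OF that], of e] e by linarith
    then have "\<bar>(transfer ^^ n) f y - (transfer ^^ n) (poly_density P) y\<bar> \<le> e * (transfer ^^ n) ?B y"
      using y by (intro transfer_pow_abs_le) auto
    moreover define c where "c = y * ln (real n)"
    moreover have c: "0 \<le> c" using y by (cases "n = 0") (auto simp: c_def)
    ultimately have "\<bar>(transfer ^^ n) f y - (transfer ^^ n) (poly_density P) y\<bar> * c \<le> e * (transfer ^^ n) ?B y * c"
      by (intro mult_right_mono)
    moreover have "?S g n = (transfer ^^ n) g y * c" for g by (simp add: c_def)
    moreover have "\<bar>A * c - B * c\<bar> = \<bar>A - B\<bar> * c" for A B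
      using c by (simp add: abs_mult left_diff_distrib[symmetric])
    ultimately show ?thesis by (simp only: mult.assoc)
  qed
  moreover have "\<forall>\<^sub>F n in sequentially. ?S ?B n < K \<and> \<bar>?S (poly_density P) n - ?I (poly_density P)\<bar> < r / 4"
  proof (rule eventually_conj)
    show "\<forall>\<^sub>F n in sequentially. ?S ?B n < K"
      by (rule order_tendstoD(2)[OF poly_density_asymptotics[OF y]]) (simp add: K_def)
    show "\<forall>\<^sub>F n in sequentially. \<bar>?S (poly_density P) n - ?I (poly_density P)\<bar> < r / 4"
      using tendstoD[OF poly_density_asymptotics[OF y, of P], of "r / 4"] r by (simp add: dist_real_def)
  qed
  moreover have "e \<le> r / 4" "e * K = r / 4" using K r by (auto simp: e_def field_simps)
  ultimately have "\<forall>\<^sub>F n in sequentially. norm (?S f n - ?I f) < r"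
  proof -
    assume a: "\<bar>?I f - ?I (poly_density P)\<bar> \<le> e" "\<And>n. \<bar>?S f n - ?S (poly_density P) n\<bar> \<le> e * ?S ?B n"
      "\<forall>\<^sub>F n in sequentially. ?S ?B n < K \<and> \<bar>?S (poly_density P) n - ?I (poly_density P)\<bar> < r / 4"
      "e \<le> r / 4" "e * K = r / 4"
    from a(3) show ?thesis
    proof eventually_elim
      case (elim n)
      have "e * ?S ?B n \<le> e * K" using elim e by (intro mult_left_mono) auto
      then show ?case using a(1) a(2)[of n] a(4,5) elim r unfolding real_norm_def by linarith
    qed
  qed
  then show "\<exists>no. \<forall>n\<ge>no. norm (?S f n - ?I f) < r" by (simp add: eventually_sequentially)
qed

end

subsection \<open>Uniqueness of reduced fractions\<close>

lemma mmul_assoc: "mmul (mmul A B) C = mmul A (mmul B C)"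
  by (cases A; cases B; cases C) (simp add: algebra_simps)

lemma hecke_mmul: "N \<in> hecke_SL q \<Longrightarrow> M \<in> hecke_SL q \<Longrightarrow> mmul M N \<in> hecke_SL q"
proof (induction N rule: hecke_SL.induct)
  case one
  then show ?case by (cases M rule: prod_cases4) simp
qed (auto simp: mmul_assoc[symmetric] intro: hecke_SL.intros)

lemma hecke_T: "Tm q \<in> hecke_SL q" and hecke_Tinv: "Tinv q \<in> hecke_SL q" and hecke_S: "Sm \<in> hecke_SL q"
  using hecke_SL.mulT[OF hecke_SL.one] hecke_SL.mulTinv[OF hecke_SL.one] hecke_SL.mulS[OF hecke_SL.one]
  by (simp_all add: Tm_def Tinv_def Sm_def)

lemma hecke_uminus: "(a, b, c, d) \<in> hecke_SL q \<Longrightarrow> (- a, - b, - c, - d) \<in> hecke_SL q"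
  using hecke_SL.mulS[OF hecke_SL.mulS] by (fastforce simp: Sm_def)

lemma hecke_det: "(a, b, c, d) \<in> hecke_SL q \<Longrightarrow> a * d - b * c = 1"
proof -
  have "mdet M = 1" if "M \<in> hecke_SL q" for M
    using that
  proof (induction rule: hecke_SL.induct)
    case (mulT M)
    then show ?case by (cases M rule: prod_cases4) (simp add: Tm_def algebra_simps)
  next
    case (mulTinv M)
    then show ?case by (cases M rule: prod_cases4) (simp add: Tinv_def algebra_simps)
  next
    case (mulS M)
    then show ?case by (cases M rule: prod_cases4) (simp add: Sm_def algebra_simps)
  qed simp
  from this[of "(a, b, c, d)"] show "(a, b, c, d) \<in> hecke_SL q \<Longrightarrow> a * d - b * c = 1" by simp
qed

lemma hecke_madj: "M \<in> hecke_SL q \<Longrightarrow> madj M \<in> hecke_SL q"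
proof (induction rule: hecke_SL.induct)
  case one
  show ?case using hecke_SL.one by simp
next
  case (mulT M)
  moreover have "madj (mmul M (Tm q)) = mmul (Tinv q) (madj M)"
    by (cases M rule: prod_cases4) (simp add: Tm_def Tinv_def algebra_simps)
  ultimately show ?case using hecke_mmul hecke_Tinv by metis
next
  case (mulTinv M)
  moreover have "madj (mmul M (Tinv q)) = mmul (Tm q) (madj M)"
    by (cases M rule: prod_cases4) (simp add: Tm_def Tinv_def algebra_simps)
  ultimately show ?case using hecke_mmul hecke_T by metis
next
  case (mulS M)
  obtain a b c d where M: "madj M = (a, b, c, d)" by (cases "madj M")
  have "mmul Sm (madj M) \<in> hecke_SL q" by (rule hecke_mmul[OF mulS.IH hecke_S])
  then have "(c, d, - a, - b) \<in> hecke_SL q" by (simp add: M Sm_def)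
  from hecke_uminus[OF this] show ?case
    using M by (cases M rule: prod_cases4) (auto simp: Sm_def)
qed

text \<open>Conjugation by \<open>diag(1, -1)\<close> maps \<open>T\<close> to its inverse and
  \<open>S\<close> to \<open>- S\<close>.\<close>

lemma hecke_conj: "(a, b, c, d) \<in> hecke_SL q \<Longrightarrow> (a, - b, - c, d) \<in> hecke_SL q"
proof -
  define J :: "mat2 \<Rightarrow> mat2" where "J = (\<lambda>(a, b, c, d). (a, - b, - c, d))"
  have "J M \<in> hecke_SL q" if "M \<in> hecke_SL q" for M
    using that
  proof (induction rule: hecke_SL.induct)
    case one
    show ?case using hecke_SL.one by (simp add: J_def)
  next
    case (mulT M)
    moreover have "J (mmul M (Tm q)) = mmul (J M) (Tinv q)"
      by (cases M rule: prod_cases4) (simp add: J_def Tm_def Tinv_def)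
    ultimately show ?case using hecke_SL.mulTinv by metis
  next
    case (mulTinv M)
    moreover have "J (mmul M (Tinv q)) = mmul (J M) (Tm q)"
      by (cases M rule: prod_cases4) (simp add: J_def Tm_def Tinv_def)
    ultimately show ?case using hecke_SL.mulT by metis
  next
    case (mulS M)
    obtain a b c d where M: "M = (a, b, c, d)" by (cases M rule: prod_cases4)
    from hecke_uminus[of "b" "a" "- d" "- c"] hecke_SL.mulS[OF mulS.IH] show ?case
      by (simp add: M J_def Sm_def)
  qed
  from this[of "(a, b, c, d)"] show "(a, b, c, d) \<in> hecke_SL q \<Longrightarrow> (a, - b, - c, d) \<in> hecke_SL q"
    by (simp add: J_def)
qed

section \<open>Integrality of the matrix entries\<close>

lemma ZlamI: "x = (\<Sum>i<n. of_int (c i) * lam q ^ i) \<Longrightarrow> x \<in> Zlam q"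
  unfolding Zlam_def by blast

lemma Zlam_0: "0 \<in> Zlam q" and Zlam_1: "1 \<in> Zlam q"
  by (simp_all add: ZlamI[where c = "\<lambda>_. 1" and n = 0] ZlamI[where c = "\<lambda>_. 1" and n = "Suc 0"])

lemma Zlam_add: assumes "x \<in> Zlam q" "y \<in> Zlam q" shows "x + y \<in> Zlam q"
proof -
  obtain m c n d where x: "x = (\<Sum>i<m. of_int (c i) * lam q ^ i)" and y: "y = (\<Sum>i<n. of_int (d i) * lam q ^ i)"
    using assms unfolding Zlam_def by blast
  have pad: "(\<Sum>i<k. of_int (e i) * lam q ^ i) = (\<Sum>i<m + n. of_int (if i < k then e i else 0) * lam q ^ i)"
    if "k \<le> m + n" for k and e :: "nat \<Rightarrow> int"
    using that by (intro sum.mono_neutral_cong_left) auto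
  have "x + y = (\<Sum>i<m + n. of_int ((if i < m then c i else 0) + (if i < n then d i else 0)) * lam q ^ i)"
    unfolding x y by (subst (1 2) pad) (simp_all only: of_int_add distrib_right sum.distrib le_add1 le_add2)
  then show ?thesis by (rule ZlamI)
qed

lemma Zlam_uminus: assumes "x \<in> Zlam q" shows "- x \<in> Zlam q"
proof -
  obtain m c where "x = (\<Sum>i<m. of_int (c i) * lam q ^ i)"
    using assms unfolding Zlam_def by blast
  then have "- x = (\<Sum>i<m. of_int (- c i) * lam q ^ i)" by (simp add: sum_negf)
  then show ?thesis by (rule ZlamI)
qed

lemma Zlam_diff: "x \<in> Zlam q \<Longrightarrow> y \<in> Zlam q \<Longrightarrow> x - y \<in> Zlam q"
  using Zlam_add[OF _ Zlam_uminus] by force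

lemma Zlam_lam: assumes "x \<in> Zlam q" shows "x * lam q \<in> Zlam q"
proof -
  obtain m c where "x = (\<Sum>i<m. of_int (c i) * lam q ^ i)"
    using assms unfolding Zlam_def by blast
  then have "x * lam q = (\<Sum>i<Suc m. of_int (case i of 0 \<Rightarrow> 0 | Suc j \<Rightarrow> c j) * lam q ^ i)"
    unfolding sum.lessThan_Suc_shift by (simp add: sum_distrib_left mult_ac)
  then show ?thesis by (rule ZlamI)
qed

lemma hecke_Zlam: "(a, b, c, d) \<in> hecke_SL q \<Longrightarrow> a \<in> Zlam q \<and> b \<in> Zlam q \<and> c \<in> Zlam q \<and> d \<in> Zlam q"
proof -
  define Z where "Z = Zlam q \<times> Zlam q \<times> Zlam q \<times> Zlam q"
  have "M \<in> Z" if "M \<in> hecke_SL q" for M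
    using that
  proof (induction rule: hecke_SL.induct)
    case (mulT M)
    then show ?case by (cases M rule: prod_cases4) (auto simp: Z_def Tm_def intro!: Zlam_add Zlam_lam)
  next
    case (mulTinv M)
    then show ?case by (cases M rule: prod_cases4) (auto simp: Z_def Tinv_def intro!: Zlam_diff Zlam_lam)
  next
    case (mulS M)
    then show ?case by (cases M rule: prod_cases4) (auto simp: Z_def Sm_def intro!: Zlam_uminus)
  qed (auto simp: Z_def Zlam_0 Zlam_1)
  from this[of "(a, b, c, d)"] show "(a, b, c, d) \<in> hecke_SL q \<Longrightarrow> ?thesis" by (simp add: Z_def)
qed

lemma reduced_fraction_iff: "reduced_fraction q a c \<longleftrightarrow> (\<exists>b d. (a, b, c, d) \<in> hecke_SL q)"
  unfolding reduced_fraction_def using hecke_Zlam by blast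

lemma reduced_fraction_uminus: "reduced_fraction q a c \<Longrightarrow> reduced_fraction q (- a) (- c)"
  unfolding reduced_fraction_iff using hecke_uminus by blast

text \<open>\<open>Q\<close> has determinant \<open>-1\<close> and lies outside the group. Its
  effect on a first column is obtained from \<open>S\<close> followed by conjugation with
  \<open>diag(1, -1)\<close>, so the branches involving \<open>Q\<close> also respect reduced
  fractions.\<close>

lemma reduced_fraction_swap: assumes "reduced_fraction q a c" shows "reduced_fraction q c a"
proof -
  obtain b d where "(a, b, c, d) \<in> hecke_SL q" using assms unfolding reduced_fraction_iff by blast
  from hecke_mmul[OF this hecke_S] have "(c, d, - a, - b) \<in> hecke_SL q" by (simp add: Sm_def)
  from hecke_conj[OF this] show ?thesis unfolding reduced_fraction_iff by auto
qed

lemma reduced_fraction_mmul: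
  assumes "reduced_fraction q a c" "(k, l, m, n) \<in> hecke_SL q"
  shows "reduced_fraction q (k * a + l * c) (m * a + n * c)"
proof -
  obtain b d where "(a, b, c, d) \<in> hecke_SL q" using assms unfolding reduced_fraction_iff by blast
  from hecke_mmul[OF this assms(2)] show ?thesis unfolding reduced_fraction_iff by auto
qed

context hecke_odd begin

lemma lam_q: "lam (Suc (2 * h)) = lm" "lam (Suc (h * 2)) = lm"
  by (simp_all add: lm_def mult.commute)

lemma s_2: "s (Suc (Suc 0)) = lm" by (simp add: s_rec)

text \<open>Left multiplication by \<open>T S\<close> sends the matrix of index \<open>j\<close> to
  minus that of index \<open>j + 1\<close>.\<close>

lemma branch_hecke: "(s (Suc j), s (Suc (Suc j)), s j, s (Suc j)) \<in> hecke_SL q"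
proof (induction j)
  case 0
  show ?case using hecke_T[of q] by (simp add: Tm_def lam_q s_2)
next
  case (Suc j)
  have "mmul (mmul (Tm q) Sm) (s (Suc j), s (Suc (Suc j)), s j, s (Suc j)) \<in> hecke_SL q"
    by (intro hecke_mmul Suc hecke_T hecke_S)
  then have "(- s (Suc (Suc j)), - s (Suc (Suc (Suc j))), - s (Suc j), - s (Suc (Suc j))) \<in> hecke_SL q"
    by (simp add: Tm_def Sm_def lam_q s_rec[of "Suc j"] s_rec[of j] algebra_simps)
  from hecke_uminus[OF this] show ?case by simp
qed

text \<open>The vectors in the closed first quadrant obtained from \<open>(1, 0)\<close> and \<open>(0, 1)\<close> by the matrices
  \<open>g\<^sub>k\<close> inverse with \<open>1 \<le> k \<le> q - 1\<close>. Up to \<open>S\<close> and signs they are stable under \<open>T\<close>, so an element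
  of the group that fixes infinity has diagonal entries 1 or -1.\<close>

inductive cone :: "real \<Rightarrow> real \<Rightarrow> bool" where
  e1: "cone 1 0"
| e2: "cone 0 1"
| step: "j < 2 * h \<Longrightarrow> cone a c \<Longrightarrow> cone (s (Suc j) * a + s (Suc (Suc j)) * c) (s j * a + s (Suc j) * c)"

definition orbit :: "real \<Rightarrow> real \<Rightarrow> bool" where
  "orbit a c \<longleftrightarrow> cone a c \<or> cone (- a) (- c) \<or> cone c (- a) \<or> cone (- c) a"

lemma cone_nonneg: "cone a c \<Longrightarrow> 0 \<le> a \<and> 0 \<le> c"
  by (induction rule: cone.induct) (auto intro!: add_nonneg_nonneg mult_nonneg_nonneg s_nonneg)

text \<open>All entries are nonnegative, so a step reaches the horizontal axis only with
  \<open>j = 0\<close> and the vertical axis only with \<open>Suc j = 2 * h\<close>, starting from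
  the axis itself; in both cases the entry that acts is 1.\<close>

lemma cone_axis: "cone a c \<Longrightarrow> (c = 0 \<longrightarrow> a = 1) \<and> (a = 0 \<longrightarrow> c = 1)"
proof (induction rule: cone.induct)
  case (step j a c)
  have nn: "0 \<le> a" "0 \<le> c" using cone_nonneg[OF step(2)] by auto
  have ss: "0 < s (Suc j)" "0 \<le> s j" "0 \<le> s (Suc (Suc j))"
    using s_pos[of "Suc j"] s_nonneg[of j] s_nonneg[of "Suc (Suc j)"] step(1) by auto
  show ?case
  proof (intro conjI impI)
    assume "s j * a + s (Suc j) * c = 0"
    then have z: "s j * a = 0" "s (Suc j) * c = 0" 
      using nn ss by (simp_all add: add_nonneg_eq_0_iff mult_nonneg_nonneg)
    then have "c = 0" "a = 1" using ss step(3) by auto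
    moreover have "j = 0" using z \<open>a = 1\<close> s_pos[of j] step(1) by (cases "j = 0") auto
    ultimately show "s (Suc j) * a + s (Suc (Suc j)) * c = 1" by simp
  next
    assume "s (Suc j) * a + s (Suc (Suc j)) * c = 0"
    then have z: "s (Suc j) * a = 0" "s (Suc (Suc j)) * c = 0" 
      using nn ss by (simp_all add: add_nonneg_eq_0_iff mult_nonneg_nonneg)
    then have "a = 0" "c = 1" using ss step(3) by auto
    moreover have "Suc j = 2 * h" using z \<open>c = 1\<close> s_pos[of "Suc (Suc j)"] step(1) by (cases "Suc j = 2 * h") auto
    ultimately show "s j * a + s (Suc j) * c = 1" using s_2h by simp
  qed
qed auto

lemma orbit_uminus: "orbit a c \<Longrightarrow> orbit (- a) (- c)"
  by (auto simp: orbit_def)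

lemma orbit_S: "orbit a c \<Longrightarrow> orbit c (- a)"
  by (auto simp: orbit_def)

lemma cone_T: "cone a c \<Longrightarrow> cone (a + lm * c) c"
  using cone.step[of 0 a c] h_pos by (simp add: s_2)

lemma cone_T': "cone x y \<Longrightarrow> cone x (y + lm * x)"
  using cone.step[of "2 * h - 1" x y] h_pos s_2h s_2h1 by (simp add: add.commute)

text \<open>The map is \<open>T\<close> times the inverse of \<open>S\<close>. It carries the image
  of step \<open>j\<close> to that of step \<open>j + 1\<close>; past the last step,
  \<open>s (Suc (Suc (2 * h))) = -1\<close> returns the vector to the cone up to a power of
  \<open>S\<close>.\<close>

lemma cone_TS: assumes "cone x y" shows "orbit (lm * x - y) x"
  using assms
proof cases
  case e1
  then show ?thesis using cone_T[OF cone.e2] by (simp add: orbit_def)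
next
  case e2
  then show ?thesis using cone.e1 by (simp add: orbit_def)
next
  case (step j a c)
  have "lm * x - y = s (Suc (Suc j)) * a + s (Suc (Suc (Suc j))) * c"
    by (simp add: step s_rec[of "Suc j"] s_rec[of j] algebra_simps)
  moreover have "Suc j = 2 * h \<or> Suc j < 2 * h" using step by auto
  moreover have "s (Suc (Suc (2 * h))) = -1" using s_rec[of "2 * h"] s_2h by simp
  ultimately show ?thesis using step s_2h cone.step[of "Suc j" a c] by (auto simp: orbit_def)
qed

lemma cone_T'S: assumes "cone x y" shows "orbit (x - lm * y) y"
  using assms
proof cases
  case e1
  then show ?thesis using cone.e1 by (simp add: orbit_def)
next
  case e2
  then show ?thesis using cone_T'[OF cone.e1] by (simp add: orbit_def)
next
  case (step j a c)
  show ?thesis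
  proof (cases j)
    case 0
    then show ?thesis using step by (simp add: orbit_def s_2)
  next
    case (Suc i)
    then have "lm * y - x = s i * a + s (Suc i) * c" "y = s (Suc i) * a + s (Suc (Suc i)) * c"
      by (simp_all add: step s_rec[of "Suc i"] s_rec[of i] algebra_simps)
    then have "cone y (lm * y - x)" using cone.step[of i a c] step Suc by simp
    then show ?thesis by (simp add: orbit_def)
  qed
qed

lemma orbit_T: assumes "orbit a c" shows "orbit (a + lm * c) c"
  using assms unfolding orbit_def[of a c]
proof (elim disjE)
  assume "cone a c"
  from cone_T[OF this] show ?thesis by (simp add: orbit_def)
next
  assume "cone (- a) (- c)"
  from cone_T[OF this] show ?thesis by (simp add: orbit_def)
next
  assume "cone c (- a)"
  from cone_TS[OF this] show ?thesis by (simp add: add.commute)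
next
  assume "cone (- c) a"
  from orbit_uminus[OF cone_TS[OF this]] show ?thesis by (simp add: add.commute)
qed

lemma orbit_Tinv: assumes "orbit a c" shows "orbit (a - lm * c) c"
  using assms unfolding orbit_def[of a c]
proof (elim disjE)
  assume "cone a c"
  from cone_T'S[OF this] show ?thesis .
next
  assume "cone (- a) (- c)"
  from orbit_uminus[OF cone_T'S[OF this]] show ?thesis by simp
next
  assume "cone c (- a)"
  from cone_T'[OF this] show ?thesis by (simp add: orbit_def)
next
  assume "cone (- c) a"
  from cone_T'[OF this] show ?thesis by (simp add: orbit_def)
qed

lemma hecke_orbit:
  assumes "M \<in> hecke_SL q" "M = (k, l, m, n)" "orbit a c"
  shows "orbit (k * a + l * c) (m * a + n * c)"
  using assms
proof (induction arbitrary: k l m n a c rule: hecke_SL.induct)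
  case (mulT M)
  obtain k' l' m' n' where M: "M = (k', l', m', n')" by (cases M)
  from mulT.IH[OF M orbit_T[OF mulT.prems(2)]] mulT.prems(1) show ?case
    by (auto simp: M Tm_def lam_q algebra_simps)
next
  case (mulTinv M)
  obtain k' l' m' n' where M: "M = (k', l', m', n')" by (cases M)
  from mulTinv.IH[OF M orbit_Tinv[OF mulTinv.prems(2)]] mulTinv.prems(1) show ?case
    by (auto simp: M Tinv_def lam_q algebra_simps)
next
  case (mulS M)
  obtain k' l' m' n' where M: "M = (k', l', m', n')" by (cases M)
  from mulS.IH[OF M orbit_S[OF mulS.prems(2)]] mulS.prems(1) show ?case
    by (auto simp: M Sm_def algebra_simps)
qed auto

lemma hecke_parabolic: assumes "(t, b, 0, d) \<in> hecke_SL q" shows "t = 1 \<or> t = -1"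
proof -
  have "orbit 1 0" using cone.e1 by (simp add: orbit_def)
  from hecke_orbit[OF assms refl this] have "orbit t 0" by simp
  then show ?thesis using cone_axis unfolding orbit_def by fastforce
qed

text \<open>When the first columns are proportional, the quotient of the two matrices is upper
  triangular. Its corner entry \<open>t\<close> is the factor of proportionality, and
  \<open>hecke_parabolic\<close> leaves only 1 and -1.\<close>

lemma reduced_fraction_unique:
  assumes "reduced_fraction q a c" "reduced_fraction q a' c'" "a * c' = a' * c"
  shows "(a' = a \<and> c' = c) \<or> (a' = - a \<and> c' = - c)"
proof -
  obtain b d b' d' where M: "(a, b, c, d) \<in> hecke_SL q" "(a', b', c', d') \<in> hecke_SL q"
    using assms unfolding reduced_fraction_iff by blast
  define t where "t = d * a' - b * c'"
  from hecke_mmul[OF M(2) hecke_madj[OF M(1)]]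
  have "(t, d * b' - b * d', 0, a * d' - c * b') \<in> hecke_SL q"
    using assms(3) by (simp add: t_def algebra_simps)
  from hecke_parabolic[OF this] have t: "t = 1 \<or> t = -1" .
  have det: "a * d - b * c = 1" by (rule hecke_det[OF M(1)])
  have "a * t = a' * (a * d - b * c)" using assms(3) by (simp add: t_def algebra_simps)
  moreover have "c * t = c' * (a * d - b * c)"
    using assms(3) by (simp add: t_def algebra_simps)
  ultimately show ?thesis using t det by auto
qed

subsection \<open>Inverse branches of the Farey map\<close>

lemma Kset_eq: "Kset q = Suc ` {h..<2*h}"
  by (auto simp: Kset_def image_iff Bex_def intro!: exI[of _ "_ - 1"])

lemma gk_Suc: "gk (Suc (2 * h)) (Suc j) = (s (Suc j), - s (Suc (Suc j)), - s j, s (Suc j))"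
  unfolding gk_def s_def by (simp add: add.commute)

text \<open>Partition points of the unit interval, falling from \<open>endpt h = 1\<close> to
  \<open>endpt (2 * h) = 0\<close>. The images of \<open>psi j\<close> and \<open>omega j\<close>
  fill the piece from \<open>endpt (Suc j)\<close> to \<open>endpt j\<close> and meet at
  \<open>psi j 1\<close>.\<close>

definition endpt :: "nat \<Rightarrow> real" where "endpt j = s (Suc j) / s j"

context
  fixes j :: nat and y :: real
  assumes j: "h \<le> j" "j < 2 * h" and y: "0 \<le> y"
begin

lemma s_pos_j: "0 < s j" "0 < s (Suc j)" "0 \<le> s (Suc (Suc j))"
  using s_pos[of j] s_pos[of "Suc j"] s_nonneg[of "Suc (Suc j)"] j h_pos by auto

lemma det_j: "s (Suc j) * s (Suc j) = s j * s (Suc (Suc j)) + 1"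
  using s_det[of j] by simp

lemma psi_minus: "psi j y - endpt (Suc j) = y / (s (Suc j) * den_psi j y)"
proof -
  have "s (Suc j) * den_psi (Suc j) y - s (Suc (Suc j)) * den_psi j y = y * (s (Suc j) * s (Suc j) - s j * s (Suc (Suc j)))"
    by (simp add: den_psi_def algebra_simps)
  then show ?thesis using s_pos_j den_psi_pos[OF j(2) y] det_j
    by (simp add: psi_def endpt_def divide_simps) (simp add: algebra_simps)
qed

lemma minus_psi: "endpt j - psi j y = 1 / (s j * den_psi j y)"
proof -
  have "s (Suc j) * den_psi j y - s j * den_psi (Suc j) y = s (Suc j) * s (Suc j) - s j * s (Suc (Suc j))"
    by (simp add: den_psi_def algebra_simps)
  then show ?thesis using s_pos_j den_psi_pos[OF j(2) y] det_j
    by (simp add: psi_def endpt_def divide_simps) (simp add: algebra_simps)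
qed

lemma omega_minus: "omega j y - endpt (Suc j) = 1 / (s (Suc j) * den_omega j y)"
proof -
  have "s (Suc j) * den_omega (Suc j) y - s (Suc (Suc j)) * den_omega j y = s (Suc j) * s (Suc j) - s j * s (Suc (Suc j))"
    by (simp add: den_omega_def algebra_simps)
  moreover have "0 < den_omega j y" using den_omega_pos j y by auto
  ultimately show ?thesis using s_pos_j det_j
    by (simp add: omega_def endpt_def divide_simps) (simp add: algebra_simps)
qed

lemma minus_omega: "endpt j - omega j y = y / (s j * den_omega j y)"
proof -
  have "s (Suc j) * den_omega j y - s j * den_omega (Suc j) y = y * (s (Suc j) * s (Suc j) - s j * s (Suc (Suc j)))"
    by (simp add: den_omega_def algebra_simps)
  moreover have "0 < den_omega j y" using den_omega_pos j y by auto
  ultimately show ?thesis using s_pos_j det_j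
    by (simp add: omega_def endpt_def divide_simps) (simp add: algebra_simps)
qed

lemma branch_bounds:
  shows "endpt (Suc j) \<le> psi j y" "psi j y < endpt j" "endpt (Suc j) < omega j y" "omega j y \<le> endpt j"
    and "0 < y \<Longrightarrow> endpt (Suc j) < psi j y" "0 < y \<Longrightarrow> omega j y < endpt j"
proof -
  have pos: "0 < s j * den_psi j y" "0 < s (Suc j) * den_psi j y" "0 < s j * den_omega j y" "0 < s (Suc j) * den_omega j y"
    using s_pos_j den_psi_pos[of j y] den_omega_pos[of j y] j y by auto
  have "0 \<le> psi j y - endpt (Suc j)" unfolding psi_minus using pos y by simp
  then show "endpt (Suc j) \<le> psi j y" by simp
  have "0 < endpt j - psi j y" unfolding minus_psi using pos y by simp
  then show "psi j y < endpt j" by simp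
  have "0 < omega j y - endpt (Suc j)" unfolding omega_minus using pos y by simp
  then show "endpt (Suc j) < omega j y" by simp
  have "0 \<le> endpt j - omega j y" unfolding minus_omega using pos y by simp
  then show "omega j y \<le> endpt j" by simp
  show "endpt (Suc j) < psi j y" if "0 < y"
  proof -
    have "0 < psi j y - endpt (Suc j)" unfolding psi_minus using pos that by simp
    then show ?thesis by simp
  qed
  show "omega j y < endpt j" if "0 < y"
  proof -
    have "0 < endpt j - omega j y" unfolding minus_omega using pos that by simp
    then show ?thesis by simp
  qed
qed

end

lemma endpt_h: "endpt h = 1" and endpt_2h: "endpt (2 * h) = 0"
  using s_mid s_pos[of h] h_pos by (auto simp: endpt_def)

lemma endpt_antimono: "h \<le> i \<Longrightarrow> i \<le> j \<Longrightarrow> j \<le> 2 * h \<Longrightarrow> endpt j \<le> endpt i"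
proof (induction j)
  case (Suc j)
  show ?case
  proof (cases "i = Suc j")
    case False
    then have "endpt j \<le> endpt i" "endpt (Suc j) \<le> endpt j"
      using Suc branch_bounds[of j 0] by (auto intro: order_trans less_imp_le)
    then show ?thesis by simp
  qed simp
qed simp

text \<open>By \<open>s_det\<close>, equality of the two values amounts to
  \<open>y * y' = 1\<close>.\<close>

lemma psi_omega_eq: 
  assumes "h \<le> j" "j < 2 * h" "0 \<le> y" "y \<le> 1" "0 \<le> y'" "y' \<le> 1" "psi j y = omega j y'"
  shows "y = 1 \<and> y' = 1"
proof -
  have "den_psi (Suc j) y * den_omega j y' = den_omega (Suc j) y' * den_psi j y"
    using assms den_psi_pos[of j y] den_omega_pos[of j y'] by (simp add: psi_def omega_def field_simps)
  moreover have "den_psi (Suc j) y * den_omega j y' - den_omega (Suc j) y' * den_psi j y = (s (Suc j) * s (Suc j) - s j * s (Suc (Suc j))) * (y * y' - 1)"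
    by (simp add: den_psi_def den_omega_def algebra_simps)
  ultimately have "y * y' = 1" using s_det[of j] by simp
  then show ?thesis using assms mult_left_le[of y' y] mult_left_le[of y y'] by (auto simp: mult.commute)
qed

lemma psi_inj: assumes "h \<le> j" "j < 2 * h" "0 \<le> y" "0 \<le> y'" "psi j y = psi j y'" shows "y = y'"
proof -
  have "den_psi (Suc j) y * den_psi j y' = den_psi (Suc j) y' * den_psi j y"
    using assms den_psi_pos[of j y] den_psi_pos[of j y'] by (simp add: psi_def field_simps)
  moreover have "den_psi (Suc j) y * den_psi j y' - den_psi (Suc j) y' * den_psi j y = (s (Suc j) * s (Suc j) - s j * s (Suc (Suc j))) * (y - y')"
    by (simp add: den_psi_def algebra_simps)
  ultimately show ?thesis using s_det[of j] by simp
qed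

lemma omega_inj: assumes "h \<le> j" "j < 2 * h" "0 \<le> y" "0 \<le> y'" "omega j y = omega j y'" shows "y = y'"
proof -
  have "den_omega (Suc j) y * den_omega j y' = den_omega (Suc j) y' * den_omega j y"
    using assms den_omega_pos[of j y] den_omega_pos[of j y'] by (simp add: omega_def field_simps)
  moreover have "den_omega (Suc j) y * den_omega j y' - den_omega (Suc j) y' * den_omega j y = (s (Suc j) * s (Suc j) - s j * s (Suc (Suc j))) * (y' - y)"
    by (simp add: den_omega_def algebra_simps)
  ultimately show ?thesis using s_det[of j] by simp
qed

section \<open>The Farey map as a relation between points and inverse branches\<close>

definition farey_pre :: "real \<Rightarrow> real \<Rightarrow> bool" where
  "farey_pre x y \<longleftrightarrow> 0 \<le> y \<and> y \<le> 1 \<and> (\<exists>j\<in>{h..<2*h}. x = psi j y \<or> x = omega j y)"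

lemma farey_pre_psi: "h \<le> j \<Longrightarrow> j < 2 * h \<Longrightarrow> 0 \<le> y \<and> y \<le> 1 \<and> x = psi j y \<Longrightarrow> farey_pre x y"
  and farey_pre_omega: "h \<le> j \<Longrightarrow> j < 2 * h \<Longrightarrow> 0 \<le> y \<and> y \<le> 1 \<and> x = omega j y \<Longrightarrow> farey_pre x y"
  unfolding farey_pre_def by auto

text \<open>Images with different indices can meet only in a partition point, where both branches
  start from 0; the two images of one index meet only where both start from 1. This makes the choice
  operator in \<open>farey\<close> harmless.\<close>

lemma farey_pre_unique: assumes "farey_pre x y" "farey_pre x y'" shows "y = y'"
proof -
  have aux: "y = 0 \<and> y' = 0"
    if "0 \<le> y" "0 \<le> y'" "h \<le> i" "i < j" "j < 2 * h" 
      "x = psi i y \<or> x = omega i y" "x = psi j y' \<or> x = omega j y'" for i j x y y'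
  proof -
    have r: "endpt j \<le> endpt (Suc i)" using that by (intro endpt_antimono) auto
    have i: "endpt (Suc i) \<le> x" "0 < y \<Longrightarrow> endpt (Suc i) < x"
      using branch_bounds[of i y] that by auto
    have j: "x \<le> endpt j" "0 < y' \<Longrightarrow> x < endpt j"
      using branch_bounds[of j y'] that by auto
    show ?thesis using r i j that(1,2) by (cases "0 < y"; cases "0 < y'") auto
  qed
  obtain i j where ij: "i \<in> {h..<2*h}" "x = psi i y \<or> x = omega i y" "j \<in> {h..<2*h}" "x = psi j y' \<or> x = omega j y'"
    and y: "0 \<le> y" "y \<le> 1" "0 \<le> y'" "y' \<le> 1"
    using assms unfolding farey_pre_def by blast
  consider "i < j" | "j < i" | "i = j" by linarith
  then show ?thesis
  proof cases
    case 1
    then show ?thesis using aux[of y y' i j x] ij y by auto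
  next
    case 2
    then show ?thesis using aux[of y' y j i x] ij y by auto
  next
    case 3
    then have i: "h \<le> i" "i < 2 * h" "x = psi i y' \<or> x = omega i y'" using ij by auto
    from ij(2) i(3) show ?thesis
    proof (elim disjE)
      assume "x = psi i y" "x = psi i y'"
      then show ?thesis using psi_inj[OF i(1,2) y(1,3)] by simp
    next
      assume "x = omega i y" "x = omega i y'"
      then show ?thesis using omega_inj[OF i(1,2) y(1,3)] by simp
    next
      assume "x = psi i y" "x = omega i y'"
      then show ?thesis using psi_omega_eq[OF i(1,2) y] by simp
    next
      assume "x = omega i y" "x = psi i y'"
      then show ?thesis using psi_omega_eq[OF i(1,2) y(3,4,1,2)] by simp
    qed
  qed
qed

lemma psi_branch_iff:
  assumes j: "h \<le> j" "j < 2 * h"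
  shows "x \<in> {mact (madj (gk q (Suc j))) 0..mact (madj (gk q (Suc j))) 1} \<and> y = mact (gk q (Suc j)) x
    \<longleftrightarrow> 0 \<le> y \<and> y \<le> 1 \<and> x = psi j y"
proof -
  define a b c where abc: "a = s j" "b = s (Suc j)" "c = s (Suc (Suc j))"
  have pos: "0 < a" "0 < b" "0 \<le> c" using s_pos_j[OF j order_refl] by (simp_all add: abc)
  have det: "b * b = a * c + 1" using s_det[of j] by (simp add: abc)
  have "(c / b \<le> x \<and> x \<le> (b + c) / (a + b) \<and> y = (b * x - c) / (- a * x + b)) \<longleftrightarrow>
     0 \<le> y \<and> y \<le> 1 \<and> x = (b * y + c) / (a * y + b)"
  proof
    assume L: "c / b \<le> x \<and> x \<le> (b + c) / (a + b) \<and> y = (b * x - c) / (- a * x + b)"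
    have x: "c \<le> b * x" "(a + b) * x \<le> b + c" using L pos by (simp_all add: field_simps)
    have "a * ((a + b) * x) \<le> a * (b + c)" using x pos by (intro mult_left_mono) auto
    also have "\<dots> < (a + b) * b" using det by (simp add: algebra_simps)
    finally have "(a + b) * (a * x) < (a + b) * b" by (simp add: algebra_simps)
    then have den: "0 < - a * x + b" using pos by (simp add: mult_less_cancel_left_pos)
    have y: "y * (- a * x + b) = b * x - c" using L den by simp
    then have "0 \<le> y" "y \<le> 1" using L den x by (auto simp: algebra_simps)
    moreover have "0 < a * y + b" using \<open>0 \<le> y\<close> pos by (intro add_nonneg_pos) auto
    then have "x = (b * y + c) / (a * y + b)" using y by (simp add: eq_divide_eq algebra_simps)
    ultimately show "0 \<le> y \<and> y \<le> 1 \<and> x = (b * y + c) / (a * y + b)" by simp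
  next
    assume R: "0 \<le> y \<and> y \<le> 1 \<and> x = (b * y + c) / (a * y + b)"
    have D: "0 < a * y + b" using R pos by (intro add_nonneg_pos) auto
    have xD: "x * (a * y + b) = b * y + c" using R D by simp
    have "(b * x - c) * (a * y + b) = b * (x * (a * y + b)) - c * (a * y + b)"
      "(- a * x + b) * (a * y + b) = - a * (x * (a * y + b)) + b * (a * y + b)"
      by (simp_all add: algebra_simps)
    then have "(b * x - c) * (a * y + b) = y * (b * b - a * c)" "(- a * x + b) * (a * y + b) = b * b - a * c"
      unfolding xD by (simp_all add: algebra_simps)
    then have 1: "b * x - c = y / (a * y + b)" and 2: "- a * x + b = 1 / (a * y + b)"
      using det D by (simp_all add: eq_divide_eq)
    have 3: "b + c - (a + b) * x = (1 - y) / (a * y + b)"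
      using 1 2 by (simp add: algebra_simps diff_divide_distrib)
    have "0 \<le> b * x - c" "0 \<le> b + c - (a + b) * x" unfolding 1 3 using R D by auto
    then have "c / b \<le> x" "x \<le> (b + c) / (a + b)" using pos by (simp_all add: field_simps)
    moreover have "y = (b * x - c) / (- a * x + b)" unfolding 1 2 using D by simp
    ultimately show "c / b \<le> x \<and> x \<le> (b + c) / (a + b) \<and> y = (b * x - c) / (- a * x + b)" by simp
  qed
  then show ?thesis by (simp add: gk_Suc psi_def den_psi_def abc add.commute)
qed

lemma omega_branch_iff:
  assumes j: "h \<le> j" "j < 2 * h"
  shows "x \<in> {mact (madj (mmul Qm (gk q (Suc j)))) 1..mact (madj (mmul Qm (gk q (Suc j)))) 0} 
      \<and> y = mact (mmul Qm (gk q (Suc j))) x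
    \<longleftrightarrow> 0 \<le> y \<and> y \<le> 1 \<and> x = omega j y"
proof -
  define a b c where abc: "a = s j" "b = s (Suc j)" "c = s (Suc (Suc j))"
  have pos: "0 < a" "0 < b" "0 \<le> c" using s_pos_j[OF j order_refl] by (simp_all add: abc)
  have det: "b * b = a * c + 1" using s_det[of j] by (simp add: abc)
  have main: "((b + c) / (a + b) \<le> x \<and> x \<le> b / a \<and> y = (- a * x + b) / (b * x - c)) \<longleftrightarrow>
     0 \<le> y \<and> y \<le> 1 \<and> x = (c * y + b) / (b * y + a)"
  proof
    assume L: "(b + c) / (a + b) \<le> x \<and> x \<le> b / a \<and> y = (- a * x + b) / (b * x - c)"
    have x: "b + c \<le> (a + b) * x" "a * x \<le> b" using L pos by (simp_all add: field_simps)
    have "(a + b) * c < b * (b + c)" using det by (simp add: algebra_simps)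
    also have "\<dots> \<le> b * ((a + b) * x)" using x pos by (intro mult_left_mono) auto
    finally have "(a + b) * c < (a + b) * (b * x)" by (simp add: algebra_simps)
    then have den: "0 < b * x - c" using pos by (simp add: mult_less_cancel_left_pos)
    have y: "y * (b * x - c) = - a * x + b" using L den by simp
    then have "0 \<le> y" "y \<le> 1" using L den x by (auto simp: algebra_simps)
    moreover have "0 < b * y + a" using \<open>0 \<le> y\<close> pos by (intro add_nonneg_pos) auto
    then have "x = (c * y + b) / (b * y + a)" using y by (simp add: eq_divide_eq algebra_simps)
    ultimately show "0 \<le> y \<and> y \<le> 1 \<and> x = (c * y + b) / (b * y + a)" by simp
  next
    assume R: "0 \<le> y \<and> y \<le> 1 \<and> x = (c * y + b) / (b * y + a)"
    have D: "0 < b * y + a" using R pos by (intro add_nonneg_pos) auto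
    have xD: "x * (b * y + a) = c * y + b" using R D by simp
    have "(b * x - c) * (b * y + a) = b * (x * (b * y + a)) - c * (b * y + a)"
      "(- a * x + b) * (b * y + a) = - a * (x * (b * y + a)) + b * (b * y + a)"
      by (simp_all add: algebra_simps)
    then have "(b * x - c) * (b * y + a) = b * b - a * c" "(- a * x + b) * (b * y + a) = y * (b * b - a * c)"
      unfolding xD by (simp_all add: algebra_simps)
    then have 1: "b * x - c = 1 / (b * y + a)" and 2: "- a * x + b = y / (b * y + a)"
      using det D by (simp_all add: eq_divide_eq)
    have 3: "(a + b) * x - (b + c) = (1 - y) / (b * y + a)"
      using 1 2 by (simp add: algebra_simps diff_divide_distrib)
    have "0 \<le> - a * x + b" "0 \<le> (a + b) * x - (b + c)" unfolding 2 3 using R D by auto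
    then have "x \<le> b / a" "(b + c) / (a + b) \<le> x" using pos by (simp_all add: field_simps)
    moreover have "y = (- a * x + b) / (b * x - c)" unfolding 1 2 using D by simp
    ultimately show "(b + c) / (a + b) \<le> x \<and> x \<le> b / a \<and> y = (- a * x + b) / (b * x - c)" by simp
  qed
  have neg: "(- b - c) / (- a - b) = (b + c) / (a + b)"
    using minus_divide_divide[of "b + c" "a + b"] by (simp add: algebra_simps)
  have "gk (Suc (2 * h)) (Suc j) = (b, - c, - a, b)" by (simp add: gk_Suc abc)
  then have "mmul Qm (gk (Suc (2 * h)) (Suc j)) = (- a, b, b, - c)" by (simp add: Qm_def)
  then show ?thesis using main neg by (simp add: omega_def den_omega_def abc[symmetric] add.commute)
qed

lemma farey_eq: "farey q x = (SOME y. farey_pre x y)"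
proof -
  have "farey_pre x y \<longleftrightarrow> (\<exists>j\<in>{h..<2*h}. (0 \<le> y \<and> y \<le> 1 \<and> x = psi j y) \<or> (0 \<le> y \<and> y \<le> 1 \<and> x = omega j y))" for y
    unfolding farey_pre_def by blast
  also have "\<dots> y \<longleftrightarrow> (\<exists>j\<in>{h..<2*h}. 
      (x \<in> {mact (madj (gk q (Suc j))) 0..mact (madj (gk q (Suc j))) 1} \<and> y = mact (gk q (Suc j)) x) \<or>
      (x \<in> {mact (madj (mmul Qm (gk q (Suc j)))) 1..mact (madj (mmul Qm (gk q (Suc j)))) 0} 
      \<and> y = mact (mmul Qm (gk q (Suc j))) x))" for y
    using psi_branch_iff[of _ x y] omega_branch_iff[of _ x y] by (intro bex_cong) auto
  finally have "farey_pre x y \<longleftrightarrow> (\<exists>k\<in>Kset q. 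
      (x \<in> {mact (madj (gk q k)) 0..mact (madj (gk q k)) 1} \<and> y = mact (gk q k) x) \<or>
      (x \<in> {mact (madj (mmul Qm (gk q k))) 1..mact (madj (mmul Qm (gk q k))) 0} 
      \<and> y = mact (mmul Qm (gk q k)) x))" for y
    unfolding Kset_eq by blast
  then show ?thesis unfolding farey_def by (simp only:)
qed

lemma farey_pre_exists: assumes "0 \<le> x" "x \<le> 1" shows "\<exists>y. farey_pre x y"
proof -
  define P where "P n \<longleftrightarrow> h \<le> n \<and> endpt (Suc n) \<le> x" for n
  obtain m where m: "2 * h = Suc m" "h \<le> m" using h_pos by (cases "2 * h") auto
  have "P m" unfolding P_def using assms m endpt_2h by simp
  define j where "j = (LEAST n. P n)"
  have "P j" "j \<le> m" unfolding j_def using \<open>P m\<close> by (auto intro: LeastI Least_le)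
  then have j: "h \<le> j" "j < 2 * h" "endpt (Suc j) \<le> x" using m by (auto simp: P_def)
  have "x \<le> endpt j"
  proof (cases "j = h")
    case False
    then have "\<not> P (j - 1)" using j unfolding j_def by (metis h_pos diff_less less_le_trans not_less_Least zero_less_one le_trans)
    then show ?thesis using False j by (auto simp: P_def)
  qed (use assms endpt_h in simp)
  show ?thesis
  proof (cases "x \<le> psi j 1")
    case True
    then have "x \<in> {mact (madj (gk q (Suc j))) 0..mact (madj (gk q (Suc j))) 1}"
      using j by (simp add: gk_Suc psi_def den_psi_def endpt_def)
    from farey_pre_psi[OF j(1,2) iffD1[OF psi_branch_iff[OF j(1,2)] conjI[OF this refl]]]
    show ?thesis by (rule exI)
  next
    case False
    then have "x \<in> {mact (madj (mmul Qm (gk q (Suc j)))) 1..mact (madj (mmul Qm (gk q (Suc j)))) 0}"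
    proof -
      have "(- s (Suc (Suc j)) - s (Suc j)) / (- s (Suc j) - s j) = psi j 1"
      proof -
        have "- s (Suc (Suc j)) - s (Suc j) = - (s (Suc j) * 1 + s (Suc (Suc j)))" "- s (Suc j) - s j = - (s j * 1 + s (Suc j))"
          by simp_all
        then show ?thesis by (simp only: minus_divide_divide psi_def den_psi_def)
      qed
      then show ?thesis using False \<open>x \<le> endpt j\<close> by (simp add: gk_Suc Qm_def endpt_def)
    qed
    from farey_pre_omega[OF j(1,2) iffD1[OF omega_branch_iff[OF j(1,2)] conjI[OF this refl]]]
    show ?thesis by (rule exI)
  qed
qed

lemma farey_iff: assumes "0 \<le> x" "x \<le> 1" shows "farey q x = y \<longleftrightarrow> farey_pre x y"
  using someI_ex[OF farey_pre_exists[OF assms]] farey_pre_unique unfolding farey_eq by blast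

lemma farey_range: assumes "x \<in> {0..1}" shows "farey q x \<in> {0..1}"
  using farey_iff[of x "farey q x"] assms by (auto simp: farey_pre_def)

lemma farey_pow_range: "x \<in> {0..1} \<Longrightarrow> (farey q ^^ n) x \<in> {0..1}"
  by (induction n) (auto dest: farey_range simp del: atLeastAtMost_iff)

subsection \<open>Preimage sums\<close>

definition fiber :: "nat \<Rightarrow> real \<Rightarrow> (real \<times> real) set" where
  "fiber n y = {(r, t). reduced_fraction q r t \<and> t > 0 \<and> r / t \<in> {0..1} \<and> (farey q ^^ n) (r / t) = y}"

lemma RF_fiber: "RF q n a c = fiber n (a / c)"
  by (simp add: RF_def fiber_def)

lemma fiber_disjoint: "x \<noteq> y \<Longrightarrow> fiber n x \<inter> fiber n y = {}"
  by (auto simp: fiber_def)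

text \<open>The last application of the Farey map is the one undone, so the base point moves to its
  one-step preimages. This matches \<open>transfer\<close> acting on the outside of an
  iterate.\<close>

lemma fiber_Suc:
  assumes y: "0 \<le> y" "y \<le> 1"
  shows "fiber (Suc n) y = (\<Union>j\<in>{h..<2*h}. fiber n (psi j y) \<union> fiber n (omega j y))"
proof -
  have "(farey q ^^ Suc n) x = y \<longleftrightarrow> (\<exists>j\<in>{h..<2*h}. (farey q ^^ n) x = psi j y \<or> (farey q ^^ n) x = omega j y)"
    if "x \<in> {0..1}" for x
  proof -
    have "(farey q ^^ Suc n) x = y \<longleftrightarrow> farey_pre ((farey q ^^ n) x) y"
      using farey_iff[of "(farey q ^^ n) x" y] farey_pow_range[OF that, of n] by simp
    then show ?thesis using y by (simp only: farey_pre_def simp_thms)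
  qed
  note step = this
  show ?thesis
  proof (rule set_eqI)
    fix p :: "real \<times> real"
    obtain r t where p: "p = (r, t)" by (cases p)
    show "p \<in> fiber (Suc n) y \<longleftrightarrow> p \<in> (\<Union>j\<in>{h..<2*h}. fiber n (psi j y) \<union> fiber n (omega j y))"
    proof (cases "r / t \<in> {0..1}")
      case True
      from step[OF True] show ?thesis unfolding fiber_def p by blast
    next
      case False
      then have "p \<notin> fiber m z" for m z by (auto simp: fiber_def p simp del: atLeastAtMost_iff)
      then show ?thesis by blast
    qed
  qed
qed

lemma fiber_0:
  assumes "reduced_fraction q a c" "0 < c" "0 \<le> a / c" "a / c \<le> 1"
  shows "fiber 0 (a / c) = {(a, c)}"
proof -
  have "r = a \<and> t = c" if "reduced_fraction q r t" "0 < t" "r / t = a / c" for r t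
  proof -
    have "a * t = r * c" using that assms by (simp add: field_simps)
    from reduced_fraction_unique[OF assms(1) that(1) this] show ?thesis using that assms by auto
  qed
  then show ?thesis using assms by (auto simp: fiber_def)
qed

lemma branch_less:
  assumes "h \<le> i" "i < j" "j < 2 * h" "0 < y" "x \<in> {psi j y, omega j y}" "z \<in> {psi i y, omega i y}"
  shows "x < z"
proof -
  have "x < endpt j" using branch_bounds[of j y] assms by auto
  also have "endpt j \<le> endpt (Suc i)" using assms by (intro endpt_antimono) auto
  also have "endpt (Suc i) < z" using branch_bounds[of i y] assms by auto
  finally show ?thesis .
qed

lemma branch_interior:
  assumes "h \<le> j" "j < 2 * h" "0 < y" "x \<in> {psi j y, omega j y}"
  shows "0 < x" "x < 1"
proof -
  have "x < endpt j" using branch_bounds[of j y] assms by auto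
  also have "endpt j \<le> 1" using assms endpt_antimono[of h j] endpt_h by auto
  finally show "x < 1" .
  have "0 \<le> endpt (Suc j)" using assms endpt_antimono[of "Suc j" "2 * h"] endpt_2h by auto
  also have "endpt (Suc j) < x" using branch_bounds[of j y] assms by auto
  finally show "0 < x" .
qed

lemma psi_fraction:
  assumes "reduced_fraction q a c" "0 < c" "0 \<le> a / c" "j < 2 * h"
  obtains a' where "reduced_fraction q a' (c * den_psi j (a / c))" "0 < c * den_psi j (a / c)" "a' / (c * den_psi j (a / c)) = psi j (a / c)"
proof
  have U: "s i * a + s (Suc i) * c = c * den_psi i (a / c)" for i
    using assms by (simp add: den_psi_def field_simps)
  show "0 < c * den_psi j (a / c)" using den_psi_pos[of j "a / c"] assms by simp
  show "reduced_fraction q (c * den_psi (Suc j) (a / c)) (c * den_psi j (a / c))"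
    using reduced_fraction_mmul[OF assms(1) branch_hecke[of j]] unfolding U .
  show "c * den_psi (Suc j) (a / c) / (c * den_psi j (a / c)) = psi j (a / c)"
    using assms by (simp add: psi_def)
qed

lemma omega_fraction:
  assumes "reduced_fraction q a c" "0 < c" "0 \<le> a / c" "h \<le> j" "j < 2 * h"
  obtains a' where "reduced_fraction q a' (c * den_omega j (a / c))" "0 < c * den_omega j (a / c)" "a' / (c * den_omega j (a / c)) = omega j (a / c)"
proof
  have V: "s i * c + s (Suc i) * a = c * den_omega i (a / c)" for i
    using assms by (simp add: den_omega_def field_simps)
  show "0 < c * den_omega j (a / c)" using den_omega_pos[of j "a / c"] assms by simp
  show "reduced_fraction q (c * den_omega (Suc j) (a / c)) (c * den_omega j (a / c))"
    using reduced_fraction_mmul[OF reduced_fraction_swap[OF assms(1)] branch_hecke[of j]] unfolding V .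
  show "c * den_omega (Suc j) (a / c) / (c * den_omega j (a / c)) = omega j (a / c)"
    using assms by (simp add: omega_def)
qed

text \<open>Pulling a fraction with denominator \<open>c\<close> back along a branch multiplies the
  denominator by \<open>den_psi j y\<close> or \<open>den_omega j y\<close>, so
  \<open>1/t\<^sup>2\<close> reproduces the weights of \<open>transfer\<close>. Strictly between 0
  and 1 the one-step preimages are distinct and again interior, hence the induction closes.\<close>

lemma fiber_sum:
  assumes "reduced_fraction q a c" "0 < c" "0 < a / c" "a / c < 1"
  shows "finite (fiber n (a / c)) \<and> (\<Sum>(r, t)\<in>fiber n (a / c). f (r / t) / t\<^sup>2) = (transfer ^^ n) f (a / c) / c\<^sup>2"
  using assms
proof (induction n arbitrary: a c)
  case 0
  then show ?case by (simp add: fiber_0)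
next
  case (Suc n)
  define y where "y = a / c"
  have y: "0 < y" "y < 1" using Suc.prems by (auto simp: y_def)
  have psi: "finite (fiber n (psi j y)) \<and> (\<Sum>(r, t)\<in>fiber n (psi j y). f (r / t) / t\<^sup>2) = (transfer ^^ n) f (psi j y) / (c * den_psi j y)\<^sup>2"
    if "j \<in> {h..<2*h}" for j
  proof -
    have j: "h \<le> j" "j < 2 * h" using that by auto
    obtain a' where a': "reduced_fraction q a' (c * den_psi j y)" "0 < c * den_psi j y" "a' / (c * den_psi j y) = psi j y"
      using psi_fraction[OF Suc.prems(1,2) _ j(2)] y unfolding y_def by (metis less_imp_le)
    then show ?thesis using Suc.IH[OF a'(1,2)] branch_interior[OF j y(1), of "psi j y"] by simp
  qed
  have omega: "finite (fiber n (omega j y)) \<and> (\<Sum>(r, t)\<in>fiber n (omega j y). f (r / t) / t\<^sup>2) = (transfer ^^ n) f (omega j y) / (c * den_omega j y)\<^sup>2"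
    if "j \<in> {h..<2*h}" for j
  proof -
    have j: "h \<le> j" "j < 2 * h" using that by auto
    obtain a' where a': "reduced_fraction q a' (c * den_omega j y)" "0 < c * den_omega j y" "a' / (c * den_omega j y) = omega j y"
      using omega_fraction[OF Suc.prems(1,2) _ j] y unfolding y_def by (metis less_imp_le)
    then show ?thesis using Suc.IH[OF a'(1,2)] branch_interior[OF j y(1), of "omega j y"] by simp
  qed
  define A where "A j = fiber n (psi j y) \<union> fiber n (omega j y)" for j
  have A: "finite (A j)" 
    "(\<Sum>(r, t)\<in>A j. f (r / t) / t\<^sup>2) = ((transfer ^^ n) f (psi j y) / (den_psi j y)\<^sup>2 + (transfer ^^ n) f (omega j y) / (den_omega j y)\<^sup>2) / c\<^sup>2"
    if "j \<in> {h..<2*h}" for j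
  proof -
    have "psi j y \<noteq> omega j y" using psi_omega_eq[of j y y] y that by auto
    then have "(\<Sum>(r, t)\<in>A j. f (r / t) / t\<^sup>2) = 
        (\<Sum>(r, t)\<in>fiber n (psi j y). f (r / t) / t\<^sup>2) + (\<Sum>(r, t)\<in>fiber n (omega j y). f (r / t) / t\<^sup>2)"
      unfolding A_def using psi[OF that] omega[OF that] fiber_disjoint by (intro sum.union_disjoint) auto
    then show "(\<Sum>(r, t)\<in>A j. f (r / t) / t\<^sup>2) = ((transfer ^^ n) f (psi j y) / (den_psi j y)\<^sup>2 + (transfer ^^ n) f (omega j y) / (den_omega j y)\<^sup>2) / c\<^sup>2"
      using psi[OF that] omega[OF that] by (simp add: add_divide_distrib power_mult_distrib mult.commute)
    show "finite (A j)" unfolding A_def using psi[OF that] omega[OF that] by simp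
  qed
  have disj: "A i \<inter> A j = {}" if "i \<in> {h..<2*h}" "j \<in> {h..<2*h}" "i \<noteq> j" for i j
  proof -
    have "x \<noteq> z" if "x \<in> {psi i y, omega i y}" "z \<in> {psi j y, omega j y}" for x z
      using branch_less[of i j y z x] branch_less[of j i y x z] that \<open>i \<in> _\<close> \<open>j \<in> _\<close> \<open>i \<noteq> j\<close> y
      by (cases "i < j") auto
    then have "fiber n x \<inter> fiber n z = {}" if "x \<in> {psi i y, omega i y}" "z \<in> {psi j y, omega j y}" for x z
      using that by (intro fiber_disjoint) blast
    then show ?thesis unfolding A_def by blast
  qed
  have fib: "fiber (Suc n) y = (\<Union>j\<in>{h..<2*h}. A j)"
    unfolding A_def by (rule fiber_Suc) (use y in simp_all)
  have "(\<Sum>(r, t)\<in>fiber (Suc n) y. f (r / t) / t\<^sup>2) = (\<Sum>j\<in>{h..<2*h}. \<Sum>(r, t)\<in>A j. f (r / t) / t\<^sup>2)"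
    unfolding fib
  proof (rule sum.UNION_disjoint)
    show "\<forall>j\<in>{h..<2*h}. finite (A j)" using A(1) by blast
    show "\<forall>i\<in>{h..<2*h}. \<forall>j\<in>{h..<2*h}. i \<noteq> j \<longrightarrow> A i \<inter> A j = {}" using disj by blast
  qed simp
  also have "\<dots> = transfer ((transfer ^^ n) f) y / c\<^sup>2"
    by (simp add: A(2) transfer_def sum_divide_distrib)
  finally show ?case using A(1) by (simp add: fib y_def[symmetric])
qed

text \<open>At 1 the branches \<open>psi j\<close> and \<open>omega j\<close> coincide, whence the
  factor 2. Their values are interior, so \<open>fiber_sum\<close> takes over after one step. At
  least one step is essential: the fiber at time 0 is a single fraction, which the operator does not
  double.\<close>

lemma fiber_sum_1:
  assumes "reduced_fraction q a c" "0 < c" "a / c = 1"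
  shows "2 * (\<Sum>(r, t)\<in>fiber (Suc n) 1. f (r / t) / t\<^sup>2) = (transfer ^^ Suc n) f 1 / c\<^sup>2"
proof -
  have psi: "finite (fiber n (psi j 1)) \<and> (\<Sum>(r, t)\<in>fiber n (psi j 1). f (r / t) / t\<^sup>2) = (transfer ^^ n) f (psi j 1) / (c * den_psi j 1)\<^sup>2"
    if "j \<in> {h..<2*h}" for j
  proof -
    have j: "h \<le> j" "j < 2 * h" using that by auto
    obtain a' where a': "reduced_fraction q a' (c * den_psi j 1)" "0 < c * den_psi j 1" "a' / (c * den_psi j 1) = psi j 1"
      using psi_fraction[OF assms(1,2) _ j(2)] unfolding assms(3) by (metis zero_le_one)
    then show ?thesis using fiber_sum[OF a'(1,2), of n f] branch_interior[OF j zero_less_one, of "psi j 1"] by simp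
  qed
  have disj: "fiber n (psi i 1) \<inter> fiber n (psi j 1) = {}" if "i \<in> {h..<2*h}" "j \<in> {h..<2*h}" "i \<noteq> j" for i j
    using branch_less[of i j 1 "psi j 1" "psi i 1"] branch_less[of j i 1 "psi i 1" "psi j 1"] that
    by (intro fiber_disjoint) (cases "i < j"; auto)
  have "fiber (Suc n) 1 = (\<Union>j\<in>{h..<2*h}. fiber n (psi j 1))"
    by (subst fiber_Suc) (simp_all add: psi_omega_1)
  then have "(\<Sum>(r, t)\<in>fiber (Suc n) 1. f (r / t) / t\<^sup>2) = (\<Sum>j\<in>{h..<2*h}. \<Sum>(r, t)\<in>fiber n (psi j 1). f (r / t) / t\<^sup>2)"
    using psi disj by (simp only:) (intro sum.UNION_disjoint, auto)
  also have "\<dots> = (\<Sum>j\<in>{h..<2*h}. (transfer ^^ n) f (psi j 1) / (den_psi j 1)\<^sup>2) / c\<^sup>2"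
    by (simp add: psi sum_divide_distrib power_mult_distrib mult.commute)
  finally have "2 * (\<Sum>(r, t)\<in>fiber (Suc n) 1. f (r / t) / t\<^sup>2) = 2 * (\<Sum>j\<in>{h..<2*h}. (transfer ^^ n) f (psi j 1) / (den_psi j 1)\<^sup>2) / c\<^sup>2"
    by simp
  moreover have "den_omega j 1 = den_psi j 1" for j by (simp add: den_psi_def den_omega_def add.commute)
  then have "transfer ((transfer ^^ n) f) 1 = 2 * (\<Sum>j\<in>{h..<2*h}. (transfer ^^ n) f (psi j 1) / (den_psi j 1)\<^sup>2)"
    by (simp add: transfer_def psi_omega_1 sum_distrib_left)
  ultimately show ?thesis by simp
qed

lemma RF_sum:
  assumes "reduced_fraction q a c" "c \<noteq> 0" "0 < a / c" "a / c \<le> 1" "1 \<le> n"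
  shows "cconst (a / c) * a * c * (\<Sum>(r, t)\<in>RF q n a c. f (r / t) / t\<^sup>2) = a / c * (transfer ^^ n) f (a / c)"
proof -
  have pos: "cconst (a / c) * a * c * (\<Sum>(r, t)\<in>RF q n a c. f (r / t) / t\<^sup>2) = a / c * (transfer ^^ n) f (a / c)"
    if a: "reduced_fraction q a c" "0 < c" "0 < a / c" "a / c \<le> 1" for a c
  proof (cases "a / c = 1")
    case True
    obtain m where "n = Suc m" using assms(5) by (cases n) auto
    then have S: "2 * (\<Sum>(r, t)\<in>RF q n a c. f (r / t) / t\<^sup>2) = (transfer ^^ n) f 1 / c\<^sup>2"
      using fiber_sum_1[OF a(1,2) True, of f m] unfolding RF_fiber True by (simp only:)
    have "a = c" using True a(2) by simp
    then have "2 * a * c * (\<Sum>(r, t)\<in>RF q n a c. f (r / t) / t\<^sup>2) = 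
        c\<^sup>2 * (2 * (\<Sum>(r, t)\<in>RF q n a c. f (r / t) / t\<^sup>2))"
      by (simp only: power2_eq_square mult_ac)
    then show ?thesis unfolding S True using a(2) by (simp add: cconst_def)
  next
    case False
    then have S: "(\<Sum>(r, t)\<in>RF q n a c. f (r / t) / t\<^sup>2) = (transfer ^^ n) f (a / c) / c\<^sup>2"
      using fiber_sum[OF a(1,2,3), of n f] a(4) unfolding RF_fiber by linarith
    show ?thesis unfolding S using False a(2) by (simp add: cconst_def power2_eq_square)
  qed
  show ?thesis
  proof (cases "0 < c")
    case True
    then show ?thesis using assms by (intro pos)
  next
    case False
    \<comment> \<open>A negative denominator is handled by the other representative of the class:
      \<open>a / c\<close> and \<open>a * c\<close> are unchanged.\<close>
    then show ?thesis using pos[of "- a" "- c"] reduced_fraction_uminus[OF assms(1)] assms(2-4)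
      unfolding RF_fiber by simp
  qed
qed

lemma RF_asymptotics:
  assumes "reduced_fraction q a c" "c \<noteq> 0" "0 < a / c" "a / c \<le> 1" "continuous_on {0..1} f"
  shows "(\<lambda>n. cconst (a / c) * a * c * ln (real n) * (\<Sum>(r, t)\<in>RF q n a c. f (r / t) / t\<^sup>2))
    \<longlonglongrightarrow> integral {0..1} f"
proof (rule Lim_transform_eventually)
  show "(\<lambda>n. a / c * (transfer ^^ n) f (a / c) * ln (real n)) \<longlonglongrightarrow> integral {0..1} f"
    by (rule transfer_pow_asymptotics[OF assms(5,3,4)])
  show "\<forall>\<^sub>F n in sequentially. a / c * (transfer ^^ n) f (a / c) * ln (real n) = 
     cconst (a / c) * a * c * ln (real n) * (\<Sum>(r, t)\<in>RF q n a c. f (r / t) / t\<^sup>2)"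
    using eventually_ge_at_top[of 1]
  proof eventually_elim
    case (elim n)
    show ?case unfolding RF_sum[OF assms(1-4) elim, of f, symmetric] by (simp only: mult_ac)
  qed
qed

end

theorem theorem1p3:
  fixes q :: nat and v w :: real
  assumes "q \<ge> 3" and "odd q"
    and "reduced_fraction q v w" and "w \<noteq> 0" and "0 < v / w" and "v / w \<le> 1"
  shows "\<forall>f. continuous_on {0..1} f \<longrightarrow>
     ((\<lambda>n. cconst (v / w) * v * w * ln (real n) *
            (\<Sum>(r,s)\<in>RF q n v w. f (r / s) / s\<^sup>2))
        \<longlongrightarrow> integral {0..1} (f :: real \<Rightarrow> real)) sequentially"
proof -
  obtain h where q: "q = 2 * h + 1" using \<open>odd q\<close> by (rule oddE)
  then interpret hecke_odd h using \<open>q \<ge> 3\<close> by unfold_locales simp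
  show ?thesis
    using RF_asymptotics assms(3-) unfolding q by blast
qed

end
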